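(* Let $X$ be a Tychonoff space. Then the following are equivalent: (1) some power $X^{\kappa}$ of $X$ (with $\kappa \geq 1$ a cardinal) has a finite basic family; (2) for all positive integers $m, n$, there is a positive integer $r$ and there are functions $\psi^{pq} \in C(X, \mathbb{R}^n)$, for $q = 1, \ldots, r$ and $p = 1, \ldots, m$, such that every $f \in C(X^m, \mathbb{R}^n)$ can be written \[ f(x_1, \ldots, x_m) = \sum_{q=1}^{r} g_q\left( \sum_{p=1}^{m} \psi^{pq}(x_p) \right) \quad \text{for all } (x_1,\ldots,x_m) \in X^m, \] for some $g_1, \ldots, g_r \in C(\mathbb{R}^n, \mathbb{R}^n)$ (depending on $f$); (3) $X$ is a locally compact, finite dimensional, separable metrizable space, or equivalently, $X$ is homeomorphic to a closed subspace of a Euclidean space $\mathbb{R}^{\ell}$ for some $\ell$.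
   Context: For topological spaces $X, Y$, $C(X,Y)$ denotes the set of all continuous maps from $X$ to $Y$, and $C(X) = C(X, \mathbb{R})$. A Tychonoff space is a completely regular Hausdorff space. Powers of $X$ carry the product topology. A family $\Phi \subseteq C(X)$ is said to be basic for a topological space $X$ if each $f \in C(X)$ can be written $f = \sum_{q=1}^{n} (g_q \circ \phi_q)$ for some $n \in \mathbb{N}$, some $\phi_1, \ldots, \phi_n$ in $\Phi$ and some functions $g_1, \ldots, g_n \in C(\mathbb{R})$. A space has a finite basic family if there is a finite $\Phi$ which is basic for it. "Finite dimensional" refers to topological (covering) dimension. *)

theory Defs
  imports "HOL-Analysis.Analysis"
begin

definition basic_family :: "'a topology \<Rightarrow> ('a \<Rightarrow> real) set \<Rightarrow> bool" where
  "basic_family X \<Phi> \<longleftrightarrow>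
     (\<forall>\<phi>\<in>\<Phi>. continuous_map X euclideanreal \<phi>) \<and>
     (\<forall>f. continuous_map X euclideanreal f \<longrightarrow>
        (\<exists>(n::nat) \<phi> g.
           (\<forall>q\<in>{1..n}. \<phi> q \<in> \<Phi> \<and> continuous_map euclideanreal euclideanreal (g q)) \<and>
           (\<forall>x\<in>topspace X. f x = (\<Sum>q=1..n. g q (\<phi> q x)))))"

definition has_finite_basic_family :: "'a topology \<Rightarrow> bool" where
  "has_finite_basic_family X \<longleftrightarrow> (\<exists>\<Phi>. finite \<Phi> \<and> basic_family X \<Phi>)"

definition tychonoff_space :: "'a topology \<Rightarrow> bool" where
  "tychonoff_space X \<longleftrightarrow> completely_regular_space X \<and> Hausdorff_space X"

(* Lebesgue covering dimension at most d, via finite open covers.  (The library's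
   dimension_le is the small inductive dimension.) *)
definition covering_dimension_le :: "'a topology \<Rightarrow> nat \<Rightarrow> bool" where
  "covering_dimension_le X d \<longleftrightarrow>
     (\<forall>\<U>. finite \<U> \<and> (\<forall>U\<in>\<U>. openin X U) \<and> \<Union>\<U> = topspace X \<longrightarrow>
        (\<exists>\<V>. finite \<V> \<and> (\<forall>V\<in>\<V>. openin X V) \<and> \<Union>\<V> = topspace X \<and>
             (\<forall>V\<in>\<V>. \<exists>U\<in>\<U>. V \<subseteq> U) \<and>
             (\<forall>x\<in>topspace X. card {V\<in>\<V>. x \<in> V} \<le> d + 1)))"

definition finite_dimensional_space :: "'a topology \<Rightarrow> bool" where
  "finite_dimensional_space X \<longleftrightarrow> (\<exists>d. covering_dimension_le X d)"

(* X^m is indexed by {1..m}; a vector of R^n is a real sequence vanishing from index n on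
   (Euclidean_space n), so sums of vectors are written out coordinatewise. *)
definition superposition_property :: "'a topology \<Rightarrow> bool" where
  "superposition_property X \<longleftrightarrow>
     (\<forall>m\<ge>1. \<forall>n\<ge>1. \<exists>r\<ge>1. \<exists>\<psi> :: nat \<Rightarrow> nat \<Rightarrow> 'a \<Rightarrow> nat \<Rightarrow> real.
        (\<forall>p\<in>{1..m}. \<forall>q\<in>{1..r}. continuous_map X (Euclidean_space n) (\<psi> p q)) \<and>
        (\<forall>f. continuous_map (product_topology (\<lambda>_. X) {1..m}) (Euclidean_space n) f \<longrightarrow>
           (\<exists>g. (\<forall>q\<in>{1..r}. continuous_map (Euclidean_space n) (Euclidean_space n) (g q)) \<and>
                (\<forall>x\<in>topspace (product_topology (\<lambda>_. X) {1..m}).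
                   f x = (\<lambda>j. \<Sum>q=1..r. g q (\<lambda>i. \<Sum>p=1..m. \<psi> p q (x p) i) j)))))"

end

theory Submission
  imports Defs
begin

text \<open>
  Two implications are soft. The superposition property for \<open>m = n = 1\<close> says that \<open>X\<close> has a finite basic
  family. A finite basic family of a power of \<open>X\<close> restricts along the diagonal to one of \<open>X\<close>, and the
  map into \<open>\<real>\<^sup>l\<close> whose coordinates are the basic functions is a closed embedding: every continuous
  function on \<open>X\<close> is the restriction of a continuous function on \<open>\<real>\<^sup>l\<close>, which for \<open>1 / dist (h x) p\<close> excludes
  limit points \<open>p\<close> outside the image.

  The main implication is a version of Kolmogorov's superposition theorem, proved as by Kahane from families
  of small disjoint compact pieces (one family for each of \<open>R\<close> colors, every point being covered in most colors)
  and from functions whose sums separate the products of pieces. The non-compactness of \<open>X\<close> requires two more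
  ideas. First, \<open>X = K - {\<omega>}\<close> for a compact \<open>K\<close>, and a function on \<open>X\<^sup>m\<close> is a sum of functions, one for each \<open>p\<close>,
  that vanish unless the \<open>p\<close>-th coordinate is about the farthest one; such a function extends by 0 to
  all values in \<open>K\<close> of the other coordinates, so only one coordinate is non-compact. Secondly, that coordinate is
  cut into compact cells separated by zones, and the outer functions \<open>g\<^sub>k\<close> are used in differences \<open>g\<^sub>k \<circ> \<psi>\<^sub>1 - g\<^sub>k \<circ> \<psi>\<^sub>0\<close> with
  \<open>\<psi>\<^sub>1 = \<psi>\<^sub>0\<close> over the zones; hence the approximation errors never leak from one cell into another, however fast
  the function grows.
\<close>

subsection \<open>Generic functions separating boxes\<close>

text \<open>The inner functions have to be fixed before \<open>f\<close> is known, so they cannot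
  depend on its modulus of continuity. Hence the same functions must separate boxes at every scale
  \<open>\<epsilon>\<close>: the pieces are chosen after \<open>f\<close>, the functions are not.
  One round of approximation multiplies the sup norm by 3/4: 1/2 is the oscillation of
  \<open>f\<close> on small boxes, and 1/4 is the cost of the colors that miss a coordinate. There
  are at most \<open>m * b\<close> of these, each with an error of at most \<open>3 * M / R\<close>,
  whence the condition \<open>12 * m * b \<le> R\<close>.

  Without compactness \<open>f\<close> may be unbounded and there is no norm to contract. Each cell
  therefore has outer functions of its own, supported in a bounded interval, and an offset added to
  the inner functions sends different cells to intervals far apart. A continuous offset cannot avoid
  intermediate values between two cells; it takes them over the zones, where the two tags agree and
  the difference is 0 whatever the outer function is. This handles only functions that vanish over
  the zones, so two systems of cells, shifted by half a period, are used together with a partition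
  of unity.\<close>

lemma sign_independent_approx_aux:
  fixes y :: "'i \<Rightarrow> real"
  assumes "finite S" "\<delta> > 0"
  shows "\<exists>c. (\<forall>s\<in>S. \<bar>c s - y s\<bar> \<le> \<delta>) \<and>
    (\<forall>n. (\<forall>s. n s \<in> {-1,0,1}) \<and> (\<exists>s\<in>S. n s \<noteq> 0) \<longrightarrow> (\<Sum>s\<in>S. n s * c s) \<noteq> 0)"
  using assms(1)
proof (induction S)
  case empty
  then show ?case by auto
next
  case (insert s S)
  then obtain c where c1: "\<forall>t\<in>S. \<bar>c t - y t\<bar> \<le> \<delta>"
    and c2: "\<forall>n. (\<forall>t. n t \<in> {-1,0,1}) \<and> (\<exists>t\<in>S. n t \<noteq> 0) \<longrightarrow> (\<Sum>t\<in>S. n t * c t) \<noteq> 0"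
    by blast
  \<comment> \<open>The finitely many values of relations among the earlier numbers. A relation that
    involves \<open>s\<close> has the coefficient 1 or -1 there, so it can vanish only if
    \<open>z\<close> lies in this set, and an interval of positive length contains other
    values.\<close>
  define V where "V = (\<lambda>n. \<Sum>t\<in>S. n t * c t) ` (S \<rightarrow>\<^sub>E {-1,0,1})"
  have "finite V"
    unfolding V_def using insert.hyps by (intro finite_imageI finite_PiE) auto
  moreover have "infinite {y s..y s + \<delta>}"
    using assms(2) by (simp add: infinite_Icc)
  ultimately obtain z where z: "z \<in> {y s..y s + \<delta>}" "z \<notin> V"
    by (meson finite_subset subsetI)
  have VI: "(\<Sum>t\<in>S. n t * c t) \<in> V" if "\<And>t. n t \<in> {-1,0,1}" for n
  proof -
    have "(\<Sum>t\<in>S. n t * c t) = (\<Sum>t\<in>S. restrict n S t * c t)"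
      by (intro sum.cong) auto
    moreover have "restrict n S \<in> S \<rightarrow>\<^sub>E {-1,0,1}" using that by auto
    ultimately show ?thesis unfolding V_def by blast
  qed
  show ?case
  proof (intro exI[of _ "c(s := z)"] conjI allI impI ballI)
    fix t assume "t \<in> insert s S"
    then show "\<bar>(c(s := z)) t - y t\<bar> \<le> \<delta>" using c1 z insert.hyps by auto
  next
    fix n :: "'i \<Rightarrow> real"
    assume n: "(\<forall>t. n t \<in> {-1,0,1}) \<and> (\<exists>t\<in>insert s S. n t \<noteq> 0)"
    have eq: "(\<Sum>t\<in>insert s S. n t * (c(s := z)) t) = n s * z + (\<Sum>t\<in>S. n t * c t)"
    proof -
      have "(\<Sum>t\<in>S. n t * (c(s := z)) t) = (\<Sum>t\<in>S. n t * c t)"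
        using insert.hyps by (intro sum.cong) auto
      then show ?thesis using insert.hyps by simp
    qed
    show "(\<Sum>t\<in>insert s S. n t * (c(s := z)) t) \<noteq> 0"
    proof (cases "n s = 0")
      case True
      then show ?thesis using eq c2 n by auto
    next
      case False
      then have ns: "n s = 1 \<or> n s = -1" using n by auto
      have "(\<Sum>t\<in>S. (- n s * n t) * c t) \<in> V"
        using VI[of "\<lambda>t. - n s * n t"] n ns by fastforce
      then have "- n s * (\<Sum>t\<in>S. n t * c t) \<in> V"
        by (simp add: sum_distrib_left sum_negf mult.assoc)
      then have "z \<noteq> - n s * (\<Sum>t\<in>S. n t * c t)" using z by auto
      then show ?thesis using ns eq by auto
    qed
  qed
qed

text \<open>Only the restriction of a sign vector to \<open>S\<close> counts, so the nonzero
  relations take finitely many values and have a uniform gap \<open>\<mu>\<close> from 0. The gap is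
  what lets separation survive small changes of the functions.\<close>

lemma sign_independent_approx:
  fixes y :: "'i \<Rightarrow> real"
  assumes "finite S" "\<delta> > 0"
  obtains c \<mu> where "\<mu> > 0" "\<And>s. s \<in> S \<Longrightarrow> \<bar>c s - y s\<bar> \<le> \<delta>"
    "\<And>n s. (\<And>t. n t \<in> {-1,0,1}) \<Longrightarrow> s \<in> S \<Longrightarrow> n s \<noteq> 0 \<Longrightarrow> \<mu> \<le> \<bar>\<Sum>s\<in>S. n s * c s\<bar>"
proof -
  obtain c where c1: "\<forall>t\<in>S. \<bar>c t - y t\<bar> \<le> \<delta>"
    and c2: "\<forall>n. (\<forall>t. n t \<in> {-1,0,1}) \<and> (\<exists>t\<in>S. n t \<noteq> 0) \<longrightarrow> (\<Sum>t\<in>S. n t * c t) \<noteq> 0"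
    using sign_independent_approx_aux[OF assms, of y] by blast
  \<comment> \<open>For empty \<open>S\<close> there is no nonzero value; the inserted 1 keeps the
    minimum defined.\<close>
  define V where "V = insert 1 ((\<lambda>n. \<bar>\<Sum>t\<in>S. n t * c t\<bar>) ` (S \<rightarrow>\<^sub>E {-1,0,1}) - {0})"
  have fV: "finite V"
    unfolding V_def using assms by (intro finite_insert[THEN iffD2] finite_Diff finite_imageI finite_PiE) auto
  show ?thesis
  proof
    show "Min V > 0" using fV by (subst Min_gr_iff) (auto simp: V_def)
    show "\<And>s. s \<in> S \<Longrightarrow> \<bar>c s - y s\<bar> \<le> \<delta>" using c1 by blast
    fix n s assume n: "\<And>t. n t \<in> {-1,0,1::real}" and s: "s \<in> S" "n s \<noteq> 0"
    have "\<bar>\<Sum>t\<in>S. n t * c t\<bar> = \<bar>\<Sum>t\<in>S. restrict n S t * c t\<bar>"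
      by (intro arg_cong[of _ _ abs] sum.cong) auto
    moreover have "restrict n S \<in> S \<rightarrow>\<^sub>E {-1,0,1}" using n by auto
    ultimately have "\<bar>\<Sum>t\<in>S. n t * c t\<bar> \<in> (\<lambda>n. \<bar>\<Sum>t\<in>S. n t * c t\<bar>) ` (S \<rightarrow>\<^sub>E {-1,0,1})" by (rule image_eqI)
    moreover have "(\<Sum>t\<in>S. n t * c t) \<noteq> 0" using c2 n s by blast
    ultimately have "\<bar>\<Sum>t\<in>S. n t * c t\<bar> \<in> V" unfolding V_def by auto
    then show "Min V \<le> \<bar>\<Sum>s\<in>S. n s * c s\<bar>" using fV by simp
  qed
qed

text \<open>It is the difference between the prescribed values and \<open>\<phi>\<close> that is
  extended, not the prescribed values themselves: the difference is bounded by
  \<open>\<delta>\<close>, Tietze's theorem preserves the bound, and so the result stays close to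
  \<open>\<phi>\<close> on all of \<open>K\<close>.\<close>

lemma Tietze_locally_constant:
  fixes K :: "'b::{metric_space,second_countable_topology} set" and \<phi> :: "'b \<Rightarrow> real"
  assumes "compact K" "finite \<A>" "disjoint \<A>" "\<And>A. A \<in> \<A> \<Longrightarrow> compact A \<and> A \<subseteq> K"
    and "closed T" "T \<subseteq> K" "continuous_on K \<phi>" "\<And>x. x \<in> T \<Longrightarrow> \<phi> x = 0"
    and "\<And>A. A \<in> \<A> \<Longrightarrow> A \<inter> T \<noteq> {} \<Longrightarrow> d A = 0"
    and "\<And>A x. A \<in> \<A> \<Longrightarrow> x \<in> A \<Longrightarrow> \<bar>d A - \<phi> x\<bar> \<le> \<delta>" "\<delta> > 0"
  obtains \<psi> where "continuous_on K \<psi>" "\<And>A x. A \<in> \<A> \<Longrightarrow> x \<in> A \<Longrightarrow> \<psi> x = d A"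
    "\<And>x. x \<in> T \<Longrightarrow> \<psi> x = 0" "\<And>x. x \<in> K \<Longrightarrow> \<bar>\<psi> x - \<phi> x\<bar> \<le> \<delta>"
proof -
  define F where "F x = (if x \<in> T then 0 else d (THE A. A \<in> \<A> \<and> x \<in> A))" for x
  have FA: "F x = d A" if "A \<in> \<A>" "x \<in> A" for A x
  proof -
    have "(THE A. A \<in> \<A> \<and> x \<in> A) = A"
      using that assms(3) by (intro the_equality) (auto simp: disjoint_def)
    then show ?thesis unfolding F_def using that assms(9) by auto
  qed
  have FT: "F x = 0" if "x \<in> T" for x using that by (simp add: F_def)
  have clA: "closed (\<Union>\<A>)" using assms(2,4) by (intro closed_Union) (auto intro: compact_imp_closed)
  have "continuous_on (\<Union>A\<in>\<A>. A) F"
  proof (rule continuous_on_closed_Union)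
    show "finite \<A>" by fact
    show "\<And>A. A \<in> \<A> \<Longrightarrow> closed A" using assms(4) compact_imp_closed by blast
    show "continuous_on A F" if "A \<in> \<A>" for A
      using FA[OF that] by (simp cong: continuous_on_cong_simp)
  qed
  moreover have "continuous_on T F"
    using FT by (simp cong: continuous_on_cong_simp)
  ultimately have cF: "continuous_on (\<Union>\<A> \<union> T) F"
    using clA assms(5) by (intro continuous_on_closed_Un) auto
  have sub: "\<Union>\<A> \<union> T \<subseteq> K" using assms(4,6) by blast
  have "continuous_on (\<Union>\<A> \<union> T) (\<lambda>x. F x - \<phi> x)"
    using cF continuous_on_subset[OF assms(7) sub] by (intro continuous_intros)
  moreover have "closedin (top_of_set K) (\<Union>\<A> \<union> T)"
    using clA assms(5) sub by (simp add: closed_subset closed_Un)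
  moreover have "norm (F x - \<phi> x) \<le> \<delta>" if "x \<in> \<Union>\<A> \<union> T" for x
    using that FA FT assms(8,10,11) by auto
  ultimately obtain h where h: "continuous_on K h" "\<And>x. x \<in> \<Union>\<A> \<union> T \<Longrightarrow> h x = F x - \<phi> x"
    "\<And>x. x \<in> K \<Longrightarrow> norm (h x) \<le> \<delta>"
    using Tietze[of "\<Union>\<A> \<union> T" "\<lambda>x. F x - \<phi> x" K \<delta>] assms(11) by auto
  show ?thesis
  proof (rule that[of "\<lambda>x. \<phi> x + h x"])
    show "continuous_on K (\<lambda>x. \<phi> x + h x)" using h(1) assms(7) by (intro continuous_intros)
    show "\<phi> x + h x = d A" if "A \<in> \<A>" "x \<in> A" for A x
    proof -
      have "h x = F x - \<phi> x" using h(2) that by blast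
      then show ?thesis using FA[OF that] by simp
    qed
  qed (use h FT assms(8) in auto)
qed

section \<open>Separation of boxes by tagged sums\<close>

text \<open>
  The function with index 0 is a perturbation that is added at the coordinate \<open>p0\<close> when the tag is set.
  It is required to vanish on a set \<open>N\<close>, so over \<open>N\<close> the two tags cannot be told apart.
\<close>

definition tagged_sum :: "nat \<Rightarrow> nat \<Rightarrow> (nat \<Rightarrow> 'b \<Rightarrow> real) \<Rightarrow> bool \<Rightarrow> (nat \<Rightarrow> 'b) \<Rightarrow> real" where
  "tagged_sum m p0 \<phi> b x = (\<Sum>p=1..m. \<phi> p (x p)) + (if b then \<phi> 0 (x p0) else 0)"

text \<open>More than injectivity on the set of boxes: the whole images of different boxes are
  disjoint, for all combinations of tags. The two images of a single box are disjoint too, unless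
  its side \<open>p0\<close> meets \<open>N\<close>, where the tags cannot differ.\<close>

definition separates_boxes :: "nat \<Rightarrow> nat \<Rightarrow> 'b set \<Rightarrow> 'b set set \<Rightarrow> (nat \<Rightarrow> 'b \<Rightarrow> real) \<Rightarrow> bool" where
  "separates_boxes m p0 N \<A> \<phi> \<longleftrightarrow>
    (\<forall>a a' b b' x x'. (\<forall>p\<in>{1..m}. a p \<in> \<A> \<and> a' p \<in> \<A> \<and> x p \<in> a p \<and> x' p \<in> a' p) \<and>
       tagged_sum m p0 \<phi> b x = tagged_sum m p0 \<phi> b' x' \<longrightarrow>
       (\<forall>p\<in>{1..m}. a p = a' p) \<and> (b = b' \<or> a p0 \<inter> N \<noteq> {}))"

lemma tagged_sum_diff_le:
  assumes "\<And>p. p \<le> m \<Longrightarrow> p \<ge> 1 \<Longrightarrow> \<bar>\<phi> p (x p) - \<psi> p (x p)\<bar> \<le> \<mu>" "\<bar>\<phi> 0 (x p0) - \<psi> 0 (x p0)\<bar> \<le> \<mu>" "\<mu> \<ge> 0"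
  shows "\<bar>tagged_sum m p0 \<phi> b x - tagged_sum m p0 \<psi> b x\<bar> \<le> (real m + 1) * \<mu>"
proof -
  have "\<bar>\<Sum>p=1..m. \<phi> p (x p) - \<psi> p (x p)\<bar> \<le> (\<Sum>p=1..m. \<bar>\<phi> p (x p) - \<psi> p (x p)\<bar>)"
    by (rule sum_abs)
  also have "\<dots> \<le> (\<Sum>p=1..m. \<mu>)" by (rule sum_mono) (use assms in auto)
  finally have "\<bar>\<Sum>p=1..m. \<phi> p (x p) - \<psi> p (x p)\<bar> \<le> real m * \<mu>" by simp
  then show ?thesis using assms(2,3) unfolding tagged_sum_def
    by (auto simp: sum_subtractf algebra_simps abs_if split: if_splits)
qed

text \<open>Separation is obtained for all functions within \<open>\<mu>\<close> of
  \<open>\<phi>'\<close> and not just for \<open>\<phi>'\<close>, because a limit of further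
  perturbations must still separate the same boxes.\<close>

lemma separates_boxes_perturbation:
  fixes K :: "'b::{metric_space,second_countable_topology} set" and \<phi> :: "nat \<Rightarrow> 'b \<Rightarrow> real"
  assumes "compact K" "closed N" "p0 \<in> {1..m}" "finite \<A>" "disjoint \<A>"
    and \<A>: "\<And>A. A \<in> \<A> \<Longrightarrow> compact A \<and> A \<subseteq> K"
    and \<phi>: "\<And>p. p \<le> m \<Longrightarrow> continuous_on K (\<phi> p)" "\<And>x. x \<in> K \<inter> N \<Longrightarrow> \<phi> 0 x = 0" and "\<delta> > 0"
    and osc: "\<And>A x y p. A \<in> \<A> \<Longrightarrow> x \<in> A \<Longrightarrow> y \<in> A \<Longrightarrow> p \<le> m \<Longrightarrow> \<bar>\<phi> p x - \<phi> p y\<bar> \<le> \<delta> / 2"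
  shows "\<exists>\<phi>' \<mu>. \<mu> > 0 \<and> (\<forall>p\<le>m. continuous_on K (\<phi>' p) \<and> (\<forall>x\<in>K. \<bar>\<phi>' p x - \<phi> p x\<bar> \<le> \<delta>)) \<and>
    (\<forall>x\<in>K \<inter> N. \<phi>' 0 x = 0) \<and>
    (\<forall>\<phi>''. (\<forall>p\<le>m. \<forall>x\<in>K. \<bar>\<phi>'' p x - \<phi>' p x\<bar> \<le> \<mu>) \<longrightarrow> separates_boxes m p0 N \<A> \<phi>'')"
proof -
  \<comment> \<open>Values on the pieces that admit no nontrivial relation with coefficients in \<open>{-1,0,1}\<close> separate all
     pairs of boxes, since two tagged sums differ by such a relation.\<close>
  define S where "S = {0..m} \<times> \<A> - {0} \<times> {A. A \<inter> N \<noteq> {}}"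
  have "finite S" using assms(4) by (simp add: S_def)
  then obtain c \<mu>0 where \<mu>0: "\<mu>0 > 0"
    and c1: "\<And>s. s \<in> S \<Longrightarrow> \<bar>c s - \<phi> (fst s) (SOME x. x \<in> snd s)\<bar> \<le> \<delta> / 2"
    and c2: "\<And>n s. (\<And>t. n t \<in> {-1,0,1}) \<Longrightarrow> s \<in> S \<Longrightarrow> n s \<noteq> 0 \<Longrightarrow> \<mu>0 \<le> \<bar>\<Sum>s\<in>S. n s * c s\<bar>"
    using \<open>\<delta> > 0\<close> by (elim sign_independent_approx[of S "\<delta>/2" "\<lambda>s. \<phi> (fst s) (SOME x. x \<in> snd s)"]) auto
  \<comment> \<open>On a piece that meets \<open>N\<close>, the function with index 0 must be 0 to
    agree with its prescribed zeros. It already vanishes somewhere on that piece, so by the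
    oscillation bound this is a change of at most \<open>\<delta> / 2\<close>.\<close>
  define d where "d p A = (if (p, A) \<in> S then c (p, A) else 0)" for p A
  have d: "\<bar>d p A - \<phi> p x\<bar> \<le> \<delta>" if "A \<in> \<A>" "x \<in> A" "p \<le> m" for p A x
  proof (cases "(p, A) \<in> S")
    case True
    have "(SOME x. x \<in> A) \<in> A" using that(2) by (rule someI)
    then have "\<bar>c (p, A) - \<phi> p (SOME x. x \<in> A)\<bar> \<le> \<delta> / 2" "\<bar>\<phi> p (SOME x. x \<in> A) - \<phi> p x\<bar> \<le> \<delta> / 2"
      using c1[OF True] osc[OF that(1) _ that(2,3)] by auto
    then show ?thesis using True unfolding d_def by (simp only: if_True)
  next
    case False
    then have "p = 0" "A \<inter> N \<noteq> {}" using that by (auto simp: S_def)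
    then obtain z where "p = 0" "z \<in> A" "z \<in> N" by blast
    then show ?thesis using osc[OF that(1,2), of z p] \<phi>(2)[of z] \<A>[OF that(1)] False \<open>\<delta> > 0\<close>
      by (auto simp: d_def)
  qed
  have "\<exists>\<psi>. continuous_on K \<psi> \<and> (\<forall>A\<in>\<A>. \<forall>x\<in>A. \<psi> x = d p A) \<and>
    (\<forall>x\<in>(if p = 0 then K \<inter> N else {}). \<psi> x = 0) \<and> (\<forall>x\<in>K. \<bar>\<psi> x - \<phi> p x\<bar> \<le> \<delta>)" if pm: "p \<le> m" for p
  proof -
    obtain \<psi> where "continuous_on K \<psi>" "\<And>A x. A \<in> \<A> \<Longrightarrow> x \<in> A \<Longrightarrow> \<psi> x = d p A"
      "\<And>x. x \<in> (if p = 0 then K \<inter> N else {}) \<Longrightarrow> \<psi> x = 0" "\<And>x. x \<in> K \<Longrightarrow> \<bar>\<psi> x - \<phi> p x\<bar> \<le> \<delta>"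
    proof (rule Tietze_locally_constant[of K \<A> "if p = 0 then K \<inter> N else {}" "\<phi> p" "d p" \<delta>], goal_cases)
      case 5
      show ?case using assms(1,2) by (auto intro: closed_Int compact_imp_closed)
    next
      case (9 A)
      then show ?case by (auto simp: d_def S_def split: if_splits)
    next
      case (10 A x)
      then show ?case using d pm by blast
    next
      case (12 \<psi>)
      from 12(1)[OF 12(2-5)] show ?case .
    qed (use assms(1,4,5,9) \<A> \<phi> pm in \<open>auto split: if_splits\<close>)
    then show ?thesis by blast
  qed
  then have "\<forall>p. \<exists>\<psi>. p \<le> m \<longrightarrow> continuous_on K \<psi> \<and> (\<forall>A\<in>\<A>. \<forall>x\<in>A. \<psi> x = d p A) \<and>
    (\<forall>x\<in>(if p = 0 then K \<inter> N else {}). \<psi> x = 0) \<and> (\<forall>x\<in>K. \<bar>\<psi> x - \<phi> p x\<bar> \<le> \<delta>)" by blast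
  from choice[OF this] obtain \<phi>' where \<phi>': "\<And>p. p \<le> m \<Longrightarrow> continuous_on K (\<phi>' p) \<and> (\<forall>A\<in>\<A>. \<forall>x\<in>A. \<phi>' p x = d p A) \<and>
    (\<forall>x\<in>(if p = 0 then K \<inter> N else {}). \<phi>' p x = 0) \<and> (\<forall>x\<in>K. \<bar>\<phi>' p x - \<phi> p x\<bar> \<le> \<delta>)"
    by blast
  have \<phi>'1: "\<And>p. p \<le> m \<Longrightarrow> continuous_on K (\<phi>' p)"
    and \<phi>'2: "\<And>p A x. p \<le> m \<Longrightarrow> A \<in> \<A> \<Longrightarrow> x \<in> A \<Longrightarrow> \<phi>' p x = d p A"
    and \<phi>'3: "\<And>p x. p \<le> m \<Longrightarrow> p = 0 \<Longrightarrow> x \<in> K \<inter> N \<Longrightarrow> \<phi>' p x = 0"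
    and \<phi>'4: "\<And>p x. p \<le> m \<Longrightarrow> x \<in> K \<Longrightarrow> \<bar>\<phi>' p x - \<phi> p x\<bar> \<le> \<delta>"
    using \<phi>' by auto
  \<comment> \<open>Each of the two compared sums has at most \<open>m + 1\<close> terms and moves
    by at most \<open>(m + 1) * \<mu>\<close>; together this is half of the gap.\<close>
  define \<mu> where "\<mu> = \<mu>0 / (4 * (real m + 1))"
  have \<mu>: "\<mu> > 0" "4 * (real m + 1) * \<mu> = \<mu>0" using \<mu>0 by (auto simp: \<mu>_def field_simps)
  have "separates_boxes m p0 N \<A> \<phi>''" if \<phi>'': "\<forall>p\<le>m. \<forall>x\<in>K. \<bar>\<phi>'' p x - \<phi>' p x\<bar> \<le> \<mu>" for \<phi>''
    unfolding separates_boxes_def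
  proof (intro allI impI, elim conjE)
    fix a a' b b' x x'
    assume in_a: "\<forall>p\<in>{1..m}. a p \<in> \<A> \<and> a' p \<in> \<A> \<and> x p \<in> a p \<and> x' p \<in> a' p"
      and eq: "tagged_sum m p0 \<phi>'' b x = tagged_sum m p0 \<phi>'' b' x'"
    have xK: "x p \<in> K" "x' p \<in> K" if "p \<in> {1..m}" for p
      using in_a that \<A> by blast+
    have l1: "\<bar>tagged_sum m p0 \<phi>'' b x - tagged_sum m p0 \<phi>' b x\<bar> \<le> (real m + 1) * \<mu>"
      using \<phi>'' xK assms(3) \<mu>(1) by (intro tagged_sum_diff_le) auto
    have l2: "\<bar>tagged_sum m p0 \<phi>'' b' x' - tagged_sum m p0 \<phi>' b' x'\<bar> \<le> (real m + 1) * \<mu>"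
      using \<phi>'' xK assms(3) \<mu>(1) by (intro tagged_sum_diff_le) auto
    have small: "\<bar>tagged_sum m p0 \<phi>' b x - tagged_sum m p0 \<phi>' b' x'\<bar> < \<mu>0"
      using l1 l2 eq \<mu> \<mu>0 by (simp add: algebra_simps)
    \<comment> \<open>The coefficients of the difference of the two sums with respect to the values
      \<open>d p A\<close>. Each is a difference of two indicators, hence in
      \<open>{-1,0,1}\<close>.\<close>
    define n :: "nat \<times> 'b set \<Rightarrow> real" where "n = (\<lambda>(p, A). if p = 0
        then (if b \<and> A = a p0 then 1 else 0) - (if b' \<and> A = a' p0 then 1 else 0)
        else (if A = a p then 1 else 0) - (if A = a' p then 1 else 0))"
    have n3: "n s \<in> {-1,0,1}" for s
    proof -
      have "(if P then 1 else 0) - (if P' then 1 else 0) \<in> {-1, 0, 1::real}" for P P' by simp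
      then show ?thesis unfolding n_def case_prod_unfold by (cases "fst s = 0") (simp_all only: simp_thms if_True if_False)
    qed
    have inner: "(\<Sum>A\<in>\<A>. n (p, A) * d p A) = d p (a p) - d p (a' p)" if "p \<in> {1..m}" for p
    proof -
      have "(\<Sum>A\<in>\<A>. n (p, A) * d p A) = (\<Sum>A\<in>\<A>. (if A = a p then d p A else 0) - (if A = a' p then d p A else 0))"
        using that by (intro sum.cong) (auto simp: n_def)
      moreover have "a p \<in> \<A>" "a' p \<in> \<A>" using in_a that by auto
      ultimately show ?thesis using assms(4) by (simp add: sum_subtractf)
    qed
    have inner0: "(\<Sum>A\<in>\<A>. n (0, A) * d 0 A) = (if b then d 0 (a p0) else 0) - (if b' then d 0 (a' p0) else 0)"
    proof -
      have "(\<Sum>A\<in>\<A>. n (0, A) * d 0 A) = (\<Sum>A\<in>\<A>. (if A = a p0 then (if b then d 0 A else 0) else 0)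
          - (if A = a' p0 then (if b' then d 0 A else 0) else 0))"
        by (intro sum.cong) (auto simp: n_def)
      moreover have "a p0 \<in> \<A>" "a' p0 \<in> \<A>" using in_a assms(3) by blast+
      ultimately show ?thesis using assms(4) by (simp add: sum_subtractf)
    qed
    have tx: "tagged_sum m p0 \<phi>' b x = (\<Sum>p=1..m. d p (a p)) + (if b then d 0 (a p0) else 0)"
      unfolding tagged_sum_def using in_a assms(3)
      by (intro arg_cong2[of _ _ _ _ "(+)"] sum.cong if_cong refl \<phi>'2) auto
    have tx': "tagged_sum m p0 \<phi>' b' x' = (\<Sum>p=1..m. d p (a' p)) + (if b' then d 0 (a' p0) else 0)"
      unfolding tagged_sum_def using in_a assms(3)
      by (intro arg_cong2[of _ _ _ _ "(+)"] sum.cong if_cong refl \<phi>'2) auto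
    have "(\<Sum>s\<in>S. n s * c s) = (\<Sum>s\<in>S. n s * d (fst s) (snd s))"
      by (intro sum.cong) (auto simp: d_def)
    also have "\<dots> = (\<Sum>s\<in>{0..m} \<times> \<A>. n s * d (fst s) (snd s))"
      by (rule sum.mono_neutral_left) (use assms(4) in \<open>auto simp: S_def d_def\<close>)
    also have "\<dots> = (\<Sum>p\<in>{0..m}. \<Sum>A\<in>\<A>. n (p, A) * d p A)"
      by (simp add: sum.cartesian_product case_prod_unfold)
    also have "{0..m} = insert 0 {1..m}" by auto
    also have "(\<Sum>p\<in>insert 0 {1..m}. \<Sum>A\<in>\<A>. n (p, A) * d p A) =
        (if b then d 0 (a p0) else 0) - (if b' then d 0 (a' p0) else 0) + (\<Sum>p=1..m. d p (a p) - d p (a' p))"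
      using inner inner0 by simp
    also have "\<dots> = tagged_sum m p0 \<phi>' b x - tagged_sum m p0 \<phi>' b' x'"
      by (simp add: tx tx' sum_subtractf)
    finally have n0: "n s = 0" if "s \<in> S" for s
      using c2[of n s] n3 that small by fastforce
    have aa: "a p = a' p" if "p \<in> {1..m}" for p
    proof -
      have "(p, a p) \<in> S" using that in_a by (auto simp: S_def)
      from n0[OF this] show ?thesis using that by (auto simp: n_def split: if_splits)
    qed
    moreover have "b = b' \<or> a p0 \<inter> N \<noteq> {}"
    proof (rule ccontr)
      assume "\<not> ?thesis"
      then have "(0, a p0) \<in> S" "b \<noteq> b'" using in_a assms(3) by (auto simp: S_def)
      with n0[OF this(1)] aa[OF assms(3)] show False by (auto simp: n_def split: if_splits)
    qed
    ultimately show "(\<forall>p\<in>{1..m}. a p = a' p) \<and> (b = b' \<or> a p0 \<inter> N \<noteq> {})" by blast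
  qed
  then show ?thesis using \<mu>(1) \<phi>'1 \<phi>'3 \<phi>'4 by (intro exI[of _ \<phi>'] exI[of _ \<mu>]) auto
qed

section \<open>Families of small disjoint pieces in many colors\<close>

definition colored_families :: "'b::metric_space set \<Rightarrow> nat \<Rightarrow> nat \<Rightarrow> real \<Rightarrow> (nat \<Rightarrow> 'b set set) \<Rightarrow> bool" where
  "colored_families K b R \<epsilon> \<A> \<longleftrightarrow>
     (\<forall>k<R. finite (\<A> k) \<and> disjoint (\<A> k) \<and>
        (\<forall>A\<in>\<A> k. compact A \<and> A \<subseteq> K \<and> (\<forall>x\<in>A. \<forall>y\<in>A. dist x y < \<epsilon>))) \<and>
     (\<forall>x\<in>K. card {k. k < R \<and> x \<notin> \<Union>(\<A> k)} \<le> b)"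

text \<open>The essential point is that \<open>b\<close> depends neither on \<open>R\<close> nor on
  \<open>\<epsilon>\<close>: with many colors, the proportion of those that miss a given point
  becomes as small as desired.\<close>

definition colorable :: "'b::metric_space set \<Rightarrow> nat \<Rightarrow> bool" where
  "colorable K b \<longleftrightarrow> (\<forall>R. \<forall>\<epsilon>>0. \<exists>\<A>. colored_families K b R \<epsilon> \<A>)"

lemma ex_uniform_radius:
  fixes P :: "'i \<Rightarrow> real \<Rightarrow> bool"
  assumes "finite S" "\<And>s. s \<in> S \<Longrightarrow> \<exists>e>0. P s e" "\<And>s e e'. s \<in> S \<Longrightarrow> P s e \<Longrightarrow> 0 < e' \<Longrightarrow> e' \<le> e \<Longrightarrow> P s e'"
  shows "\<exists>e>0. \<forall>s\<in>S. P s e"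
  using assms
proof (induction S)
  case empty
  then show ?case using zero_less_one by blast
next
  case (insert s S)
  obtain e1 where "e1 > 0" "\<forall>s\<in>S. P s e1" using insert.IH insert.prems by (metis insertCI)
  moreover obtain e2 where "e2 > 0" "P s e2" using insert.prems(1)[of s] by blast
  ultimately have "min e1 e2 > 0 \<and> (\<forall>s\<in>insert s S. P s (min e1 e2))"
    using insert.prems(2) by (metis insert_iff min.cobounded1 min.cobounded2 min_less_iff_conj)
  then show ?case by blast
qed

text \<open>The functions are given first; their moduli of continuity dictate the size of the
  pieces, and only then are they perturbed. The common margin is a minimum over the finitely many
  colors.\<close>

lemma separates_boxes_step:
  fixes K :: "'b::{metric_space,second_countable_topology} set"
  assumes "compact K" "closed N" "p0 \<in> {1..m}" "colorable K b" "\<delta> > 0" "\<epsilon> > 0"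
    and cont: "\<And>k p. k < R \<Longrightarrow> p \<le> m \<Longrightarrow> continuous_on K (\<Phi> k p)"
    and zero: "\<And>k x. k < R \<Longrightarrow> x \<in> K \<inter> N \<Longrightarrow> \<Phi> k 0 x = 0"
  shows "\<exists>\<Phi>' \<mu> \<A>. \<mu> > 0 \<and> colored_families K b R \<epsilon> \<A> \<and>
    (\<forall>k<R. (\<forall>p\<le>m. continuous_on K (\<Phi>' k p) \<and> (\<forall>x\<in>K. \<bar>\<Phi>' k p x - \<Phi> k p x\<bar> \<le> \<delta>)) \<and>
      (\<forall>x\<in>K \<inter> N. \<Phi>' k 0 x = 0) \<and>
      (\<forall>\<phi>. (\<forall>p\<le>m. \<forall>x\<in>K. \<bar>\<phi> p x - \<Phi>' k p x\<bar> \<le> \<mu>) \<longrightarrow> separates_boxes m p0 N (\<A> k) \<phi>))"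
proof -
  have "\<exists>e>0. \<forall>s\<in>{..<R} \<times> {..m}. \<forall>x\<in>K. \<forall>y\<in>K. dist x y < e \<longrightarrow>
      \<bar>\<Phi> (fst s) (snd s) x - \<Phi> (fst s) (snd s) y\<bar> \<le> \<delta> / 2"
  proof (rule ex_uniform_radius)
    fix s assume "s \<in> {..<R} \<times> {..m}"
    then have "uniformly_continuous_on K (\<Phi> (fst s) (snd s))"
      using cont assms(1) by (auto intro: compact_uniformly_continuous)
    then obtain e where "e > 0" "\<forall>x\<in>K. \<forall>y\<in>K. dist y x < e \<longrightarrow> dist (\<Phi> (fst s) (snd s) y) (\<Phi> (fst s) (snd s) x) < \<delta> / 2"
      using half_gt_zero[OF \<open>\<delta> > 0\<close>] unfolding uniformly_continuous_on_def by blast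
    then show "\<exists>e>0. \<forall>x\<in>K. \<forall>y\<in>K. dist x y < e \<longrightarrow>
      \<bar>\<Phi> (fst s) (snd s) x - \<Phi> (fst s) (snd s) y\<bar> \<le> \<delta> / 2"
      unfolding dist_real_def by (metis less_imp_le)
  qed auto
  then obtain e where e: "e > 0" and osc: "\<And>k p x y. k < R \<Longrightarrow> p \<le> m \<Longrightarrow> x \<in> K \<Longrightarrow> y \<in> K \<Longrightarrow> dist x y < e \<Longrightarrow>
      \<bar>\<Phi> k p x - \<Phi> k p y\<bar> \<le> \<delta> / 2"
    by fastforce
  have "min e \<epsilon> > 0" using e assms by simp
  then obtain \<A> where \<A>: "colored_families K b R (min e \<epsilon>) \<A>"
    using assms(4) unfolding colorable_def by blast
  let ?Q = "\<lambda>k \<phi>' \<mu>. \<mu> > 0 \<and> (\<forall>p\<le>m. continuous_on K (\<phi>' p) \<and> (\<forall>x\<in>K. \<bar>\<phi>' p x - \<Phi> k p x\<bar> \<le> \<delta>)) \<and>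
    (\<forall>x\<in>K \<inter> N. \<phi>' 0 x = 0) \<and>
    (\<forall>\<phi>. (\<forall>p\<le>m. \<forall>x\<in>K. \<bar>\<phi> p x - \<phi>' p x\<bar> \<le> \<mu>) \<longrightarrow> separates_boxes m p0 N (\<A> k) \<phi>)"
  have "\<forall>k. \<exists>\<phi>' \<mu>. k < R \<longrightarrow> ?Q k \<phi>' \<mu>"
  proof
    fix k
    show "\<exists>\<phi>' \<mu>. k < R \<longrightarrow> ?Q k \<phi>' \<mu>"
    proof (cases "k < R")
      case True
      have fam: "finite (\<A> k)" "disjoint (\<A> k)" "\<And>A. A \<in> \<A> k \<Longrightarrow> compact A \<and> A \<subseteq> K"
        "\<And>A x y. A \<in> \<A> k \<Longrightarrow> x \<in> A \<Longrightarrow> y \<in> A \<Longrightarrow> dist x y < e"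
        using \<A> True unfolding colored_families_def by auto
      have osc': "\<bar>\<Phi> k p x - \<Phi> k p y\<bar> \<le> \<delta> / 2" if "A \<in> \<A> k" "x \<in> A" "y \<in> A" "p \<le> m" for A x y p
        using osc[OF True that(4)] fam(3,4) that(1-3) by blast
      have "\<exists>\<phi>' \<mu>. ?Q k \<phi>' \<mu>"
        by (rule separates_boxes_perturbation[of K N p0 m "\<A> k" "\<Phi> k" \<delta>])
          (fact assms fam(1,2) | erule fam(3) | erule cont[OF True] | erule zero[OF True] | erule (3) osc')+
      then show ?thesis by blast
    qed auto
  qed
  from choice[OF this] obtain \<Phi>' where "\<forall>k. \<exists>\<mu>. k < R \<longrightarrow> ?Q k (\<Phi>' k) \<mu>"
    by blast
  from choice[OF this] obtain \<mu> where \<mu>: "\<And>k. k < R \<Longrightarrow> ?Q k (\<Phi>' k) (\<mu> k)"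
    by blast
  have "\<exists>e>0. \<forall>k\<in>{..<R}. e \<le> \<mu> k"
    by (rule ex_uniform_radius) (use \<mu> in auto)
  then obtain \<nu> where \<nu>: "\<nu> > 0" "\<And>k. k < R \<Longrightarrow> \<nu> \<le> \<mu> k" by auto
  show ?thesis
  proof (intro exI[of _ \<Phi>'] exI[of _ \<nu>] exI[of _ \<A>] conjI allI impI)
    show "colored_families K b R \<epsilon> \<A>" using \<A> unfolding colored_families_def by auto
    fix k \<phi> assume k: "k < R" "\<forall>p\<le>m. \<forall>x\<in>K. \<bar>\<phi> p x - \<Phi>' k p x\<bar> \<le> \<nu>"
    then have "\<forall>p\<le>m. \<forall>x\<in>K. \<bar>\<phi> p x - \<Phi>' k p x\<bar> \<le> \<mu> k" using \<nu>(2) by (meson order_trans)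
    then show "separates_boxes m p0 N (\<A> k) \<phi>" using \<mu>[OF k(1)] by blast
  qed (use \<nu> \<mu> in blast)+
qed

section \<open>Separation at all scales by a limit of perturbations\<close>

text \<open>
  In place of the Baire category theorem: each perturbation is smaller than the margin \<open>\<mu>\<close> that keeps the
  separation achieved in all earlier steps.
\<close>

proposition generic_separation:
  fixes K :: "'b::{metric_space,second_countable_topology} set"
  assumes "compact K" "closed N" "p0 \<in> {1..m}" "colorable K b"
  obtains \<Phi> :: "nat \<Rightarrow> nat \<Rightarrow> 'b \<Rightarrow> real"
  where "\<And>k p. k < R \<Longrightarrow> p \<le> m \<Longrightarrow> continuous_on K (\<Phi> k p)"
    "\<And>k p x. k < R \<Longrightarrow> p \<le> m \<Longrightarrow> x \<in> K \<Longrightarrow> \<bar>\<Phi> k p x\<bar> \<le> 1"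
    "\<And>k x. k < R \<Longrightarrow> x \<in> K \<inter> N \<Longrightarrow> \<Phi> k 0 x = 0"
    "\<And>\<epsilon>. \<epsilon> > 0 \<Longrightarrow> \<exists>\<A>. colored_families K b R \<epsilon> \<A> \<and> (\<forall>k<R. separates_boxes m p0 N (\<A> k) (\<Phi> k))"
proof -
  \<comment> \<open>The start at 0 with margin 1/2 bounds the limit functions by 1, since the total
    movement is at most twice the first margin.\<close>
  define P where "P = (\<lambda>(n::nat) (s::(nat \<Rightarrow> nat \<Rightarrow> 'b \<Rightarrow> real) \<times> real). snd s > 0 \<and>
      (\<forall>k<R. \<forall>p\<le>m. continuous_on K (fst s k p)) \<and> (\<forall>k<R. \<forall>x\<in>K \<inter> N. fst s k 0 x = 0) \<and>
      (n = 0 \<longrightarrow> fst s = (\<lambda>k p x. 0) \<and> snd s = 1/2))"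
  \<comment> \<open>As the margins at least halve, all later steps together move the functions by at
    most \<open>2 * snd s'\<close>. This is why separation is kept within twice the margin that is
    allowed for a single step.\<close>
  define Q where "Q = (\<lambda>(n::nat) (s::(nat \<Rightarrow> nat \<Rightarrow> 'b \<Rightarrow> real) \<times> real) s'.
      (\<forall>k<R. \<forall>p\<le>m. \<forall>x\<in>K. \<bar>fst s' k p x - fst s k p x\<bar> \<le> snd s) \<and> snd s' \<le> snd s / 2 \<and>
      (\<exists>\<A>. colored_families K b R (1 / real (Suc n)) \<A> \<and> (\<forall>k<R. \<forall>\<phi>.
         (\<forall>p\<le>m. \<forall>x\<in>K. \<bar>\<phi> p x - fst s' k p x\<bar> \<le> 2 * snd s') \<longrightarrow> separates_boxes m p0 N (\<A> k) \<phi>)))"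
  have "\<exists>f. \<forall>n. P n (f n) \<and> Q n (f n) (f (Suc n))"
  proof (rule dependent_nat_choice)
    show "\<exists>s. P 0 s"
      by (rule exI[of _ "(\<lambda>k p x. 0, 1/2)"]) (auto simp: P_def)
    fix s n assume "P n s"
    then have s: "snd s > 0" "\<And>k p. k < R \<Longrightarrow> p \<le> m \<Longrightarrow> continuous_on K (fst s k p)"
      "\<And>k x. k < R \<Longrightarrow> x \<in> K \<inter> N \<Longrightarrow> fst s k 0 x = 0" by (auto simp: P_def)
    have n: "1 / real (Suc n) > 0" by simp
    have "\<exists>\<Phi>' \<mu> \<A>. \<mu> > 0 \<and> colored_families K b R (1 / real (Suc n)) \<A> \<and>
      (\<forall>k<R. (\<forall>p\<le>m. continuous_on K (\<Phi>' k p) \<and> (\<forall>x\<in>K. \<bar>\<Phi>' k p x - fst s k p x\<bar> \<le> snd s)) \<and>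
      (\<forall>x\<in>K \<inter> N. \<Phi>' k 0 x = 0) \<and>
      (\<forall>\<phi>. (\<forall>p\<le>m. \<forall>x\<in>K. \<bar>\<phi> p x - \<Phi>' k p x\<bar> \<le> \<mu>) \<longrightarrow> separates_boxes m p0 N (\<A> k) \<phi>))"
      by (rule separates_boxes_step[of K N p0 m b "snd s" "1 / real (Suc n)" R "fst s"])
        (fact assms n s(1) | erule (1) s(2) | erule (1) s(3))+
    then obtain \<Phi>' \<mu> \<A> where \<mu>: "\<mu> > 0" and \<A>: "colored_families K b R (1 / real (Suc n)) \<A>" and
      *: "\<forall>k<R. (\<forall>p\<le>m. continuous_on K (\<Phi>' k p) \<and> (\<forall>x\<in>K. \<bar>\<Phi>' k p x - fst s k p x\<bar> \<le> snd s)) \<and>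
      (\<forall>x\<in>K \<inter> N. \<Phi>' k 0 x = 0) \<and>
      (\<forall>\<phi>. (\<forall>p\<le>m. \<forall>x\<in>K. \<bar>\<phi> p x - \<Phi>' k p x\<bar> \<le> \<mu>) \<longrightarrow> separates_boxes m p0 N (\<A> k) \<phi>)"
      by blast
    define \<delta>' where "\<delta>' = min (snd s / 2) (\<mu> / 2)"
    have \<delta>': "\<delta>' > 0" "\<delta>' \<le> snd s / 2" "2 * \<delta>' \<le> \<mu>" using s(1) \<mu> by (auto simp: \<delta>'_def)
    have "Q n s (\<Phi>', \<delta>')" unfolding Q_def fst_conv snd_conv
    proof (intro conjI exI[of _ \<A>] allI impI \<A> \<delta>'(2))
      fix k \<phi> assume k: "k < R" "\<forall>p\<le>m. \<forall>x\<in>K. \<bar>\<phi> p x - \<Phi>' k p x\<bar> \<le> 2 * \<delta>'"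
      then have "\<forall>p\<le>m. \<forall>x\<in>K. \<bar>\<phi> p x - \<Phi>' k p x\<bar> \<le> \<mu>" using \<delta>'(3) by (meson order_trans)
      then show "separates_boxes m p0 N (\<A> k) \<phi>" using * k(1) by blast
    qed (use * in blast)
    moreover have "P (Suc n) (\<Phi>', \<delta>')" unfolding P_def fst_conv snd_conv using * \<delta>'(1) by auto
    ultimately show "\<exists>s'. P (Suc n) s' \<and> Q n s s'" by blast
  qed
  then obtain f where f: "\<And>n. P n (f n)" "\<And>n. Q n (f n) (f (Suc n))" by blast
  define \<delta> where "\<delta> n = snd (f n)" for n
  define \<Psi> where "\<Psi> n = fst (f n)" for n
  have \<delta>pos: "\<delta> n > 0" for n using f(1)[of n] by (simp add: P_def \<delta>_def)
  have \<delta>half: "\<delta> (Suc n) \<le> \<delta> n / 2" for n using f(2)[of n] by (simp add: Q_def \<delta>_def)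
  have \<delta>0: "\<delta> 0 = 1/2" "\<Psi> 0 = (\<lambda>k p x. 0)" using f(1)[of 0] by (auto simp: P_def \<delta>_def \<Psi>_def)
  have \<delta>lim: "\<delta> n \<le> (1/2) ^ Suc n" for n
  proof (induction n)
    case (Suc n)
    then show ?case using \<delta>half[of n] by simp
  qed (use \<delta>0 in auto)
  have cont\<Psi>: "continuous_on K (\<Psi> n k p)" if "k < R" "p \<le> m" for n k p
    using f(1)[of n] that by (simp add: P_def \<Psi>_def)
  have zero\<Psi>: "\<Psi> n k 0 x = 0" if "k < R" "x \<in> K \<inter> N" for n k x
    using f(1)[of n] that by (simp add: P_def \<Psi>_def)
  have step: "\<bar>\<Psi> (Suc n) k p x - \<Psi> n k p x\<bar> \<le> \<delta> n" if "k < R" "p \<le> m" "x \<in> K" for n k p x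
    using f(2)[of n] that unfolding Q_def \<Psi>_def \<delta>_def by blast
  have tail: "\<bar>\<Psi> (n + j) k p x - \<Psi> n k p x\<bar> \<le> 2 * \<delta> n - 2 * \<delta> (n + j)" if "k < R" "p \<le> m" "x \<in> K" for n j k p x
  proof (induction j)
    case (Suc j)
    then show ?case using step[OF that, of "n + j"] \<delta>half[of "n + j"] by simp
  qed simp
  have tail2: "\<bar>\<Psi> n' k p x - \<Psi> n k p x\<bar> \<le> 2 * \<delta> n" if "k < R" "p \<le> m" "x \<in> K" "n \<le> n'" for n n' k p x
    using tail[OF that(1-3), of n "n' - n"] \<delta>pos[of n'] that(4) by simp
  have small: "\<exists>n. 2 * \<delta> n < e" if "e > 0" for e
  proof -
    obtain n where "(1/2::real) ^ n < e" using real_arch_pow_inv[of e "1/2"] \<open>e > 0\<close> by auto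
    then have "2 * \<delta> n < e" using \<delta>lim[of n] by simp
    then show ?thesis by blast
  qed
  define \<Phi> where "\<Phi> k p x = lim (\<lambda>n. \<Psi> n k p x)" for k p x
  have conv: "(\<lambda>n. \<Psi> n k p x) \<longlonglongrightarrow> \<Phi> k p x" if "k < R" "p \<le> m" "x \<in> K" for k p x
  proof -
    have "Cauchy (\<lambda>n. \<Psi> n k p x)"
    proof (rule metric_CauchyI)
      fix e :: real assume "e > 0"
      then obtain n0 where n0: "2 * \<delta> n0 < e / 2" using small[of "e/2"] by auto
      show "\<exists>M. \<forall>i\<ge>M. \<forall>j\<ge>M. dist (\<Psi> i k p x) (\<Psi> j k p x) < e"
      proof (intro exI[of _ n0] allI impI)
        fix i j assume "n0 \<le> i" "n0 \<le> j"
        then show "dist (\<Psi> i k p x) (\<Psi> j k p x) < e"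
          using tail2[OF that, of n0 i] tail2[OF that, of n0 j] n0 unfolding dist_real_def by linarith
      qed
    qed
    then show ?thesis unfolding \<Phi>_def by (simp add: Cauchy_convergent convergent_LIMSEQ_iff[symmetric])
  qed
  have lim_bd: "\<bar>\<Phi> k p x - \<Psi> n k p x\<bar> \<le> 2 * \<delta> n" if "k < R" "p \<le> m" "x \<in> K" for n k p x
  proof (rule LIMSEQ_le_const2)
    show "(\<lambda>j. \<bar>\<Psi> j k p x - \<Psi> n k p x\<bar>) \<longlonglongrightarrow> \<bar>\<Phi> k p x - \<Psi> n k p x\<bar>"
      using conv[OF that] by (intro tendsto_intros)
    show "\<exists>N. \<forall>j\<ge>N. \<bar>\<Psi> j k p x - \<Psi> n k p x\<bar> \<le> 2 * \<delta> n"
      using tail2[OF that] by blast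
  qed
  show ?thesis
  proof (rule that[of \<Phi>])
    fix k p assume kp: "k < R" "p \<le> m"
    have "uniform_limit K (\<lambda>n. \<Psi> n k p) (\<Phi> k p) sequentially"
    proof (rule uniform_limitI)
      fix e :: real assume "e > 0"
      then obtain n0 where n0: "2 * \<delta> n0 < e / 2" using small[of "e/2"] by auto
      show "\<forall>\<^sub>F n in sequentially. \<forall>x\<in>K. dist (\<Psi> n k p x) (\<Phi> k p x) < e"
        unfolding eventually_sequentially
      proof (intro exI[of _ n0] allI impI ballI)
        fix n x assume "n0 \<le> n" "x \<in> K"
        then show "dist (\<Psi> n k p x) (\<Phi> k p x) < e"
          using tail2[OF kp, of x n0 n] lim_bd[OF kp, of x n0] n0 unfolding dist_real_def by linarith
      qed
    qed
    then show "continuous_on K (\<Phi> k p)"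
      by (rule uniform_limit_theorem[rotated]) (use cont\<Psi> kp in auto)
    show "\<bar>\<Phi> k p x\<bar> \<le> 1" if "x \<in> K" for x
      using lim_bd[OF kp that, of 0] \<delta>0 by simp
  next
    fix k x assume kx: "k < R" "x \<in> K \<inter> N"
    then have "(\<lambda>n. \<Psi> n k 0 x) \<longlonglongrightarrow> \<Phi> k 0 x" using conv by simp
    then show "\<Phi> k 0 x = 0" using zero\<Psi>[OF kx] by (simp add: LIMSEQ_const_iff)
  next
    fix \<epsilon> :: real assume "\<epsilon> > 0"
    then obtain n where n: "1 / real (Suc n) < \<epsilon>" using nat_approx_posE by blast
    obtain \<A> where \<A>: "colored_families K b R (1 / real (Suc n)) \<A>"
      and sep: "\<forall>k<R. \<forall>\<phi>. (\<forall>p\<le>m. \<forall>x\<in>K. \<bar>\<phi> p x - \<Psi> (Suc n) k p x\<bar> \<le> 2 * \<delta> (Suc n)) \<longrightarrow> separates_boxes m p0 N (\<A> k) \<phi>"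
      using f(2)[of n] unfolding Q_def \<Psi>_def \<delta>_def by blast
    have "colored_families K b R \<epsilon> \<A>" using \<A> n unfolding colored_families_def by (meson order_less_trans)
    moreover have "\<forall>k<R. separates_boxes m p0 N (\<A> k) (\<Phi> k)" using sep lim_bd by blast
    ultimately show "\<exists>\<A>. colored_families K b R \<epsilon> \<A> \<and> (\<forall>k<R. separates_boxes m p0 N (\<A> k) (\<Phi> k))" by blast
  qed
qed

subsection \<open>Approximation on a compact slab\<close>

lemma dist_fun_less:
  fixes \<delta> :: real
  assumes "\<delta> > 0"
  obtains e where "e > 0" "\<And>x y :: nat \<Rightarrow> 'b::metric_space. (\<And>i. dist (x i) (y i) < e) \<Longrightarrow> dist x y < \<delta>"
proof -
  obtain n where n: "(1/2::real) ^ n < \<delta> / 2" using real_arch_pow_inv[of "\<delta>/2" "1/2"] assms by auto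
  show ?thesis
  proof (rule that[of "\<delta> / 4"])
    fix x y :: "nat \<Rightarrow> 'b" assume xy: "\<And>i. dist (x i) (y i) < \<delta> / 4"
    have eq: "{dist (x (from_nat i)) (y (from_nat i)) |i. i \<le> n} = (\<lambda>i. dist (x (from_nat i)) (y (from_nat i))) ` {..n}" by auto
    have "Max {dist (x (from_nat i)) (y (from_nat i)) |i. i \<le> n} \<le> \<delta> / 4"
      unfolding eq using xy by (intro Max.boundedI) (auto intro: less_imp_le)
    then show "dist x y < \<delta>" using dist_fun_le_dist_first_terms[of x y n] n by simp
  qed (use assms in simp)
qed

text \<open>An extensional function has the fixed value \<open>undefined\<close> outside
  \<open>I\<close>, so the set is a full product with one-point factors there, and Tychonoff's
  theorem applies.\<close>

lemma compact_PiE_fun: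
  fixes L :: "'i \<Rightarrow> 'b::topological_space set"
  assumes "\<And>i. i \<in> I \<Longrightarrow> compact (L i)"
  shows "compact (PiE I L)"
proof -
  have "PiE I L = PiE UNIV (\<lambda>i. if i \<in> I then L i else {undefined})"
    by (auto simp: PiE_iff extensional_def split: if_splits)
  moreover have "compactin (product_topology (\<lambda>i. euclidean) UNIV) (PiE UNIV (\<lambda>i. if i \<in> I then L i else {undefined}))"
    using assms by (auto simp: compactin_PiE)
  ultimately show ?thesis by (simp add: euclidean_product_topology)
qed

lemma uniformly_continuous_on_PiE:
  fixes f :: "(nat \<Rightarrow> 'b::metric_space) \<Rightarrow> real"
  assumes "\<And>i. i \<in> I \<Longrightarrow> compact (L i)" "continuous_on (PiE I L) f" "\<eta> > 0"
  obtains e where "e > 0" "\<And>x y. x \<in> PiE I L \<Longrightarrow> y \<in> PiE I L \<Longrightarrow> (\<And>i. i \<in> I \<Longrightarrow> dist (x i) (y i) < e) \<Longrightarrow> \<bar>f x - f y\<bar> < \<eta>"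
proof -
  have "uniformly_continuous_on (PiE I L) f"
    by (intro compact_uniformly_continuous assms(2) compact_PiE_fun assms(1))
  then obtain \<delta> where \<delta>: "\<delta> > 0" "\<And>x y. x \<in> PiE I L \<Longrightarrow> y \<in> PiE I L \<Longrightarrow> dist x y < \<delta> \<Longrightarrow> \<bar>f x - f y\<bar> < \<eta>"
    using assms(3) unfolding uniformly_continuous_on_def dist_real_def by metis
  obtain e where e: "e > 0" "\<And>x y :: nat \<Rightarrow> 'b. (\<And>i. dist (x i) (y i) < e) \<Longrightarrow> dist x y < \<delta>"
    using dist_fun_less[OF \<delta>(1)] by blast
  show ?thesis
  proof (rule that[OF e(1)])
    fix x y assume xy: "x \<in> PiE I L" "y \<in> PiE I L" "\<And>i. i \<in> I \<Longrightarrow> dist (x i) (y i) < e"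
    have "dist (x i) (y i) < e" for i
      using xy(3) e(1) PiE_arb[OF xy(1)] PiE_arb[OF xy(2)] by (cases "i \<in> I") auto
    then show "\<bar>f x - f y\<bar> < \<eta>" using \<delta>(2) e(2) xy by blast
  qed
qed

lemma continuous_on_coordinate:
  fixes \<phi> :: "'b::topological_space \<Rightarrow> 'c::topological_space"
  assumes "continuous_on L \<phi>" "\<And>x. x \<in> D \<Longrightarrow> x p \<in> L"
  shows "continuous_on D (\<lambda>x. \<phi> (x p))"
  by (rule continuous_on_compose2[OF assms(1)])
    (use assms(2) in \<open>auto intro: continuous_on_subset[OF continuous_on_product_coordinates]\<close>)

lemma continuous_on_tagged_sum:
  assumes "\<And>p. p \<le> m \<Longrightarrow> continuous_on K (\<phi> p)" "\<And>x p. x \<in> D \<Longrightarrow> p \<in> {1..m} \<Longrightarrow> x p \<in> K" "p0 \<in> {1..m}"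
  shows "continuous_on D (tagged_sum m p0 \<phi> b)"
proof -
  have "continuous_on D (\<lambda>x. (\<Sum>p=1..m. \<phi> p (x p)) + (if b then \<phi> 0 (x p0) else 0))"
    using assms by (cases b) (auto intro!: continuous_intros continuous_on_coordinate[where L = K])
  then show ?thesis unfolding tagged_sum_def[abs_def] .
qed

lemma tagged_sum_bound:
  assumes "\<And>p. p \<in> {1..m} \<Longrightarrow> \<bar>\<phi> p (x p)\<bar> \<le> 1" "\<bar>\<phi> 0 (x p0)\<bar> \<le> 1"
  shows "\<bar>tagged_sum m p0 \<phi> b x\<bar> \<le> real m + 1"
  using tagged_sum_diff_le[of m \<phi> x "\<lambda>_ _. 0" 1 p0 b] assms by (simp add: tagged_sum_def)

text \<open>If \<open>a p0\<close> misses \<open>N\<close>, the compact image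
  \<open>T True a\<close> is disjoint from the images of all other boxes and from every
  \<open>T False a'\<close>, so an outer function can take the value \<open>v a\<close> on it and 0
  on the rest. A box whose side \<open>p0\<close> meets \<open>N\<close> gets 0 for both
  tags.\<close>

lemma box_interpolation:
  fixes K :: "'b::{metric_space,second_countable_topology} set" and v :: "(nat \<Rightarrow> 'b set) \<Rightarrow> real"
  assumes p0: "p0 \<in> {1..m}" and fin: "finite \<A>" and \<A>: "\<And>A. A \<in> \<A> \<Longrightarrow> compact A \<and> A \<subseteq> K"
    and cont: "\<And>p. p \<le> m \<Longrightarrow> continuous_on K (\<phi> p)" and bd: "\<And>p x. p \<le> m \<Longrightarrow> x \<in> K \<Longrightarrow> \<bar>\<phi> p x\<bar> \<le> 1"
    and sep: "separates_boxes m p0 N \<A> \<phi>" and v: "\<And>a. \<bar>v a\<bar> \<le> c" "c > 0"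
  shows "\<exists>g. continuous_on UNIV g \<and> (\<forall>t. \<bar>g t\<bar> \<le> c) \<and> (\<forall>t. \<bar>t\<bar> \<ge> real m + 2 \<longrightarrow> g t = 0) \<and>
    (\<forall>a x. a \<in> {1..m} \<rightarrow>\<^sub>E \<A> \<longrightarrow> x \<in> PiE {1..m} a \<longrightarrow> g (tagged_sum m p0 \<phi> False x) = 0 \<and>
       g (tagged_sum m p0 \<phi> True x) = (if a p0 \<inter> N = {} then v a else 0))"
proof -
  define J where "J = ({1..m} \<rightarrow>\<^sub>E \<A>)"
  define T where "T b a = tagged_sum m p0 \<phi> b ` PiE {1..m} a" for b a
  have finJ: "finite J" unfolding J_def using fin by (intro finite_PiE) auto
  have inK: "x p \<in> K" if "a \<in> J" "x \<in> PiE {1..m} a" "p \<in> {1..m}" for a x p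
    using that \<A> unfolding J_def by (meson PiE_mem subsetD)
  have compT: "compact (T b a)" if "a \<in> J" for b a
    unfolding T_def
  proof (rule compact_continuous_image)
    show "continuous_on (PiE {1..m} a) (tagged_sum m p0 \<phi> b)"
      using inK[OF that] by (intro continuous_on_tagged_sum[OF cont _ p0]) auto
    show "compact (PiE {1..m} a)" using that \<A> unfolding J_def by (intro compact_PiE_fun) (meson PiE_mem)
  qed
  have bdT: "\<bar>t\<bar> \<le> real m + 1" if "a \<in> J" "t \<in> T b a" for a b t
    using that(2) inK[OF that(1)] bd p0 unfolding T_def by (auto intro!: tagged_sum_bound)
  have sepT: "a = a' \<and> (b = b' \<or> a p0 \<inter> N \<noteq> {})" if aT: "a \<in> J" "a' \<in> J" "t \<in> T b a" "t \<in> T b' a'" for a a' b b' t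
  proof -
    obtain x x' where x: "x \<in> PiE {1..m} a" "x' \<in> PiE {1..m} a'"
      "tagged_sum m p0 \<phi> b x = tagged_sum m p0 \<phi> b' x'"
      using aT(3,4) unfolding T_def by auto
    have "\<forall>p\<in>{1..m}. a p \<in> \<A> \<and> a' p \<in> \<A> \<and> x p \<in> a p \<and> x' p \<in> a' p"
      using x aT(1,2) unfolding J_def by (meson PiE_mem)
    then have "(\<forall>p\<in>{1..m}. a p = a' p) \<and> (b = b' \<or> a p0 \<inter> N \<noteq> {})"
      using sep x(3) unfolding separates_boxes_def by blast
    then show ?thesis using aT(1,2) unfolding J_def by (meson PiE_ext)
  qed
  define J1 where "J1 = {a \<in> J. a p0 \<inter> N = {}}"
  \<comment> \<open>The images lie within \<open>m + 1\<close> of 0. Prescribing 0 at the two points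
    of absolute value \<open>m + 2\<close> allows the function to be continued by 0 to the whole
    line.\<close>
  define T0 where "T0 = ((\<Union>a\<in>J - J1. T True a) \<union> (\<Union>a\<in>J. T False a) \<union> {t. \<bar>t\<bar> = real m + 2})"
  define d where "d S = v (SOME a. a \<in> J1 \<and> S = T True a)" for S
  have d: "d (T True a) = v a" if "a \<in> J1" "T True a \<noteq> {}" for a
  proof -
    have "(SOME a'. a' \<in> J1 \<and> T True a = T True a') = a"
    proof (rule some_equality)
      fix a' assume "a' \<in> J1 \<and> T True a = T True a'"
      then show "a' = a" using sepT that unfolding J1_def by blast
    qed (use that in simp)
    then show ?thesis by (simp add: d_def)
  qed
  obtain \<psi> where \<psi>: "continuous_on (cball 0 (real m + 2)) \<psi>"
    "\<And>S t. S \<in> T True ` J1 \<Longrightarrow> t \<in> S \<Longrightarrow> \<psi> t = d S" "\<And>t. t \<in> T0 \<Longrightarrow> \<psi> t = 0"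
    "\<And>t. t \<in> cball 0 (real m + 2) \<Longrightarrow> \<bar>\<psi> t - 0\<bar> \<le> c"
  proof (rule Tietze_locally_constant[of "cball 0 (real m + 2)" "T True ` J1" T0 "\<lambda>_. 0" d c], goal_cases)
    case 3
    show ?case using sepT unfolding J1_def disjoint_def by blast
  next
    case (4 A)
    then show ?case using compT bdT unfolding J1_def by fastforce
  next
    case 5
    show ?case unfolding T0_def using finJ compT
      by (intro closed_Un closed_UN closed_Collect_eq continuous_intros) (auto intro: compact_imp_closed)
  next
    case 6
    show ?case using bdT unfolding T0_def J1_def by fastforce
  next
    case (9 A)
    then obtain a t where a: "a \<in> J1" "t \<in> T True a" "t \<in> T0" by auto
    then have aJ: "a \<in> J" "a p0 \<inter> N = {}" by (auto simp: J1_def)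
    from a(3) consider a' where "a' \<in> J - J1" "t \<in> T True a'" | a' where "a' \<in> J" "t \<in> T False a'"
      | "\<bar>t\<bar> = real m + 2" unfolding T0_def by blast
    then have False
    proof cases
      case 1
      then show False using sepT[OF aJ(1) _ a(2) 1(2)] a(1) by blast
    next
      case 2
      then show False using sepT[OF aJ(1) 2(1) a(2) 2(2)] aJ(2) by blast
    next
      case 3
      then show False using bdT[OF aJ(1) a(2)] by simp
    qed
    then show ?case ..
  next
    case (12 \<psi>)
    from 12(1)[OF 12(2-5)] show ?case .
  next
    case 2
    show ?case using finJ by (simp add: J1_def)
  next
    case (10 A x)
    show ?case using v(1) by (simp add: d_def)
  qed (use v(2) in simp_all)
  define g where "g t = (if t \<in> cball 0 (real m + 2) then \<psi> t else 0)" for t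
  show ?thesis
  proof (intro exI[of _ g] conjI allI impI)
    have "continuous_on (cball 0 (real m + 2) \<union> {t. \<bar>t\<bar> \<ge> real m + 2}) g"
      unfolding g_def
    proof (rule continuous_on_cases)
      show "closed {t::real. \<bar>t\<bar> \<ge> real m + 2}" by (intro closed_Collect_le continuous_intros)
    qed (use \<psi> in \<open>auto simp: T0_def\<close>)
    moreover have "cball 0 (real m + 2) \<union> {t. \<bar>t\<bar> \<ge> real m + 2} = UNIV" by auto
    ultimately show "continuous_on UNIV g" by simp
    show "\<bar>g t\<bar> \<le> c" for t using \<psi>(4)[of t] v(2) by (auto simp: g_def)
    show "g t = 0" if "\<bar>t\<bar> \<ge> real m + 2" for t
      using \<psi>(3)[of t] that by (auto simp: g_def T0_def)
    fix a x assume a: "a \<in> {1..m} \<rightarrow>\<^sub>E \<A>" and x: "x \<in> PiE {1..m} a"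
    have aJ: "a \<in> J" using a by (simp add: J_def)
    have inT: "tagged_sum m p0 \<phi> b x \<in> T b a" for b using x by (auto simp: T_def)
    have inB: "tagged_sum m p0 \<phi> b x \<in> cball 0 (real m + 2)" for b
      using bdT[OF aJ inT[of b]] by (simp add: dist_real_def)
    have "tagged_sum m p0 \<phi> False x \<in> T0" using inT[of False] aJ by (auto simp: T0_def)
    then show "g (tagged_sum m p0 \<phi> False x) = 0" using \<psi>(3) inB by (simp add: g_def)
    show "g (tagged_sum m p0 \<phi> True x) = (if a p0 \<inter> N = {} then v a else 0)"
    proof (cases "a p0 \<inter> N = {}")
      case True
      then have J1: "a \<in> J1" using aJ by (simp add: J1_def)
      then have "\<psi> (tagged_sum m p0 \<phi> True x) = d (T True a)"
        using \<psi>(2) inT by blast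
      then show ?thesis using d[OF J1] inT[of True] True inB by (auto simp: g_def)
    next
      case False
      then have "tagged_sum m p0 \<phi> True x \<in> T0" using inT[of True] aJ by (auto simp: T0_def J1_def)
      then show ?thesis using \<psi>(3) inB False by (simp add: g_def)
    qed
  qed
qed

text \<open>Only the coordinate \<open>p0\<close> is confined to \<open>L\<close>. The others run
  through all of the compact set, including the point that will later play the part of
  infinity.\<close>

definition slab :: "nat \<Rightarrow> nat \<Rightarrow> 'b set \<Rightarrow> 'b set \<Rightarrow> (nat \<Rightarrow> 'b) set" where
  "slab m p0 L K = PiE {1..m} (\<lambda>p. if p = p0 then L else K)"

locale separating_system =
  fixes K :: "'b::{metric_space,second_countable_topology} set" and N :: "'b set" and m p0 b R :: nat
    and \<Phi> :: "nat \<Rightarrow> nat \<Rightarrow> 'b \<Rightarrow> real"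
  assumes K: "compact K" and p0: "p0 \<in> {1..m}"
    and cont: "\<And>k p. k < R \<Longrightarrow> p \<le> m \<Longrightarrow> continuous_on K (\<Phi> k p)"
    and bd: "\<And>k p x. k < R \<Longrightarrow> p \<le> m \<Longrightarrow> x \<in> K \<Longrightarrow> \<bar>\<Phi> k p x\<bar> \<le> 1"
    and zero: "\<And>k x. k < R \<Longrightarrow> x \<in> K \<inter> N \<Longrightarrow> \<Phi> k 0 x = 0"
    and sep: "\<And>\<epsilon>. \<epsilon> > 0 \<Longrightarrow> \<exists>\<A>. colored_families K b R \<epsilon> \<A> \<and> (\<forall>k<R. separates_boxes m p0 N (\<A> k) (\<Phi> k))"
    and R: "R > 0" "12 * m * b \<le> R"
begin

definition tag_difference :: "(nat \<Rightarrow> real \<Rightarrow> real) \<Rightarrow> (nat \<Rightarrow> 'b) \<Rightarrow> real" where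
  "tag_difference g x = (\<Sum>k<R. g k (tagged_sum m p0 (\<Phi> k) True x) - g k (tagged_sum m p0 (\<Phi> k) False x))"

text \<open>
  The difference of the two tags vanishes identically over \<open>N\<close>. This is what makes it possible to treat
  the cells of a non-compact space independently of each other, for functions that vanish over \<open>N\<close>.
  At a point covered in all but at most \<open>m * b\<close> of the \<open>R\<close> colors each covering color contributes about
  \<open>f x / R\<close>, and each of the others at most \<open>2 * M / R\<close> in absolute value.
\<close>

lemma approximation_step:
  assumes L: "compact L" "L \<subseteq> K" "K \<inter> N \<subseteq> L"
    and f: "continuous_on (slab m p0 L K) f" "\<And>x. x \<in> slab m p0 L K \<Longrightarrow> x p0 \<in> N \<Longrightarrow> f x = 0"
      "\<And>x. x \<in> slab m p0 L K \<Longrightarrow> \<bar>f x\<bar> \<le> M" "M > 0"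
  shows "\<exists>g. (\<forall>k<R. continuous_on UNIV (g k) \<and> (\<forall>t. \<bar>g k t\<bar> \<le> M) \<and> (\<forall>t. \<bar>t\<bar> \<ge> real m + 2 \<longrightarrow> g k t = 0)) \<and>
    (\<forall>x\<in>slab m p0 L K. \<bar>f x - tag_difference g x\<bar> \<le> 3/4 * M)"
proof -
  have compD: "compact (if p = p0 then L else K)" for p using K L by simp
  have "M / 2 > 0" using f by simp
  obtain e where e: "e > 0" and fe: "\<And>x y. x \<in> slab m p0 L K \<Longrightarrow> y \<in> slab m p0 L K \<Longrightarrow> (\<And>p. p \<in> {1..m} \<Longrightarrow> dist (x p) (y p) < e) \<Longrightarrow> \<bar>f x - f y\<bar> < M / 2"
    using uniformly_continuous_on_PiE[OF compD f(1)[unfolded slab_def] \<open>M / 2 > 0\<close>] unfolding slab_def by blast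
  obtain \<A> where \<A>: "colored_families K b R e \<A>" and sepA: "\<And>k. k < R \<Longrightarrow> separates_boxes m p0 N (\<A> k) (\<Phi> k)"
    using sep[OF e] by blast
  \<comment> \<open>The sample point has to lie in the slab, where \<open>f\<close> is controlled. A
    box may miss the slab, as \<open>L\<close> can be smaller than \<open>K\<close>; it then gets
    the value 0, which respects the bound \<open>M / R\<close>.\<close>
  define v where "v a = (if \<exists>y. y \<in> slab m p0 L K \<inter> PiE {1..m} a then f (SOME y. y \<in> slab m p0 L K \<inter> PiE {1..m} a) / R else 0)" for a
  have vbd: "\<bar>v a\<bar> \<le> M / R" for a
  proof (cases "\<exists>y. y \<in> slab m p0 L K \<inter> PiE {1..m} a")
    case True
    then have "(SOME y. y \<in> slab m p0 L K \<inter> PiE {1..m} a) \<in> slab m p0 L K" using someI_ex[OF True] by blast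
    moreover have "v a = f (SOME y. y \<in> slab m p0 L K \<inter> PiE {1..m} a) / R"
      unfolding v_def using True by (rule if_P)
    ultimately show ?thesis using f(3) R by (simp add: divide_right_mono)
  next
    case False
    then have "v a = 0" unfolding v_def by (rule if_not_P)
    then show ?thesis using f(4) by simp
  qed
  have MR: "M / R > 0" using f(4) R by simp
  have AK: "compact A \<and> A \<subseteq> K" "\<And>x y. x \<in> A \<Longrightarrow> y \<in> A \<Longrightarrow> dist x y < e" if "k < R" "A \<in> \<A> k" for k A
    using \<A> that unfolding colored_families_def by blast+
  have finA: "finite (\<A> k)" if "k < R" for k using \<A> that unfolding colored_families_def by blast
  let ?Q = "\<lambda>k g. continuous_on UNIV g \<and> (\<forall>t. \<bar>g t\<bar> \<le> M / R) \<and> (\<forall>t. \<bar>t\<bar> \<ge> real m + 2 \<longrightarrow> g t = 0) \<and>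
    (\<forall>a x. a \<in> {1..m} \<rightarrow>\<^sub>E \<A> k \<longrightarrow> x \<in> PiE {1..m} a \<longrightarrow> g (tagged_sum m p0 (\<Phi> k) False x) = 0 \<and>
       g (tagged_sum m p0 (\<Phi> k) True x) = (if a p0 \<inter> N = {} then v a else 0))"
  have "\<forall>k. \<exists>g. k < R \<longrightarrow> ?Q k g"
  proof (intro allI, subst ex_simps(6), intro impI)
    fix k assume k: "k < R"
    show "\<exists>g. ?Q k g"
    proof (rule box_interpolation[of p0 m "\<A> k" K "\<Phi> k" N v "M / R"])
      show "compact A \<and> A \<subseteq> K" if "A \<in> \<A> k" for A using AK(1)[OF k that] .
      show "continuous_on K (\<Phi> k p)" if "p \<le> m" for p using cont[OF k that] .
      show "\<bar>\<Phi> k p x\<bar> \<le> 1" if "p \<le> m" "x \<in> K" for p x using bd[OF k that] .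
    qed (fact p0 finA[OF k] sepA[OF k] vbd MR)+
  qed
  from choice[OF this] obtain g where g0: "\<forall>k. k < R \<longrightarrow> ?Q k (g k)" ..
  have g1: "continuous_on UNIV (g k)" if "k < R" for k using g0 that by blast
  have g2: "\<bar>g k t\<bar> \<le> M / R" if "k < R" for k t using g0 that by blast
  have g3: "g k t = 0" if "k < R" "\<bar>t\<bar> \<ge> real m + 2" for k t using g0 that by blast
  have g4: "g k (tagged_sum m p0 (\<Phi> k) False x) = 0 \<and>
       g k (tagged_sum m p0 (\<Phi> k) True x) = (if a p0 \<inter> N = {} then v a else 0)"
    if "k < R" "a \<in> {1..m} \<rightarrow>\<^sub>E \<A> k" "x \<in> PiE {1..m} a" for k a x
    using g0 that by blast
  define h where "h k x = g k (tagged_sum m p0 (\<Phi> k) True x) - g k (tagged_sum m p0 (\<Phi> k) False x)" for k x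
  have h2: "\<bar>h k x\<bar> \<le> 2 * (M / R)" if "k < R" for k x
    using g2[OF that, of "tagged_sum m p0 (\<Phi> k) True x"] g2[OF that, of "tagged_sum m p0 (\<Phi> k) False x"]
    unfolding h_def by linarith
  have main: "\<bar>f x - (\<Sum>k<R. h k x)\<bar> \<le> 3/4 * M" if x: "x \<in> slab m p0 L K" for x
  proof -
    have xK: "x p \<in> K" if "p \<in> {1..m}" for p
      using PiE_mem[OF x[unfolded slab_def] that] L(2) by (auto split: if_splits)
    define Bad where "Bad = {k. k < R \<and> (\<exists>p\<in>{1..m}. x p \<notin> \<Union>(\<A> k))}"
    have good: "\<bar>f x / R - h k x\<bar> \<le> (M / 2) / R" if k: "k < R" "k \<notin> Bad" for k
    proof -
      have "\<forall>p. \<exists>A. p \<in> {1..m} \<longrightarrow> A \<in> \<A> k \<and> x p \<in> A" using k unfolding Bad_def by blast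
      from choice[OF this] obtain a' where a': "\<And>p. p \<in> {1..m} \<Longrightarrow> a' p \<in> \<A> k \<and> x p \<in> a' p" by blast
      define a where "a = restrict a' {1..m}"
      have a: "a \<in> {1..m} \<rightarrow>\<^sub>E \<A> k" "\<And>p. p \<in> {1..m} \<Longrightarrow> x p \<in> a p" using a' by (auto simp: a_def)
      have xa: "x \<in> PiE {1..m} a" using a(2) x unfolding slab_def by (auto simp: PiE_iff)
      have near: "dist z w < e" if "p \<in> {1..m}" "z \<in> a p" "w \<in> a p" for p z w
        using AK(2)[OF k(1), of "a p"] a(1) that by blast
      have hk: "h k x = (if a p0 \<inter> N = {} then v a else 0)"
        using g4[OF k(1) a(1) xa] by (simp add: h_def)
      have "\<bar>f x - R * h k x\<bar> \<le> M / 2"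
      proof (cases "a p0 \<inter> N = {}")
        case True
        define y where "y = (SOME y. y \<in> slab m p0 L K \<inter> PiE {1..m} a)"
        have ex: "\<exists>y. y \<in> slab m p0 L K \<inter> PiE {1..m} a" using x xa by blast
        have y: "y \<in> slab m p0 L K" "y \<in> PiE {1..m} a" using someI_ex[OF ex] by (auto simp: y_def)
        have "v a = f y / R" unfolding v_def y_def using ex by (rule if_P)
        then have "h k x = f y / R" using hk True by simp
        moreover have "\<bar>f x - f y\<bar> < M / 2"
          using near[OF _ a(2) PiE_mem[OF y(2)]] by (intro fe x y(1)) blast
        ultimately show ?thesis using R by simp
      next
        case False
        \<comment> \<open>Moving the coordinate \<open>p0\<close> of \<open>x\<close> to
          \<open>z\<close> stays in the same box, and in the slab because of
          \<open>K \<inter> N \<subseteq> L\<close>. It leads to a zero of \<open>f\<close>, so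
          \<open>f x\<close> is small and the forced value 0 of \<open>h k x\<close> is accurate
          enough.\<close>
        then obtain z where z: "z \<in> a p0" "z \<in> N" by blast
        have "z \<in> K" using AK(1)[OF k(1), of "a p0"] a(1) p0 z by blast
        then have zL: "z \<in> L" using z L by blast
        have y: "x(p0 := z) \<in> slab m p0 L K" using x zL p0 unfolding slab_def by (auto simp: PiE_iff extensional_def)
        have "\<bar>f x - f (x(p0 := z))\<bar> < M / 2"
          using near a(2) z(1) e p0 by (intro fe x y) auto
        moreover have "f (x(p0 := z)) = 0" using f(2)[OF y] z by simp
        ultimately show ?thesis using hk False by simp
      qed
      then have "\<bar>f x - R * h k x\<bar> / R \<le> (M / 2) / R" using R by (intro divide_right_mono) auto
      moreover have "f x / R - h k x = (f x - R * h k x) / R" using R by (simp add: field_simps)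
      then have "\<bar>f x / R - h k x\<bar> = \<bar>f x - R * h k x\<bar> / R" by (simp add: abs_divide)
      ultimately show ?thesis by simp
    qed
    have bad: "\<bar>f x / R - h k x\<bar> \<le> 3 * (M / R)" if "k < R" for k
    proof -
      have "\<bar>f x / R\<bar> \<le> M / R" using f(3)[OF x] R by (simp add: divide_right_mono)
      then show ?thesis using h2[OF that, of x] by linarith
    qed
    have "Bad = (\<Union>p\<in>{1..m}. {k. k < R \<and> x p \<notin> \<Union>(\<A> k)})"
      unfolding Bad_def by (intro set_eqI) (simp only: mem_Collect_eq UN_iff bex_simps)
    then have "card Bad \<le> (\<Sum>p\<in>{1..m}. card {k. k < R \<and> x p \<notin> \<Union>(\<A> k)})"
      by (simp add: card_UN_le)
    also have "\<dots> \<le> (\<Sum>p\<in>{1..m}. b)"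
    proof (rule sum_mono)
      fix p assume "p \<in> {1..m}"
      from xK[OF this] show "card {k. k < R \<and> x p \<notin> \<Union>(\<A> k)} \<le> b"
        using \<A> unfolding colored_families_def by blast
    qed
    finally have cB: "card Bad \<le> m * b" by simp
    have finB: "finite Bad" "Bad \<subseteq> {..<R}" unfolding Bad_def by auto
    have "f x = (\<Sum>k<R. f x / R)" using R by simp
    then have "\<bar>f x - (\<Sum>k<R. h k x)\<bar> = \<bar>\<Sum>k<R. f x / R - h k x\<bar>" by (simp only: sum_subtractf)
    also have "\<dots> \<le> (\<Sum>k<R. \<bar>f x / R - h k x\<bar>)" by (rule sum_abs)
    also have "\<dots> \<le> (\<Sum>k<R. (M / 2) / R + (if k \<in> Bad then 3 * (M / R) else 0))"
    proof (rule sum_mono)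
      fix k assume "k \<in> {..<R}"
      then show "\<bar>f x / R - h k x\<bar> \<le> (M / 2) / R + (if k \<in> Bad then 3 * (M / R) else 0)"
        using good[of k] bad[of k] MR by (cases "k \<in> Bad") auto
    qed
    also have "\<dots> = M / 2 + (\<Sum>k<R. if k \<in> Bad then 3 * (M / R) else 0)"
      using R by (simp add: sum.distrib)
    also have "(\<Sum>k<R. if k \<in> Bad then 3 * (M / R) else 0) = real (card Bad) * (3 * (M / R))"
    proof -
      have "(\<Sum>k<R. if k \<in> Bad then 3 * (M / R) else 0) = (\<Sum>k\<in>Bad. 3 * (M / R))"
        using finB by (simp add: sum.If_cases Int_absorb1)
      then show ?thesis by simp
    qed
    also have "real (card Bad) * (3 * (M / R)) \<le> M / 4"
    proof -
      have "12 * card Bad \<le> R" using cB R(2) by linarith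
      then have "real (12 * card Bad) \<le> real R" by (rule of_nat_mono)
      then have "12 * real (card Bad) * M \<le> R * M" using f(4) by (intro mult_right_mono) auto
      then show ?thesis using R by (simp add: field_simps)
    qed
    finally show ?thesis by simp
  qed
  have "\<bar>g k t\<bar> \<le> M" if "k < R" for k t
  proof -
    have "M / R \<le> M" using R f(4) by (simp add: field_simps)
    then show ?thesis using g2[OF that, of t] by linarith
  qed
  then show ?thesis using g1 g3 main unfolding h_def tag_difference_def by (intro exI[of _ g]) blast
qed

lemma continuous_on_tag_difference:
  assumes "\<And>k. k < R \<Longrightarrow> continuous_on UNIV (g k)" "\<And>x p. x \<in> D \<Longrightarrow> p \<in> {1..m} \<Longrightarrow> x p \<in> K"
  shows "continuous_on D (tag_difference g)"
proof -
  have "continuous_on D (\<lambda>x. \<Sum>k<R. g k (tagged_sum m p0 (\<Phi> k) True x) - g k (tagged_sum m p0 (\<Phi> k) False x))"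
  proof (intro continuous_on_sum continuous_on_diff)
    fix k assume "k \<in> {..<R}"
    then have k: "k < R" by simp
    have "continuous_on D (\<lambda>x. g k (tagged_sum m p0 (\<Phi> k) b x))" for b
      by (rule continuous_on_compose2[OF assms(1)[OF k] continuous_on_tagged_sum[where K = K]])
        (use cont[OF k] assms(2) p0 in auto)
    then show "continuous_on D (\<lambda>x. g k (tagged_sum m p0 (\<Phi> k) True x))"
      "continuous_on D (\<lambda>x. g k (tagged_sum m p0 (\<Phi> k) False x))" by auto
  qed
  then show ?thesis unfolding tag_difference_def[abs_def] .
qed

lemma tag_difference_eq_0:
  assumes "x p0 \<in> K \<inter> N"
  shows "tag_difference g x = 0"
  unfolding tag_difference_def tagged_sum_def using zero[OF _ assms] by simp

text \<open>The approximation can be iterated because tag differences vanish over \<open>N\<close>: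
  each remainder satisfies the same hypotheses as \<open>f\<close>. The outer functions are
  dominated by a geometric series, and their common bound on the support passes to the sum.\<close>

proposition superposition_on_slab:
  assumes L: "compact L" "L \<subseteq> K" "K \<inter> N \<subseteq> L"
    and f: "continuous_on (slab m p0 L K) f" "\<And>x. x \<in> slab m p0 L K \<Longrightarrow> x p0 \<in> N \<Longrightarrow> f x = 0"
  shows "\<exists>g. (\<forall>k<R. continuous_on UNIV (g k) \<and> (\<forall>t. \<bar>t\<bar> \<ge> real m + 2 \<longrightarrow> g k t = 0)) \<and>
    (\<forall>x\<in>slab m p0 L K. f x = tag_difference g x)"
proof -
  define D where "D = slab m p0 L K"
  have DK: "x p \<in> K" if "x \<in> D" "p \<in> {1..m}" for x p
    using PiE_mem[OF that[unfolded D_def slab_def]] L(2) by (auto split: if_splits)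
  have "compact D" unfolding D_def slab_def using K L(1) by (intro compact_PiE_fun) simp
  then have "bounded (f ` D)" using f(1) unfolding D_def[symmetric]
    by (intro compact_imp_bounded compact_continuous_image)
  then obtain M where M: "M > 0" "\<And>x. x \<in> D \<Longrightarrow> \<bar>f x\<bar> \<le> M" unfolding bounded_pos by auto
  define P where "P n h \<longleftrightarrow> continuous_on D h \<and> (\<forall>x\<in>D. x p0 \<in> N \<longrightarrow> h x = 0) \<and> (\<forall>x\<in>D. \<bar>h x\<bar> \<le> (3/4)^n * M) \<and>
     (n = 0 \<longrightarrow> h = f)" for n :: nat and h
  define G where "G n g \<longleftrightarrow> (\<forall>k<R. continuous_on UNIV (g k) \<and> (\<forall>t. \<bar>g k t\<bar> \<le> (3/4)^n * M) \<and> (\<forall>t. \<bar>t\<bar> \<ge> real m + 2 \<longrightarrow> g k t = 0))"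
    for n :: nat and g :: "nat \<Rightarrow> real \<Rightarrow> real"
  have "\<exists>F. \<forall>n. P n (F n) \<and> (\<exists>g. G n g \<and> F (Suc n) = (\<lambda>x. F n x - tag_difference g x))"
  proof (rule dependent_nat_choice)
    show "\<exists>h. P 0 h" using f M unfolding P_def D_def by (intro exI[of _ f]) simp
    fix h n assume h: "P n h"
    have "(3/4)^n * M > 0" using M(1) by simp
    then obtain g where g: "G n g" "\<And>x. x \<in> D \<Longrightarrow> \<bar>h x - tag_difference g x\<bar> \<le> 3/4 * ((3/4)^n * M)"
      using approximation_step[OF L, of h "(3/4)^n * M"] h unfolding P_def D_def G_def by blast
    have "P (Suc n) (\<lambda>x. h x - tag_difference g x)" unfolding P_def
    proof (intro conjI ballI impI)
      show "continuous_on D (\<lambda>x. h x - tag_difference g x)"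
        using h g(1) DK unfolding P_def G_def by (intro continuous_on_diff continuous_on_tag_difference) auto
      show "h x - tag_difference g x = 0" if "x \<in> D" "x p0 \<in> N" for x
        using h DK[OF that(1) p0] that tag_difference_eq_0[of x g] unfolding P_def by simp
      show "\<bar>h x - tag_difference g x\<bar> \<le> (3/4) ^ Suc n * M" if "x \<in> D" for x
        using g(2)[OF that] by (simp add: mult.assoc)
    qed simp
    then show "\<exists>h'. P (Suc n) h' \<and> (\<exists>g. G n g \<and> h' = (\<lambda>x. h x - tag_difference g x))" using g(1) by blast
  qed
  then obtain F where F: "\<And>n. P n (F n)" "\<And>n. \<exists>g. G n g \<and> F (Suc n) = (\<lambda>x. F n x - tag_difference g x)" by blast
  from F(2) have "\<forall>n. \<exists>g. G n g \<and> F (Suc n) = (\<lambda>x. F n x - tag_difference g x)" by blast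
  from choice[OF this] obtain g where g: "\<And>n. G n (g n)" "\<And>n. F (Suc n) = (\<lambda>x. F n x - tag_difference (g n) x)" by blast
  have gb: "\<bar>g n k t\<bar> \<le> (3/4)^n * M" if "k < R" for n k t using g(1)[of n] that unfolding G_def by blast
  have "summable (\<lambda>n. (3/4::real)^n * M)" by (intro summable_mult2 summable_geometric) simp
  then have lim: "uniform_limit UNIV (\<lambda>n t. \<Sum>i<n. g i k t) (\<lambda>t. \<Sum>i. g i k t) sequentially" if "k < R" for k
    using gb[OF that] by (intro Weierstrass_m_test[where M = "\<lambda>n. (3/4)^n * M"]) auto
  define h where "h k t = (\<Sum>i. g i k t)" for k t
  have partial: "F n x = f x - (\<Sum>i<n. tag_difference (g i) x)" for n x
  proof (induction n)
    case 0
    then show ?case using F(1)[of 0] by (simp add: P_def)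
  qed (simp add: g(2))
  show ?thesis
  proof (intro exI[of _ h] conjI allI impI ballI)
    fix k assume k: "k < R"
    show "continuous_on UNIV (h k)" unfolding h_def
    proof (rule uniform_limit_theorem[OF _ lim[OF k]])
      show "\<forall>\<^sub>F n in sequentially. continuous_on UNIV (\<lambda>t. \<Sum>i<n. g i k t)"
        using g(1) k unfolding G_def by (intro always_eventually allI continuous_on_sum) blast
    qed simp
    show "h k t = 0" if "\<bar>t\<bar> \<ge> real m + 2" for t
    proof -
      have "g i k t = 0" for i using g(1)[of i] k that unfolding G_def by blast
      then show ?thesis by (simp add: h_def)
    qed
  next
    fix x assume x: "x \<in> slab m p0 L K"
    have lim': "(\<lambda>n. \<Sum>i<n. g i k t) \<longlonglongrightarrow> h k t" if "k < R" for k t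
      using tendsto_uniform_limitI[OF lim[OF that]] unfolding h_def by blast
    have "(\<lambda>n. \<Sum>k<R. (\<Sum>i<n. g i k (tagged_sum m p0 (\<Phi> k) True x)) - (\<Sum>i<n. g i k (tagged_sum m p0 (\<Phi> k) False x)))
      \<longlonglongrightarrow> tag_difference h x"
      unfolding tag_difference_def by (intro tendsto_sum tendsto_diff lim') auto
    moreover have "(\<Sum>k<R. (\<Sum>i<n. g i k (tagged_sum m p0 (\<Phi> k) True x)) - (\<Sum>i<n. g i k (tagged_sum m p0 (\<Phi> k) False x)))
       = (\<Sum>i<n. tag_difference (g i) x)" for n
      unfolding tag_difference_def sum_subtractf[symmetric] by (rule sum.swap)
    ultimately have l1: "(\<lambda>n. \<Sum>i<n. tag_difference (g i) x) \<longlonglongrightarrow> tag_difference h x" by simp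
    have "(\<lambda>n. (3/4::real)^n * M) \<longlonglongrightarrow> 0" by (intro tendsto_mult_left_zero LIMSEQ_realpow_zero) auto
    moreover have "\<bar>F n x\<bar> \<le> (3/4)^n * M" for n using F(1)[of n] x unfolding P_def D_def by blast
    ultimately have "(\<lambda>n. F n x) \<longlonglongrightarrow> 0"
      by (intro Lim_null_comparison[of "\<lambda>n. F n x" "\<lambda>n. (3/4)^n * M"]) auto
    then have "(\<lambda>n. f x - F n x) \<longlonglongrightarrow> f x - 0" by (intro tendsto_diff tendsto_const)
    then have "(\<lambda>n. \<Sum>i<n. tag_difference (g i) x) \<longlonglongrightarrow> f x" using partial by simp
    with l1 show "f x = tag_difference h x" using LIMSEQ_unique by blast
  qed
qed

end

subsection \<open>Superposition with one non-compact coordinate\<close>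

lemma slab_iff:
  assumes "p0 \<in> {1..m}"
  shows "x \<in> slab m p0 A K \<longleftrightarrow> x p0 \<in> A \<and> (\<forall>p\<in>{1..m}. p \<noteq> p0 \<longrightarrow> x p \<in> K) \<and> x \<in> extensional {1..m}"
  using assms unfolding slab_def PiE_iff by auto

text \<open>\<open>\<rho>\<close> is a proper function, so its sublevel sets are compact and its
  even levels cut the non-compact coordinate into cells. The cosine is at least 1/2 exactly in a
  zone around each even level; there \<open>f\<close> is assumed to vanish.\<close>

proposition superposition_one_proper_coordinate:
  fixes K :: "'b::{metric_space,second_countable_topology} set"
  assumes K: "compact K" and p0: "p0 \<in> {1..m}" and col: "colorable K b"
    and \<rho>: "continuous_on (K - {\<omega>}) \<rho>" "\<And>x. x \<in> K - {\<omega>} \<Longrightarrow> \<rho> x \<ge> 0"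
      "\<And>c. compact {x \<in> K - {\<omega>}. \<rho> x \<le> c}"
    and R: "R > 0" "12 * m * b \<le> R"
  shows "\<exists>\<psi> :: nat \<Rightarrow> bool \<Rightarrow> nat \<Rightarrow> 'b \<Rightarrow> real. (\<forall>k<R. \<forall>i. \<forall>p\<in>{1..m}. continuous_on (if p = p0 then K - {\<omega>} else K) (\<psi> k i p)) \<and>
    (\<forall>f::(nat \<Rightarrow> 'b) \<Rightarrow> real. continuous_on (slab m p0 (K - {\<omega>}) K) f \<and>
         (\<forall>x\<in>slab m p0 (K - {\<omega>}) K. cos (pi * \<rho> (x p0)) \<ge> 1/2 \<longrightarrow> f x = 0) \<longrightarrow>
       (\<exists>g. (\<forall>k<R. continuous_on UNIV (g k)) \<and> (\<forall>x\<in>slab m p0 (K - {\<omega>}) K.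
          f x = (\<Sum>k<R. g k (\<Sum>p=1..m. \<psi> k True p (x p)) - g k (\<Sum>p=1..m. \<psi> k False p (x p))))))"
proof -
  define U where "U = {x \<in> K - {\<omega>}. cos (pi * \<rho> x) < 1/2}"
  \<comment> \<open>\<open>U\<close> is the union of the open cells \<open>2 * j < \<rho> x < 2 * j + 2\<close>, shrunk so that the zones between
     consecutive cells are thick enough for the offset \<open>B\<close> below to jump there.\<close>
  define N where "N = insert \<omega> (K - U)"
  have opK: "openin (top_of_set K) (K - {\<omega>})"
    using openin_open_Int[of "- {\<omega>}" K] by (simp add: Diff_eq open_Compl)
  have "openin (top_of_set (K - {\<omega>})) ((K - {\<omega>}) \<inter> (\<lambda>x. cos (pi * \<rho> x)) -` {..<1/2})"
    using \<rho>(1) by (intro continuous_openin_preimage_gen continuous_intros) auto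
  moreover have "(K - {\<omega>}) \<inter> (\<lambda>x. cos (pi * \<rho> x)) -` {..<1/2} = U" by (auto simp: U_def)
  ultimately have "openin (top_of_set K) U" using opK openin_trans by fastforce
  then have "closedin (top_of_set K) (K - U)" by (simp add: closedin_diff)
  then have "closed (K - U)" using K by (meson closedin_closed_trans compact_imp_closed)
  then have clN: "closed N" by (simp add: N_def closed_insert)
  obtain \<Phi> :: "nat \<Rightarrow> nat \<Rightarrow> 'b \<Rightarrow> real" where \<Phi>:
    "\<And>k p. k < R \<Longrightarrow> p \<le> m \<Longrightarrow> continuous_on K (\<Phi> k p)"
    "\<And>k p x. k < R \<Longrightarrow> p \<le> m \<Longrightarrow> x \<in> K \<Longrightarrow> \<bar>\<Phi> k p x\<bar> \<le> 1"
    "\<And>k x. k < R \<Longrightarrow> x \<in> K \<inter> N \<Longrightarrow> \<Phi> k 0 x = 0"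
    "\<And>\<epsilon>. \<epsilon> > 0 \<Longrightarrow> \<exists>\<A>. colored_families K b R \<epsilon> \<A> \<and> (\<forall>k<R. separates_boxes m p0 N (\<A> k) (\<Phi> k))"
  proof (rule generic_separation[OF K clN p0 col, of R], goal_cases)
    case (1 \<Phi>)
    from 1(1)[OF 1(2-5)] show ?case .
  qed
  interpret separating_system K N m p0 b R \<Phi>
    by unfold_locales (fact K p0 \<Phi> R)+
  define C where "C j = {x \<in> K - {\<omega>}. \<rho> x \<le> 2 * real j + 2 \<and> 2 * real j \<le> \<rho> x \<and> cos (pi * \<rho> x) \<le> 1/2}" for j :: nat
  have compC: "compact (C j)" for j
  proof -
    define T where "T = {x \<in> K - {\<omega>}. \<rho> x \<le> 2 * real j + 2}"
    have cT: "compact T" unfolding T_def by (rule \<rho>(3))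
    have "continuous_on T \<rho>" by (rule continuous_on_subset[OF \<rho>(1)]) (auto simp: T_def)
    then have "closedin (top_of_set T) (T \<inter> \<rho> -` {2 * real j..} \<inter> (T \<inter> (\<lambda>x. cos (pi * \<rho> x)) -` {..1/2}))"
      by (intro closedin_Int continuous_closedin_preimage continuous_intros) auto
    moreover have "C j = T \<inter> \<rho> -` {2 * real j..} \<inter> (T \<inter> (\<lambda>x. cos (pi * \<rho> x)) -` {..1/2})"
      by (auto simp: C_def T_def)
    ultimately show ?thesis using cT closedin_compact by metis
  qed
  define L where "L j = C j \<union> (K \<inter> N)" for j
  have compN: "compact (K \<inter> N)" using K clN by (simp add: compact_Int_closed)
  have L: "compact (L j)" "L j \<subseteq> K" "K \<inter> N \<subseteq> L j" for j
    using compC compN by (auto simp: L_def C_def)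
  \<comment> \<open>A tagged sum is at most \<open>m + 1\<close> in absolute value, and the outer
    functions of a cell vanish from \<open>m + 2\<close> on. With offsets at least \<open>H\<close>
    apart, the values over one cell stay outside the supports belonging to all the others.\<close>
  define H where "H = 2 * real m + 3"
  define S where "S = {x \<in> K - {\<omega>}. cos (pi * \<rho> x) \<le> 1/2}"
  have notint: "\<rho> x / 2 \<notin> \<int>" if "x \<in> S" for x
  proof
    assume "\<rho> x / 2 \<in> \<int>"
    then obtain n where "\<rho> x / 2 = of_int n" by (elim Ints_cases)
    then have "pi * \<rho> x = 2 * pi * of_int n" by simp
    then have "cos (pi * \<rho> x) = 1" using cos_int_2pin by metis
    then show False using that by (simp add: S_def)
  qed
  \<comment> \<open>Outside the zones \<open>\<rho> x / 2\<close> is never an integer, so its floor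
    is continuous there and constant on each cell. Tietze's theorem then carries the offset across
    the zones.\<close>
  have "continuous_on S (\<lambda>x. H * of_int \<lfloor>\<rho> x / 2\<rfloor>)"
  proof -
    have "continuous_on S (\<lambda>x. \<rho> x / 2)"
      by (intro continuous_intros continuous_on_subset[OF \<rho>(1)]) (auto simp: S_def)
    then have "continuous_on S (\<lambda>x. real_of_int \<lfloor>\<rho> x / 2\<rfloor>)"
      by (rule continuous_on_compose2[OF continuous_on_of_int_floor]) (use notint in auto)
    then show ?thesis by (rule continuous_on_mult_left)
  qed
  moreover have "closedin (top_of_set (K - {\<omega>})) S"
  proof -
    have "closedin (top_of_set (K - {\<omega>})) ((K - {\<omega>}) \<inter> (\<lambda>x. cos (pi * \<rho> x)) -` {..1/2})"
      using \<rho>(1) by (intro continuous_closedin_preimage continuous_intros) auto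
    moreover have "(K - {\<omega>}) \<inter> (\<lambda>x. cos (pi * \<rho> x)) -` {..1/2} = S" by (auto simp: S_def)
    ultimately show ?thesis by simp
  qed
  ultimately obtain B where B: "continuous_on (K - {\<omega>}) B" "\<And>x. x \<in> S \<Longrightarrow> B x = H * of_int \<lfloor>\<rho> x / 2\<rfloor>"
    using Tietze_unbounded[of S "\<lambda>x. H * of_int \<lfloor>\<rho> x / 2\<rfloor>" "K - {\<omega>}"] by blast
  have BC: "B x = H * real j" if "x \<in> C j" for x j
  proof -
    have xS: "x \<in> S" using that by (simp add: C_def S_def)
    have "\<rho> x / 2 \<noteq> of_int (int j + 1)" using notint[OF xS] by (metis Ints_of_int)
    then have "\<lfloor>\<rho> x / 2\<rfloor> = int j" using that by (intro floor_unique) (auto simp: C_def)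
    then show ?thesis using B(2)[OF xS] by simp
  qed
  define \<psi> where "\<psi> k i p x = (if p = p0 then B x + \<Phi> k p x + (if i then \<Phi> k 0 x else 0) else \<Phi> k p x)" for k i p x
  have sum\<psi>: "(\<Sum>p=1..m. \<psi> k i p (x p)) = B (x p0) + tagged_sum m p0 (\<Phi> k) i x" for k i x
  proof -
    have "(\<Sum>p=1..m. \<psi> k i p (x p)) = (\<Sum>p=1..m. \<Phi> k p (x p) +
        (if p = p0 then B (x p0) + (if i then \<Phi> k 0 (x p0) else 0) else 0))"
      by (intro sum.cong) (auto simp: \<psi>_def)
    then show ?thesis using p0 by (simp add: sum.distrib tagged_sum_def)
  qed
  have cont\<psi>: "continuous_on (if p = p0 then K - {\<omega>} else K) (\<psi> k i p)" if "k < R" "p \<in> {1..m}" for k i p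
  proof (cases "p = p0")
    case True
    have "continuous_on (K - {\<omega>}) (\<lambda>x. B x + \<Phi> k p x + (if i then \<Phi> k 0 x else 0))"
      using B(1) continuous_on_subset[OF \<Phi>(1)[OF that(1)], of _ "K - {\<omega>}"] that
      by (cases i) (auto intro!: continuous_on_add)
    then show ?thesis using True by (simp add: \<psi>_def[abs_def])
  next
    case False
    then show ?thesis using \<Phi>(1)[OF that(1), of p] that by (simp add: \<psi>_def[abs_def])
  qed
  have "\<exists>g. (\<forall>k<R. continuous_on UNIV (g k)) \<and> (\<forall>x\<in>slab m p0 (K - {\<omega>}) K.
          f x = (\<Sum>k<R. g k (\<Sum>p=1..m. \<psi> k True p (x p)) - g k (\<Sum>p=1..m. \<psi> k False p (x p))))"
    if f: "continuous_on (slab m p0 (K - {\<omega>}) K) f"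
      and f0: "\<And>x. x \<in> slab m p0 (K - {\<omega>}) K \<Longrightarrow> cos (pi * \<rho> (x p0)) \<ge> 1/2 \<Longrightarrow> f x = 0" for f :: "(nat \<Rightarrow> 'b) \<Rightarrow> real"
  proof -
    \<comment> \<open>One cell of \<open>f\<close>, continued by 0 over \<open>N\<close>. The cell
      \<open>C j\<close> meets \<open>N\<close> only where the cosine equals 1/2, and there
      \<open>f\<close> is 0, so the two closed parts of the slab fit together.\<close>
    define F where "F j x = (if x p0 \<in> C j then f x else 0)" for j x
    have slab_p0: "x p0 \<in> A" if "x \<in> slab m p0 A K" for x A
      using PiE_mem[OF that[unfolded slab_def] p0] by simp
    have slab_mono: "slab m p0 A K \<subseteq> slab m p0 A' K" if "A \<subseteq> A'" for A A'
      unfolding slab_def using that by (intro PiE_mono) auto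
    have FN: "F j x = 0" if "x \<in> slab m p0 (K \<inter> N) K" for j x
    proof (cases "x p0 \<in> C j")
      case True
      then have "x \<in> slab m p0 (K - {\<omega>}) K" using that by (simp add: slab_iff[OF p0] C_def)
      moreover have "cos (pi * \<rho> (x p0)) \<ge> 1/2"
        using slab_p0[OF that] True by (auto simp: N_def U_def C_def)
      ultimately show ?thesis using f0 by (simp add: F_def)
    qed (simp add: F_def)
    have slab_closed: "closed (slab m p0 A K)" if "compact A" for A
      unfolding slab_def using that K by (intro compact_imp_closed compact_PiE_fun) auto
    have contF: "continuous_on (slab m p0 (L j) K) (F j)" for j
    proof -
      have "continuous_on (slab m p0 (C j) K) f"
        by (rule continuous_on_subset[OF f slab_mono]) (auto simp: C_def)
      then have "continuous_on (slab m p0 (C j) K) (F j)"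
        by (rule continuous_on_eq) (use slab_p0 in \<open>auto simp: F_def\<close>)
      moreover have "continuous_on (slab m p0 (K \<inter> N) K) (F j)"
        by (rule continuous_on_eq[OF continuous_on_const[of _ 0]]) (use FN in auto)
      ultimately have "continuous_on (slab m p0 (C j) K \<union> slab m p0 (K \<inter> N) K) (F j)"
        using compC compN by (intro continuous_on_closed_Un slab_closed)
      moreover have "slab m p0 (L j) K \<subseteq> slab m p0 (C j) K \<union> slab m p0 (K \<inter> N) K"
        unfolding L_def by (auto simp: slab_iff[OF p0])
      ultimately show ?thesis using continuous_on_subset by blast
    qed
    have "\<exists>g. (\<forall>k<R. continuous_on UNIV (g k) \<and> (\<forall>t. \<bar>t\<bar> \<ge> real m + 2 \<longrightarrow> g k t = 0)) \<and>
       (\<forall>x\<in>slab m p0 (L j) K. F j x = tag_difference g x)" for j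
    proof (rule superposition_on_slab[OF L contF])
      show "F j x = 0" if "x \<in> slab m p0 (L j) K" "x p0 \<in> N" for x
      proof (rule FN)
        show "x \<in> slab m p0 (K \<inter> N) K"
          using that L(2)[of j] by (auto simp: slab_iff[OF p0])
      qed
    qed
    then have "\<forall>j. \<exists>g. (\<forall>k<R. continuous_on UNIV (g k) \<and> (\<forall>t. \<bar>t\<bar> \<ge> real m + 2 \<longrightarrow> g k t = 0)) \<and>
       (\<forall>x\<in>slab m p0 (L j) K. F j x = tag_difference g x)" ..
    from choice[OF this] obtain G where G: "\<forall>j. (\<forall>k<R. continuous_on UNIV (G j k) \<and> (\<forall>t. \<bar>t\<bar> \<ge> real m + 2 \<longrightarrow> G j k t = 0)) \<and>
       (\<forall>x\<in>slab m p0 (L j) K. F j x = tag_difference (G j) x)" ..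
    have Gc: "continuous_on UNIV (G j k)" if "k < R" for j k using G that by blast
    have G0: "G j k t = 0" if "k < R" "\<bar>t\<bar> \<ge> real m + 2" for j k t using G that by blast
    have GF: "F j x = tag_difference (G j) x" if "x \<in> slab m p0 (L j) K" for j x using G that by blast
    \<comment> \<open>The locally finite sum of the outer functions of all cells, each shifted by
      its offset, cut off beyond the terms that can be nonzero at \<open>t\<close>. Any larger
      cutoff gives the same value, so near a point one cutoff serves all arguments and continuity
      follows.\<close>
    define g where "g k t = (\<Sum>j\<le>nat \<lceil>\<bar>t\<bar>\<rceil> + 1. G j k (t - H * real j))" for k t
    have g_eq: "g k t = (\<Sum>j\<le>n + 1. G j k (t - H * real j))" if "k < R" "\<bar>t\<bar> \<le> real n" for k t n
      unfolding g_def
    proof (rule sum.mono_neutral_left)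
      show "{..nat \<lceil>\<bar>t\<bar>\<rceil> + 1} \<subseteq> {..n + 1}" using that(2) by (simp add: nat_le_iff ceiling_le_iff)
      show "\<forall>j\<in>{..n + 1} - {..nat \<lceil>\<bar>t\<bar>\<rceil> + 1}. G j k (t - H * real j) = 0"
      proof
        fix j assume "j \<in> {..n + 1} - {..nat \<lceil>\<bar>t\<bar>\<rceil> + 1}"
        then have "nat \<lceil>\<bar>t\<bar>\<rceil> + 1 < j" by simp
        moreover have "\<bar>t\<bar> \<le> real (nat \<lceil>\<bar>t\<bar>\<rceil>)" by linarith
        ultimately have j: "\<bar>t\<bar> + 1 \<le> real j" by linarith
        have "(2 * real m + 2) * 1 \<le> (2 * real m + 2) * real j" using j by (intro mult_left_mono) auto
        then have "H * real j - \<bar>t\<bar> \<ge> 2 * real m + 2 + 1" using j by (simp add: H_def algebra_simps)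
        then show "G j k (t - H * real j) = 0" by (intro G0[OF that(1)]) linarith
      qed
    qed simp
    have gc: "continuous_on UNIV (g k)" if k: "k < R" for k
    proof -
      have "isCont (g k) t" for t
      proof -
        define n where "n = nat \<lceil>\<bar>t\<bar>\<rceil> + 1"
        have n: "\<bar>t\<bar> < real n" unfolding n_def by linarith
        have "continuous_on {- real n<..<real n} (\<lambda>t. \<Sum>j\<le>n + 1. G j k (t - H * real j))"
          by (intro continuous_on_sum continuous_on_compose2[OF Gc[OF k]] continuous_intros) auto
        then have "continuous_on {- real n<..<real n} (g k)"
          by (rule continuous_on_eq) (rule g_eq[OF k, symmetric], simp add: abs_le_iff)
        then show ?thesis using n by (simp add: continuous_on_eq_continuous_at abs_less_iff)
      qed
      then show ?thesis by (simp add: continuous_at_imp_continuous_on)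
    qed
    show ?thesis
    proof (intro exI[of _ g] conjI allI impI ballI gc)
      fix x assume x: "x \<in> slab m p0 (K - {\<omega>}) K"
      have xp: "x p0 \<in> K - {\<omega>}" using slab_p0[OF x] .
      have xK: "x p \<in> K" if "p \<in> {1..m}" for p
        using PiE_mem[OF x[unfolded slab_def] that] by (auto split: if_splits)
      show "f x = (\<Sum>k<R. g k (\<Sum>p=1..m. \<psi> k True p (x p)) - g k (\<Sum>p=1..m. \<psi> k False p (x p)))"
      proof (cases "x p0 \<in> U")
        case False
        \<comment> \<open>Over the zones the value of the offset is unknown, but both tags give
          \<open>g k\<close> the same argument.\<close>
        then have "x p0 \<in> K \<inter> N" using xp by (simp add: N_def)
        then have "tagged_sum m p0 (\<Phi> k) True x = tagged_sum m p0 (\<Phi> k) False x" if "k < R" for k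
          using \<Phi>(3)[OF that] by (simp add: tagged_sum_def)
        then have "(\<Sum>k<R. g k (\<Sum>p=1..m. \<psi> k True p (x p)) - g k (\<Sum>p=1..m. \<psi> k False p (x p))) = 0"
          unfolding sum\<psi> by (intro sum.neutral) simp
        moreover have "f x = 0" using False xp by (intro f0 x) (simp add: U_def)
        ultimately show ?thesis by simp
      next
        case True
        define j where "j = nat \<lfloor>\<rho> (x p0) / 2\<rfloor>"
        have "\<rho> (x p0) \<ge> 0" using \<rho>(2) xp by blast
        then have "real j \<le> \<rho> (x p0) / 2" "\<rho> (x p0) / 2 < real j + 1" unfolding j_def by linarith+
        then have Cj: "x p0 \<in> C j" using True xp by (simp add: C_def U_def)
        have xL: "x \<in> slab m p0 (L j) K" using x Cj by (simp add: slab_iff[OF p0] L_def)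
        have "g k (H * real j + tagged_sum m p0 (\<Phi> k) i x) = G j k (tagged_sum m p0 (\<Phi> k) i x)" if k: "k < R" for k i
        proof -
          define s where "s = tagged_sum m p0 (\<Phi> k) i x"
          have s: "\<bar>s\<bar> \<le> real m + 1" unfolding s_def using \<Phi>(2)[OF k] xK p0 by (intro tagged_sum_bound) auto
          define n where "n = nat \<lceil>\<bar>H * real j + s\<bar>\<rceil> + j"
          have n: "\<bar>H * real j + s\<bar> \<le> real n" "j \<le> n + 1" unfolding n_def by linarith+
          have "g k (H * real j + s) = (\<Sum>j'\<le>n + 1. G j' k (H * real j + s - H * real j'))" by (rule g_eq[OF k n(1)])
          also have "\<dots> = (\<Sum>j'\<in>{j}. G j' k (H * real j + s - H * real j'))"
          proof (rule sum.mono_neutral_right)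
            show "\<forall>j'\<in>{..n + 1} - {j}. G j' k (H * real j + s - H * real j') = 0"
            proof
              fix j' assume "j' \<in> {..n + 1} - {j}"
              then have "1 \<le> \<bar>real j - real j'\<bar>" by auto
              then have "H * 1 \<le> H * \<bar>real j - real j'\<bar>" by (intro mult_left_mono) (simp_all add: H_def)
              also have "\<dots> = \<bar>H * real j - H * real j'\<bar>" by (simp add: H_def abs_mult right_diff_distrib[symmetric])
              finally show "G j' k (H * real j + s - H * real j') = 0"
                using s by (intro G0[OF k]) (simp add: H_def)
            qed
          qed (use n(2) in auto)
          finally show ?thesis by (simp add: s_def)
        qed
        then have "(\<Sum>k<R. g k (\<Sum>p=1..m. \<psi> k True p (x p)) - g k (\<Sum>p=1..m. \<psi> k False p (x p))) = tag_difference (G j) x"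
          unfolding tag_difference_def sum\<psi> by (intro sum.cong) (auto simp: BC[OF Cj])
        also have "\<dots> = F j x" using GF[OF xL] by simp
        finally show ?thesis using Cj by (simp add: F_def)
      qed
    qed
  qed
  note representation = this
  show ?thesis
  proof (intro exI[of _ \<psi>] conjI allI impI ballI)
    show "continuous_on (if p = p0 then K - {\<omega>} else K) (\<psi> k i p)" if "k < R" "p \<in> {1..m}" for k i p
      using cont\<psi> that .
  qed (rule representation, blast+)
qed

subsection \<open>Superposition on finite powers\<close>

lemma superposition_sum_indexed:
  fixes X :: "'b::topological_space set" and Q :: "'q set" and \<Psi> :: "'q \<Rightarrow> nat \<Rightarrow> 'b \<Rightarrow> real"
  assumes "finite Q" "Q \<noteq> {}"
    and \<Psi>: "\<And>q p. q \<in> Q \<Longrightarrow> p \<in> {1..m} \<Longrightarrow> continuous_on X (\<Psi> q p)"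
    and rep: "\<And>f :: (nat \<Rightarrow> 'b) \<Rightarrow> real. continuous_on (PiE {1..m} (\<lambda>_. X)) f \<Longrightarrow>
      \<exists>g. (\<forall>q\<in>Q. continuous_on UNIV (g q)) \<and> (\<forall>x\<in>PiE {1..m} (\<lambda>_. X). f x = (\<Sum>q\<in>Q. g q (\<Sum>p=1..m. \<Psi> q p (x p))))"
  shows "\<exists>r\<ge>1. \<exists>\<psi> :: nat \<Rightarrow> nat \<Rightarrow> 'b \<Rightarrow> real. (\<forall>p\<in>{1..m}. \<forall>q\<in>{1..r}. continuous_on X (\<psi> p q)) \<and>
    (\<forall>f :: (nat \<Rightarrow> 'b) \<Rightarrow> real. continuous_on (PiE {1..m} (\<lambda>_. X)) f \<longrightarrow>
      (\<exists>g. (\<forall>q\<in>{1..r}. continuous_on UNIV (g q)) \<and>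
        (\<forall>x\<in>PiE {1..m} (\<lambda>_. X). f x = (\<Sum>q=1..r. g q (\<Sum>p=1..m. \<psi> p q (x p))))))"
proof -
  obtain h where h: "bij_betw h {1..card Q} Q"
    using ex_bij_betw_nat_finite_1[OF assms(1)] by blast
  have hQ: "h q \<in> Q" if "q \<in> {1..card Q}" for q using h that bij_betwE by blast
  show ?thesis
  proof (intro exI[of _ "card Q"] exI[of _ "\<lambda>p q. \<Psi> (h q) p"] conjI ballI allI impI)
    show "1 \<le> card Q" using assms(1,2) by (simp add: Suc_le_eq card_gt_0_iff)
    show "continuous_on X (\<Psi> (h q) p)" if "p \<in> {1..m}" "q \<in> {1..card Q}" for p q
      using \<Psi>[OF hQ[OF that(2)] that(1)] .
    fix f :: "(nat \<Rightarrow> 'b) \<Rightarrow> real" assume "continuous_on (PiE {1..m} (\<lambda>_. X)) f"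
    from rep[OF this] obtain g where g: "\<forall>q\<in>Q. continuous_on UNIV (g q)"
      "\<forall>x\<in>PiE {1..m} (\<lambda>_. X). f x = (\<Sum>q\<in>Q. g q (\<Sum>p=1..m. \<Psi> q p (x p)))" by blast
    have "(\<Sum>q=1..card Q. g (h q) (\<Sum>p=1..m. \<Psi> (h q) p (x p))) = (\<Sum>q\<in>Q. g q (\<Sum>p=1..m. \<Psi> q p (x p)))" for x
      by (rule sum.reindex_bij_betw[OF h])
    then show "\<exists>g. (\<forall>q\<in>{1..card Q}. continuous_on UNIV (g q)) \<and>
        (\<forall>x\<in>PiE {1..m} (\<lambda>_. X). f x = (\<Sum>q=1..card Q. g q (\<Sum>p=1..m. \<Psi> (h q) p (x p))))"
      using g hQ by (intro exI[of _ "\<lambda>q. g (h q)"]) simp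
  qed
qed

proposition superposition_power:
  fixes K :: "'b::{metric_space,second_countable_topology} set" and \<omega> :: 'b
  assumes K: "compact K" and m: "m \<ge> 1" and col: "colorable K b"
  defines "X \<equiv> K - {\<omega>}"
  shows "\<exists>r\<ge>1. \<exists>\<psi> :: nat \<Rightarrow> nat \<Rightarrow> 'b \<Rightarrow> real. (\<forall>p\<in>{1..m}. \<forall>q\<in>{1..r}. continuous_on X (\<psi> p q)) \<and>
    (\<forall>f :: (nat \<Rightarrow> 'b) \<Rightarrow> real. continuous_on (PiE {1..m} (\<lambda>_. X)) f \<longrightarrow>
      (\<exists>g. (\<forall>q\<in>{1..r}. continuous_on UNIV (g q)) \<and>
        (\<forall>x\<in>PiE {1..m} (\<lambda>_. X). f x = (\<Sum>q=1..r. g q (\<Sum>p=1..m. \<psi> p q (x p))))))"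
proof -
  define d where "d x = dist x \<omega>" for x
  have contd: "continuous_on S d" for S unfolding d_def[abs_def] by (intro continuous_intros)
  have dpos: "d x > 0" if "x \<in> X" for x using that by (simp add: d_def X_def)
  have d0: "d x \<ge> 0" for x by (simp add: d_def)
  \<comment> \<open>The reciprocal distance to \<open>\<omega>\<close> is proper on
    \<open>X\<close>: after multiplication by \<open>d x\<close>, its sublevel sets are closed
    conditions in \<open>K\<close> that \<open>\<omega>\<close> violates. Adding 1 moves the zones
    to the middles of the former cells.\<close>
  define \<rho> where "\<rho> \<sigma> x = 1 / d x + (if \<sigma> then 1 else 0)" for \<sigma> x
  have \<rho>1: "continuous_on X (\<rho> \<sigma>)" for \<sigma>
    unfolding \<rho>_def[abs_def] using dpos by (intro continuous_intros contd) force
  have \<rho>2: "\<rho> \<sigma> x \<ge> 0" if "x \<in> X" for \<sigma> x using d0[of x] by (simp add: \<rho>_def)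
  have \<rho>3: "compact {x \<in> X. \<rho> \<sigma> x \<le> c}" for \<sigma> c
  proof -
    define c' where "c' = c - (if \<sigma> then 1 else 0)"
    have "{x \<in> X. \<rho> \<sigma> x \<le> c} = K \<inter> {x. 1 \<le> c' * d x}"
    proof (intro set_eqI iffI)
      fix x assume "x \<in> {x \<in> X. \<rho> \<sigma> x \<le> c}"
      then show "x \<in> K \<inter> {x. 1 \<le> c' * d x}"
        using dpos[of x] by (auto simp: X_def \<rho>_def c'_def field_simps)
    next
      fix x assume x: "x \<in> K \<inter> {x. 1 \<le> c' * d x}"
      then have "x \<in> X" by (auto simp: X_def d_def)
      then show "x \<in> {x \<in> X. \<rho> \<sigma> x \<le> c}"
        using dpos[of x] x by (auto simp: \<rho>_def c'_def field_simps)
    qed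
    moreover have "closed {x. 1 \<le> c' * d x}" by (intro closed_Collect_le continuous_intros contd)
    ultimately show ?thesis using K by (simp add: compact_Int_closed)
  qed
  define R where "R = 12 * m * b + 1"
  have R: "R > 0" "12 * m * b \<le> R" by (auto simp: R_def)
  let ?C = "\<lambda>p0 \<psi>. \<forall>k<R. \<forall>i. \<forall>p\<in>{1..m}. continuous_on (if p = p0 then X else K) (\<psi> k i p)"
  let ?G = "\<lambda>p0 \<sigma> \<psi>. \<forall>f::(nat \<Rightarrow> 'b) \<Rightarrow> real. continuous_on (slab m p0 X K) f \<and>
         (\<forall>x\<in>slab m p0 X K. cos (pi * \<rho> \<sigma> (x p0)) \<ge> 1/2 \<longrightarrow> f x = 0) \<longrightarrow>
       (\<exists>g. (\<forall>k<R. continuous_on UNIV (g k)) \<and> (\<forall>x\<in>slab m p0 X K.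
          f x = (\<Sum>k<R. g k (\<Sum>p=1..m. \<psi> k True p (x p)) - g k (\<Sum>p=1..m. \<psi> k False p (x p)))))"
  have "\<forall>s. \<exists>\<psi> :: nat \<Rightarrow> bool \<Rightarrow> nat \<Rightarrow> 'b \<Rightarrow> real. fst s \<in> {1..m} \<longrightarrow> ?C (fst s) \<psi> \<and> ?G (fst s) (snd s) \<psi>"
    using superposition_one_proper_coordinate[OF K _ col \<rho>1[unfolded X_def] \<rho>2[unfolded X_def] \<rho>3[unfolded X_def] R]
    unfolding X_def[symmetric] by blast
  from choice[OF this] obtain \<Psi> :: "nat \<times> bool \<Rightarrow> nat \<Rightarrow> bool \<Rightarrow> nat \<Rightarrow> 'b \<Rightarrow> real" where
    \<Psi>: "\<forall>s. fst s \<in> {1..m} \<longrightarrow> ?C (fst s) (\<Psi> s) \<and> ?G (fst s) (snd s) (\<Psi> s)" ..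
  \<comment> \<open>\<open>\<tau> p\<close> is the weight of the points whose coordinate \<open>p\<close> is the closest one to \<open>\<omega>\<close>, up to a bounded
     error in \<open>1 / d\<close>; it vanishes near the points with another coordinate equal to \<open>\<omega>\<close>.\<close>
  define \<tau> where "\<tau> p x = (\<Prod>p'\<in>{1..m} - {p}. max 0 (d (x p') / d (x p) - 1 + d (x p')))" for p and x :: "nat \<Rightarrow> 'b"
  define T where "T x = (\<Sum>p=1..m. \<tau> p x)" for x
  \<comment> \<open>\<open>w False\<close> and \<open>w True\<close> split a function into parts vanishing on the zones of \<open>\<rho> False\<close> and \<open>\<rho> True\<close>,
     which lie around the even and the odd values of \<open>1 / d\<close>.\<close>
  define w where "w \<sigma> x = (let s = max 0 (min 1 (1/2 - cos (pi * \<rho> False x))) in if \<sigma> then 1 - s else s)" for \<sigma> x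
  have contw: "continuous_on X (w \<sigma>)" for \<sigma>
    unfolding w_def[abs_def] Let_def using \<rho>1[of False] by (cases \<sigma>) (auto intro!: continuous_intros)
  have w0: "w \<sigma> x = 0" if "cos (pi * \<rho> \<sigma> x) \<ge> 1/2" for \<sigma> x
  proof (cases \<sigma>)
    case True
    have "pi * \<rho> \<sigma> x = pi * \<rho> False x + pi" using True by (simp add: \<rho>_def algebra_simps)
    then have "cos (pi * \<rho> \<sigma> x) = - cos (pi * \<rho> False x)" by simp
    then show ?thesis using that True by (simp add: w_def)
  qed (use that in \<open>simp add: w_def\<close>)
  have w1: "w False x + w True x = 1" for x by (simp add: w_def Let_def)
  have \<tau>0: "\<tau> p x \<ge> 0" for p x unfolding \<tau>_def by (intro prod_nonneg) simp
  have Tpos: "T x > 0" if x: "x \<in> PiE {1..m} (\<lambda>_. X)" for x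
  proof -
    have "Min ((\<lambda>p. d (x p)) ` {1..m}) \<in> (\<lambda>p. d (x p)) ` {1..m}" using m by (intro Min_in) auto
    then obtain p where p: "p \<in> {1..m}" "Min ((\<lambda>p. d (x p)) ` {1..m}) = d (x p)" by auto
    \<comment> \<open>For the coordinate closest to \<open>\<omega>\<close> all ratios are at least
      1, and the extra summand \<open>d (x p')\<close> makes the factors positive even at a
      tie.\<close>
    have "\<tau> p x > 0" unfolding \<tau>_def
    proof (rule prod_pos)
      fix p' assume p': "p' \<in> {1..m} - {p}"
      have "d (x p) \<le> d (x p')" using p' by (subst p(2)[symmetric]) (intro Min_le, auto)
      moreover have "d (x p) > 0" "d (x p') > 0" using p(1) p' PiE_mem[OF x] dpos by auto
      ultimately have "d (x p') / d (x p) \<ge> 1" by simp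
      then show "0 < max 0 (d (x p') / d (x p) - 1 + d (x p'))" using \<open>d (x p') > 0\<close> by simp
    qed
    also have "\<tau> p x \<le> T x" unfolding T_def using p(1) \<tau>0 by (intro member_le_sum) auto
    finally show ?thesis .
  qed
  have contdx: "continuous_on S (\<lambda>x. d (x p))" for S :: "(nat \<Rightarrow> 'b) set" and p
    by (rule continuous_on_coordinate[OF contd[of UNIV]]) simp
  have dslab: "d (x p) > 0" if "x \<in> slab m p X K" "p \<in> {1..m}" for x p
    using that dpos by (simp add: slab_iff)
  have cont\<tau>: "continuous_on (slab m p X K) (\<tau> p)" if p: "p \<in> {1..m}" for p
    unfolding \<tau>_def[abs_def] using dslab[OF _ p] by (intro continuous_intros contdx) force
  have sub: "PiE {1..m} (\<lambda>_. X) \<subseteq> slab m p X K" for p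
    unfolding slab_def by (intro PiE_mono) (auto simp: X_def)
  define F where "F f s x = (if x \<in> PiE {1..m} (\<lambda>_. X) then f x * (\<tau> (fst s) x / T x) * w (snd s) (x (fst s)) else 0)"
    for f :: "(nat \<Rightarrow> 'b) \<Rightarrow> real" and s :: "nat \<times> bool" and x
  have contF: "continuous_on (slab m (fst s) X K) (F f s)"
    if f: "continuous_on (PiE {1..m} (\<lambda>_. X)) f" and s: "fst s \<in> {1..m}" for f s
  proof -
    \<comment> \<open>Two relatively open sets that cover the slab. On \<open>A\<close> no
      coordinate is \<open>\<omega>\<close> and the product formula applies; on \<open>B\<close>
      some factor of \<open>\<tau>\<close> is cut off to 0. At a point outside \<open>A\<close>
      another coordinate is \<open>\<omega>\<close>, and the corresponding expression in
      \<open>B\<close> has the value -1.\<close>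
    define A where "A = slab m (fst s) X K \<inter> (\<lambda>x. \<Prod>p=1..m. d (x p)) -` {0<..}"
    define B where "B = (\<Union>p\<in>{1..m} - {fst s}. slab m (fst s) X K \<inter> (\<lambda>x. d (x p) / d (x (fst s)) - 1 + d (x p)) -` {..<0})"
    have AX: "A = PiE {1..m} (\<lambda>_. X)"
    proof
      show "A \<subseteq> PiE {1..m} (\<lambda>_. X)"
      proof
        fix x assume x: "x \<in> A"
        have "x p \<in> X" if "p \<in> {1..m}" for p
        proof -
          have "d (x p) \<noteq> 0"
          proof
            assume "d (x p) = 0"
            then have "(\<Prod>p=1..m. d (x p)) = 0" using that by (intro prod_zero) blast+
            then show False using x unfolding A_def by (simp only: Int_iff vimage_eq greaterThan_iff less_irrefl simp_thms)
          qed
          moreover have "x p \<in> K" using x s that by (cases "p = fst s") (auto simp: A_def slab_iff X_def)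
          ultimately show ?thesis by (auto simp: X_def d_def)
        qed
        then show "x \<in> PiE {1..m} (\<lambda>_. X)" using x s by (auto simp: A_def slab_iff PiE_iff)
      qed
      show "PiE {1..m} (\<lambda>_. X) \<subseteq> A"
      proof
        fix x assume x: "x \<in> PiE {1..m} (\<lambda>_. X)"
        have "(\<Prod>p=1..m. d (x p)) > 0" by (intro prod_pos dpos PiE_mem[OF x])
        then show "x \<in> A" using sub x unfolding A_def by blast
      qed
    qed
    have "openin (top_of_set (slab m (fst s) X K)) A"
      unfolding A_def by (intro continuous_openin_preimage_gen continuous_intros contdx)
    moreover have "openin (top_of_set (slab m (fst s) X K)) B"
      unfolding B_def
    proof (intro openin_Union ballI, elim imageE, hypsubst)
      fix p
      have "\<forall>x\<in>slab m (fst s) X K. d (x (fst s)) \<noteq> 0" using dslab[OF _ s] by force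
      then show "openin (top_of_set (slab m (fst s) X K)) (slab m (fst s) X K \<inter> (\<lambda>x. d (x p) / d (x (fst s)) - 1 + d (x p)) -` {..<0})"
        by (intro continuous_openin_preimage_gen continuous_intros contdx open_lessThan)
    qed
    moreover have AB: "slab m (fst s) X K = A \<union> B"
    proof (intro equalityI subsetI)
      fix x assume x: "x \<in> slab m (fst s) X K"
      show "x \<in> A \<union> B"
      proof (cases "x \<in> A")
        case False
        then obtain p where p: "p \<in> {1..m}" "x p \<notin> X" using x s unfolding AX by (auto simp: slab_iff PiE_iff)
        then have ps: "p \<noteq> fst s" using x s by (auto simp: slab_iff)
        then have "x p \<in> K" using x s p(1) by (auto simp: slab_iff)
        then have "d (x p) = 0" using p(2) by (simp add: X_def d_def)
        then have "x \<in> slab m (fst s) X K \<inter> (\<lambda>x. d (x p) / d (x (fst s)) - 1 + d (x p)) -` {..<0}" using x by simp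
        then show ?thesis using p ps unfolding B_def by blast
      qed simp
    qed (auto simp: A_def B_def)
    moreover have "continuous_on A (F f s)"
    proof -
      have c\<tau>: "continuous_on A (\<tau> p)" if "p \<in> {1..m}" for p
        using continuous_on_subset[OF cont\<tau>[OF that] sub] unfolding AX .
      have cT: "continuous_on A T" unfolding T_def[abs_def] by (intro continuous_on_sum c\<tau>)
      have T0: "\<forall>x\<in>A. T x \<noteq> 0" unfolding AX using Tpos by (metis less_irrefl)
      have cw: "continuous_on A (\<lambda>x. w (snd s) (x (fst s)))"
        by (rule continuous_on_coordinate[OF contw]) (use s in \<open>auto simp: AX\<close>)
      have "continuous_on A (\<lambda>x. f x * (\<tau> (fst s) x / T x) * w (snd s) (x (fst s)))"
        using f unfolding AX[symmetric]
        by (intro continuous_on_mult continuous_on_divide c\<tau>[OF s] cT T0 cw)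
      then show ?thesis by (rule continuous_on_eq) (simp add: F_def AX)
    qed
    moreover have "continuous_on B (F f s)"
    proof (rule continuous_on_eq[OF continuous_on_const[of _ 0]])
      fix x assume "x \<in> B"
      then obtain p where p: "p \<in> {1..m} - {fst s}" "d (x p) / d (x (fst s)) - 1 + d (x p) < 0"
        unfolding B_def by blast
      have "\<tau> (fst s) x = 0" unfolding \<tau>_def by (rule prod_zero[OF _ bexI[OF _ p(1)]]) (use p(2) in auto)
      then show "0 = F f s x" by (simp add: F_def)
    qed
    ultimately show ?thesis by (metis continuous_on_Un_local_open)
  qed
  have sumF: "f x = (\<Sum>s\<in>{1..m} \<times> UNIV. F f s x)" if x: "x \<in> PiE {1..m} (\<lambda>_. X)" for f x
  proof -
    have "(\<Sum>s\<in>{1..m} \<times> UNIV. F f s x) = (\<Sum>p=1..m. \<Sum>\<sigma>\<in>UNIV. F f (p, \<sigma>) x)"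
      by (simp add: sum.cartesian_product)
    also have "\<dots> = (\<Sum>p=1..m. f x * (\<tau> p x / T x))"
    proof (rule sum.cong[OF refl])
      fix p
      have "(\<Sum>\<sigma>\<in>UNIV. F f (p, \<sigma>) x) = f x * (\<tau> p x / T x) * (w False (x p) + w True (x p))"
        using x by (simp add: F_def UNIV_bool distrib_left)
      then show "(\<Sum>\<sigma>\<in>UNIV. F f (p, \<sigma>) x) = f x * (\<tau> p x / T x)" by (simp only: w1 mult_1_right)
    qed
    also have "\<dots> = f x * ((\<Sum>p=1..m. \<tau> p x) / T x)" by (simp add: sum_distrib_left sum_divide_distrib)
    also have "\<dots> = f x" using Tpos[OF x] by (simp add: T_def)
    finally show ?thesis ..
  qed
  define Q where "Q = (({1..m} \<times> UNIV) \<times> ({..<R} \<times> UNIV) :: ((nat \<times> bool) \<times> (nat \<times> bool)) set)"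
  show ?thesis
  proof (rule superposition_sum_indexed[of Q m X "\<lambda>q. \<Psi> (fst q) (fst (snd q)) (snd (snd q))"])
    show "finite Q" by (simp add: Q_def)
    show "Q \<noteq> {}" using m R by (auto simp: Q_def)
    show "continuous_on X (\<Psi> (fst q) (fst (snd q)) (snd (snd q)) p)" if "q \<in> Q" "p \<in> {1..m}" for q p
    proof -
      have q: "fst (fst q) \<in> {1..m}" "fst (snd q) < R" using that(1) unfolding Q_def by auto
      have "?C (fst (fst q)) (\<Psi> (fst q))" using \<Psi> q(1) by blast
      then have "continuous_on (if p = fst (fst q) then X else K) (\<Psi> (fst q) (fst (snd q)) (snd (snd q)) p)"
        using q(2) that(2) by blast
      then show ?thesis by (rule continuous_on_subset) (auto simp: X_def)
    qed
    fix f :: "(nat \<Rightarrow> 'b) \<Rightarrow> real" assume f: "continuous_on (PiE {1..m} (\<lambda>_. X)) f"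
    have "\<forall>s. \<exists>g. fst s \<in> {1..m} \<longrightarrow> (\<forall>k<R. continuous_on UNIV (g k)) \<and> (\<forall>x\<in>slab m (fst s) X K.
          F f s x = (\<Sum>k<R. g k (\<Sum>p=1..m. \<Psi> s k True p (x p)) - g k (\<Sum>p=1..m. \<Psi> s k False p (x p))))"
    proof (intro allI, subst ex_simps(6), intro impI)
      fix s :: "nat \<times> bool" assume s: "fst s \<in> {1..m}"
      have "?G (fst s) (snd s) (\<Psi> s)" using \<Psi> s by blast
      moreover have "\<forall>x\<in>slab m (fst s) X K. cos (pi * \<rho> (snd s) (x (fst s))) \<ge> 1/2 \<longrightarrow> F f s x = 0"
        using w0 by (simp add: F_def)
      ultimately show "\<exists>g. (\<forall>k<R. continuous_on UNIV (g k)) \<and> (\<forall>x\<in>slab m (fst s) X K.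
          F f s x = (\<Sum>k<R. g k (\<Sum>p=1..m. \<Psi> s k True p (x p)) - g k (\<Sum>p=1..m. \<Psi> s k False p (x p))))"
        using contF[OF f s] by blast
    qed
    from choice[OF this] obtain g where g: "\<forall>s. fst s \<in> {1..m} \<longrightarrow> (\<forall>k<R. continuous_on UNIV (g s k)) \<and> (\<forall>x\<in>slab m (fst s) X K.
          F f s x = (\<Sum>k<R. g s k (\<Sum>p=1..m. \<Psi> s k True p (x p)) - g s k (\<Sum>p=1..m. \<Psi> s k False p (x p))))" ..
    \<comment> \<open>The sign of a tag is absorbed into the outer function, so that the differences
      become one plain sum of superpositions.\<close>
    define G where "G q t = (if snd (snd q) then 1 else - 1) * g (fst q) (fst (snd q)) t" for q :: "(nat \<times> bool) \<times> (nat \<times> bool)" and t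
    show "\<exists>g. (\<forall>q\<in>Q. continuous_on UNIV (g q)) \<and> (\<forall>x\<in>PiE {1..m} (\<lambda>_. X).
      f x = (\<Sum>q\<in>Q. g q (\<Sum>p=1..m. \<Psi> (fst q) (fst (snd q)) (snd (snd q)) p (x p))))"
    proof (intro exI[of _ G] conjI ballI)
      fix q assume "q \<in> Q"
      then have "fst (fst q) \<in> {1..m}" "fst (snd q) < R" unfolding Q_def by auto
      then have "continuous_on UNIV (g (fst q) (fst (snd q)))" using g by blast
      then show "continuous_on UNIV (G q)" unfolding G_def[abs_def] by (rule continuous_on_mult_left)
    next
      fix x assume x: "x \<in> PiE {1..m} (\<lambda>_. X)"
      have "(\<Sum>q\<in>Q. G q (\<Sum>p=1..m. \<Psi> (fst q) (fst (snd q)) (snd (snd q)) p (x p))) =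
        (\<Sum>s\<in>{1..m} \<times> UNIV. \<Sum>k<R. \<Sum>i\<in>UNIV. G (s, k, i) (\<Sum>p=1..m. \<Psi> s k i p (x p)))"
        unfolding Q_def by (simp add: sum.cartesian_product case_prod_unfold)
      also have "\<dots> = (\<Sum>s\<in>{1..m} \<times> UNIV. F f s x)"
      proof (rule sum.cong[OF refl])
        fix s :: "nat \<times> bool" assume "s \<in> {1..m} \<times> UNIV"
        then have s: "fst s \<in> {1..m}" by auto
        then have "F f s x = (\<Sum>k<R. g s k (\<Sum>p=1..m. \<Psi> s k True p (x p)) - g s k (\<Sum>p=1..m. \<Psi> s k False p (x p)))"
          using g x sub by blast
        also have "\<dots> = (\<Sum>k<R. \<Sum>i\<in>UNIV. G (s, k, i) (\<Sum>p=1..m. \<Psi> s k i p (x p)))"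
          by (intro sum.cong) (auto simp: UNIV_bool G_def)
        finally show "(\<Sum>k<R. \<Sum>i\<in>UNIV. G (s, k, i) (\<Sum>p=1..m. \<Psi> s k i p (x p))) = F f s x" ..
      qed
      also have "\<dots> = f x" using sumF[OF x] by simp
      finally show "f x = (\<Sum>q\<in>Q. G q (\<Sum>p=1..m. \<Psi> (fst q) (fst (snd q)) (snd (snd q)) p (x p)))" ..
    qed
  qed
qed

subsection \<open>Covering dimension\<close>

lemma covering_dimension_leE:
  assumes "covering_dimension_le X n" "finite \<U>" "\<forall>U\<in>\<U>. openin X U" "\<Union>\<U> = topspace X"
  obtains \<V> where "finite \<V>" "\<forall>V\<in>\<V>. openin X V" "\<Union>\<V> = topspace X" "\<forall>V\<in>\<V>. \<exists>U\<in>\<U>. V \<subseteq> U"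
    "\<forall>x\<in>topspace X. card {V \<in> \<V>. x \<in> V} \<le> n + 1"
proof -
  have "\<exists>\<V>. finite \<V> \<and> (\<forall>V\<in>\<V>. openin X V) \<and> \<Union>\<V> = topspace X \<and>
     (\<forall>V\<in>\<V>. \<exists>U\<in>\<U>. V \<subseteq> U) \<and> (\<forall>x\<in>topspace X. card {V \<in> \<V>. x \<in> V} \<le> n + 1)"
    by (rule assms(1)[unfolded covering_dimension_le_def, THEN spec, THEN mp]) (intro conjI assms)
  then show ?thesis by (elim exE conjE) (rule that)
qed

lemma covering_dimension_le_homeomorphic:
  assumes "X homeomorphic_space Y" "covering_dimension_le X n"
  shows "covering_dimension_le Y n"
  unfolding covering_dimension_le_def
proof (intro allI impI, elim conjE)
  fix \<U> assume \<U>: "finite \<U>" "\<forall>U\<in>\<U>. openin Y U" "\<Union>\<U> = topspace Y"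
  obtain f g where fg: "continuous_map X Y f" "continuous_map Y X g"
    "\<And>x. x \<in> topspace X \<Longrightarrow> g (f x) = x" "\<And>y. y \<in> topspace Y \<Longrightarrow> f (g y) = y"
    using assms(1) unfolding homeomorphic_space_def homeomorphic_maps_def by blast
  have gX: "g y \<in> topspace X" if "y \<in> topspace Y" for y
    using fg(2) that by (meson continuous_map_image_subset_topspace image_subset_iff)
  have fY: "f x \<in> topspace Y" if "x \<in> topspace X" for x
    using fg(1) that by (meson continuous_map_image_subset_topspace image_subset_iff)
  define \<U>' where "\<U>' = (\<lambda>U. {x \<in> topspace X. f x \<in> U}) ` \<U>"
  have 1: "finite \<U>'" using \<U>(1) by (simp add: \<U>'_def)
  have 2: "\<forall>U\<in>\<U>'. openin X U"
    unfolding \<U>'_def using \<U>(2) openin_continuous_map_preimage[OF fg(1)] by blast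
  have 3: "\<Union>\<U>' = topspace X"
  proof (intro equalityI subsetI)
    fix x assume x: "x \<in> topspace X"
    then obtain U where "U \<in> \<U>" "f x \<in> U" using fY[OF x] \<U>(3) by blast
    then show "x \<in> \<Union>\<U>'" using x by (auto simp: \<U>'_def)
  qed (auto simp: \<U>'_def)
  obtain \<V> where \<V>: "finite \<V>" "\<forall>V\<in>\<V>. openin X V" "\<Union>\<V> = topspace X" "\<forall>V\<in>\<V>. \<exists>U\<in>\<U>'. V \<subseteq> U"
    "\<forall>x\<in>topspace X. card {V \<in> \<V>. x \<in> V} \<le> n + 1"
    using covering_dimension_leE[OF assms(2) 1 2 3] .
  define h where "h V = {y \<in> topspace Y. g y \<in> V}" for V
  show "\<exists>\<V>. finite \<V> \<and> (\<forall>V\<in>\<V>. openin Y V) \<and> \<Union>\<V> = topspace Y \<and> (\<forall>V\<in>\<V>. \<exists>U\<in>\<U>. V \<subseteq> U) \<and>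
     (\<forall>x\<in>topspace Y. card {V \<in> \<V>. x \<in> V} \<le> n + 1)"
  proof (intro exI[of _ "h ` \<V>"] conjI ballI)
    show "finite (h ` \<V>)" using \<V>(1) by simp
    show "openin Y V" if Vh: "V \<in> h ` \<V>" for V
    proof -
      obtain V0 where "V0 \<in> \<V>" "V = h V0" using Vh by blast
      then show ?thesis using \<V>(2) openin_continuous_map_preimage[OF fg(2), of V0] unfolding h_def by simp
    qed
    show "\<Union> (h ` \<V>) = topspace Y"
    proof (intro equalityI subsetI)
      fix y assume y: "y \<in> topspace Y"
      then obtain V where "V \<in> \<V>" "g y \<in> V" using gX[OF y] \<V>(3) by blast
      then show "y \<in> \<Union> (h ` \<V>)" using y by (auto simp: h_def)
    qed (auto simp: h_def)
    show "\<exists>U\<in>\<U>. V \<subseteq> U" if V: "V \<in> h ` \<V>" for V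
    proof -
      obtain V0 where V0: "V0 \<in> \<V>" "V = h V0" using V by blast
      then obtain U where U: "U \<in> \<U>" "V0 \<subseteq> {x \<in> topspace X. f x \<in> U}" using \<V>(4) unfolding \<U>'_def by blast
      have "V \<subseteq> U"
      proof
        fix y assume "y \<in> V"
        then have "y \<in> topspace Y" "f (g y) \<in> U" using V0 U by (auto simp: h_def)
        then show "y \<in> U" using fg(4) by simp
      qed
      then show ?thesis using U by blast
    qed
    show "card {V \<in> h ` \<V>. y \<in> V} \<le> n + 1" if y: "y \<in> topspace Y" for y
    proof -
      have "{V \<in> h ` \<V>. y \<in> V} \<subseteq> h ` {V \<in> \<V>. g y \<in> V}" by (auto simp: h_def)
      then have "card {V \<in> h ` \<V>. y \<in> V} \<le> card (h ` {V \<in> \<V>. g y \<in> V})"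
        using \<V>(1) by (intro card_mono) auto
      also have "\<dots> \<le> card {V \<in> \<V>. g y \<in> V}" using \<V>(1) by (intro card_image_le) auto
      also have "\<dots> \<le> n + 1" using \<V>(5) gX[OF y] by blast
      finally show ?thesis .
    qed
  qed
qed

text \<open>The dimension is known for \<open>K - {\<omega>}\<close> only. A cover of that open
  subset is completed by a single ball around \<open>\<omega>\<close>, which raises the order from
  \<open>n + 1\<close> to \<open>n + 2\<close>.\<close>

lemma ex_bounded_order_cover:
  fixes K :: "'b::metric_space set"
  assumes K: "compact K" and dim: "covering_dimension_le (top_of_set (K - {\<omega>})) n" and "\<epsilon> > 0"
  obtains \<W> where "finite \<W>" "\<And>V. V \<in> \<W> \<Longrightarrow> openin (top_of_set K) V" "K \<subseteq> \<Union>\<W>"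
    "\<And>V x y. V \<in> \<W> \<Longrightarrow> x \<in> V \<Longrightarrow> y \<in> V \<Longrightarrow> dist x y < \<epsilon>"
    "\<And>x. x \<in> K \<Longrightarrow> card {V \<in> \<W>. x \<in> V} \<le> n + 2"
proof -
  define X where "X = K - {\<omega>}"
  have half: "\<epsilon> / 2 > 0" using \<open>\<epsilon> > 0\<close> by simp
  obtain F where F: "finite F" "K \<subseteq> (\<Union>x\<in>F. ball x (\<epsilon>/2))"
    using compact_imp_seq_compact[OF K] seq_compact_imp_totally_bounded half by metis
  have near: "dist x y < \<epsilon>" if "x \<in> ball z (\<epsilon>/2)" "y \<in> ball z (\<epsilon>/2)" for x y z
    using dist_triangle_half_r[of z x \<epsilon> y] that by auto
  define \<U> where "\<U> = (\<lambda>x. X \<inter> ball x (\<epsilon>/2)) ` F"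
  have \<U>: "finite \<U>" "\<forall>U\<in>\<U>. openin (top_of_set X) U" "\<Union>\<U> = topspace (top_of_set X)"
    using F by (auto simp: \<U>_def X_def)
  obtain \<V> where \<V>: "finite \<V>" "\<forall>V\<in>\<V>. openin (top_of_set X) V" "\<Union>\<V> = X" "\<forall>V\<in>\<V>. \<exists>U\<in>\<U>. V \<subseteq> U"
    "\<forall>x\<in>X. card {V \<in> \<V>. x \<in> V} \<le> n + 1"
    using covering_dimension_leE[OF dim[folded X_def] \<U>] unfolding topspace_euclidean_subtopology .
  define W where "W = K \<inter> ball \<omega> (\<epsilon>/2)"
  have opX: "openin (top_of_set K) X"
    using openin_open_Int[of "- {\<omega>}" K] by (simp add: X_def Diff_eq open_Compl)
  show ?thesis
  proof (rule that[of "insert W \<V>"])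
    show "finite (insert W \<V>)" using \<V>(1) by simp
    show "openin (top_of_set K) V" if "V \<in> insert W \<V>" for V
      using that \<V>(2) opX by (auto simp: W_def openin_open_Int intro: openin_trans)
    show "K \<subseteq> \<Union> (insert W \<V>)" using \<V>(3) half by (auto simp: W_def X_def)
    show "dist x y < \<epsilon>" if V: "V \<in> insert W \<V>" "x \<in> V" "y \<in> V" for V x y
    proof -
      have "\<exists>z. V \<subseteq> ball z (\<epsilon>/2)" using V(1) \<V>(4) by (fastforce simp: W_def \<U>_def)
      then show ?thesis using near V by blast
    qed
    show "card {V \<in> insert W \<V>. x \<in> V} \<le> n + 2" if x: "x \<in> K" for x
    proof -
      have "card {V \<in> \<V>. x \<in> V} \<le> n + 1"
      proof (cases "x \<in> X")
        case False
        then have "{V \<in> \<V>. x \<in> V} = {}" using \<V>(3) by blast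
        then show ?thesis by (simp only: card.empty)
      qed (use \<V>(5) in blast)
      moreover have "{V \<in> insert W \<V>. x \<in> V} \<subseteq> insert W {V \<in> \<V>. x \<in> V}" by blast
      then have "card {V \<in> insert W \<V>. x \<in> V} \<le> card (insert W {V \<in> \<V>. x \<in> V})"
        using \<V>(1) by (intro card_mono) auto
      moreover have "card (insert W {V \<in> \<V>. x \<in> V}) \<le> Suc (card {V \<in> \<V>. x \<in> V})"
        using \<V>(1) by (simp add: card_insert_if)
      ultimately show ?thesis by linarith
    qed
  qed
qed

text \<open>Each color that misses a point is charged to a member of the cover containing the point,
  and different colors to different members. So the order of the cover bounds the number of missed
  colors, however many colors there are.\<close>

proposition colorable_of_covering_dimension:
  fixes K :: "'b::metric_space set"
  assumes K: "compact K" and dim: "covering_dimension_le (top_of_set (K - {\<omega>})) n"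
  shows "colorable K (n + 2)"
  unfolding colorable_def
proof (intro allI impI)
  fix R and \<epsilon> :: real assume "\<epsilon> > 0"
  obtain \<W> where \<W>: "finite \<W>" "\<And>V. V \<in> \<W> \<Longrightarrow> openin (top_of_set K) V" "K \<subseteq> \<Union>\<W>"
    "\<And>V x y. V \<in> \<W> \<Longrightarrow> x \<in> V \<Longrightarrow> y \<in> V \<Longrightarrow> dist x y < \<epsilon>"
    "\<And>x. x \<in> K \<Longrightarrow> card {V \<in> \<W>. x \<in> V} \<le> n + 2"
  proof (rule ex_bounded_order_cover[OF K dim \<open>\<epsilon> > 0\<close>], goal_cases)
    case (1 \<W>)
    from 1(1)[OF 1(2-6)] show ?case .
  qed
  \<comment> \<open>The distance to an empty set is 0 by convention.\<close>
  define q where "q V x = (if K - V = {} then 1 else infdist x (K - V))" for V x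
  have contq: "continuous_on S (q V)" for S V
    unfolding q_def[abs_def] by (cases "K - V = {}") (auto intro!: continuous_intros)
  have q0: "q V x \<ge> 0" for V x by (simp add: q_def infdist_nonneg)
  have qpos: "q V x > 0 \<longleftrightarrow> x \<in> V" if "V \<in> \<W>" "x \<in> K" for V x
  proof (cases "K - V = {}")
    case False
    have "closedin (top_of_set K) (K - V)" using \<W>(2)[OF that(1)] by (simp add: closedin_diff)
    then have "closed (K - V)" using K by (meson closedin_closed_trans compact_imp_closed)
    then have "x \<in> K - V \<longleftrightarrow> infdist x (K - V) = 0" using False by (rule in_closed_iff_infdist_zero)
    then show ?thesis using that(2) False q0[of V x] by (auto simp: q_def)
  qed (use that in \<open>auto simp: q_def\<close>)
  \<comment> \<open>A substitute for a Lebesgue number: the sum of all \<open>q V\<close> has a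
    positive minimum on \<open>K\<close>, and at every point some summand is at least the
    average.\<close>
  obtain l where l: "l > 0" "\<And>x. x \<in> K \<Longrightarrow> \<exists>V\<in>\<W>. q V x \<ge> l"
  proof (cases "K = {}")
    case True
    then show ?thesis using that[of 1] by simp
  next
    case False
    have "continuous_on K (\<lambda>x. \<Sum>V\<in>\<W>. q V x)" by (intro continuous_on_sum contq)
    then obtain z where z: "z \<in> K" "\<And>x. x \<in> K \<Longrightarrow> (\<Sum>V\<in>\<W>. q V z) \<le> (\<Sum>V\<in>\<W>. q V x)"
      using continuous_attains_inf[OF K False] by blast
    obtain V0 where V0: "V0 \<in> \<W>" "z \<in> V0" using z(1) \<W>(3) by blast
    have "0 < q V0 z" using qpos V0 z by blast
    also have "\<dots> \<le> (\<Sum>V\<in>\<W>. q V z)" using V0(1) \<W>(1) q0 by (intro member_le_sum) auto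
    finally have pos: "0 < (\<Sum>V\<in>\<W>. q V z)" .
    have cW: "card \<W> > 0" using \<W>(1) V0 card_gt_0_iff by blast
    show ?thesis
    proof (rule that[of "(\<Sum>V\<in>\<W>. q V z) / card \<W>"])
      show "0 < (\<Sum>V\<in>\<W>. q V z) / card \<W>" using pos cW by simp
      fix x assume x: "x \<in> K"
      show "\<exists>V\<in>\<W>. (\<Sum>V\<in>\<W>. q V z) / card \<W> \<le> q V x"
      proof (rule ccontr)
        assume "\<not> ?thesis"
        then have "(\<Sum>V\<in>\<W>. q V x) < (\<Sum>V\<in>\<W>. (\<Sum>V\<in>\<W>. q V z) / card \<W>)"
          using \<W>(1) V0 by (intro sum_strict_mono) (auto simp: not_le)
        also have "\<dots> = (\<Sum>V\<in>\<W>. q V z)" using cW by simp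
        finally show False using z(2)[OF x] by simp
      qed
    qed
  qed
  \<comment> \<open>The pieces of color \<open>c\<close> are indexed by the set of those \<open>V\<close> with \<open>q V x\<close> above the threshold \<open>t c\<close>;
     a point is missed only if some \<open>q V x\<close> is within \<open>g\<close> of \<open>t c\<close>, and a given \<open>V\<close> spoils at most one color.\<close>
  define g where "g = l / (2 * real R + 1)"
  have g: "g > 0" "l = (2 * real R + 1) * g" using l(1) by (auto simp: g_def)
  \<comment> \<open>The thresholds are \<open>2 * g\<close> apart, so the open intervals of radius
    \<open>g\<close> around them are disjoint; those of the colors \<open>c < R\<close> lie between
    0 and \<open>l\<close>.\<close>
  define t where "t c = (2 * real c + 1) * g" for c :: nat
  have t1: "t c - g \<ge> 0" for c using g(1) by (simp add: t_def algebra_simps)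
  have t2: "t c + g \<le> l" if "c < R" for c
  proof -
    have "(2 * real c + 2) * g \<le> (2 * real R + 1) * g" using that g(1) by (intro mult_right_mono) auto
    then show ?thesis by (simp add: t_def g(2) algebra_simps)
  qed
  have t3: "c = c'" if "\<bar>s - t c\<bar> < g" "\<bar>s - t c'\<bar> < g" for s c c'
  proof -
    have "\<bar>t c - t c'\<bar> < 2 * g" using that by linarith
    then have "\<bar>real c - real c'\<bar> * (2 * g) < 1 * (2 * g)"
      using g(1) by (simp add: t_def left_diff_distrib[symmetric] abs_mult)
    then have "\<bar>real c - real c'\<bar> < 1" using g(1) by (simp only: mult_less_cancel_right_pos)
    then show ?thesis by linarith
  qed
  define A where "A c J = {x \<in> K. (\<forall>V\<in>J. q V x \<ge> t c + g) \<and> (\<forall>V\<in>\<W> - J. q V x \<le> t c - g)}" for c J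
  \<comment> \<open>A nonempty \<open>J\<close> puts the piece inside a member of the cover and
    makes it small. For a point not missed, \<open>J\<close> is nonempty because some
    \<open>q V x\<close> is at least \<open>l\<close>, above every threshold.\<close>
  define \<A> where "\<A> c = A c ` {J. J \<subseteq> \<W> \<and> J \<noteq> {}}" for c
  have "colored_families K (n + 2) R \<epsilon> \<A>" unfolding colored_families_def
  proof (intro conjI allI impI ballI)
    fix c
    show "finite (\<A> c)" using \<W>(1) by (simp add: \<A>_def)
    show "disjoint (\<A> c)"
    proof (rule disjointI)
      fix S S' assume S: "S \<in> \<A> c" "S' \<in> \<A> c" "S \<noteq> S'"
      obtain J J' where J: "J \<subseteq> \<W>" "J' \<subseteq> \<W>" "S = A c J" "S' = A c J'" using S by (auto simp: \<A>_def)
      have "J = J'" if "x \<in> S" "x \<in> S'" for x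
      proof (intro equalityI subsetI)
        fix V assume "V \<in> J"
        then have "q V x \<ge> t c + g" "V \<in> \<W>" using that J by (auto simp: A_def)
        then show "V \<in> J'" using that(2) J(4) g(1) unfolding A_def by force
      next
        fix V assume "V \<in> J'"
        then have "q V x \<ge> t c + g" "V \<in> \<W>" using that J by (auto simp: A_def)
        then show "V \<in> J" using that(1) J(3) g(1) unfolding A_def by force
      qed
      then show "S \<inter> S' = {}" using S(3) J by blast
    qed
    fix S assume "S \<in> \<A> c"
    then obtain J where J: "J \<subseteq> \<W>" "J \<noteq> {}" "S = A c J" by (auto simp: \<A>_def)
    show "S \<subseteq> K" using J by (auto simp: A_def)
    have "S = K \<inter> ((\<Inter>V\<in>J. {x. t c + g \<le> q V x}) \<inter> (\<Inter>V\<in>\<W> - J. {x. q V x \<le> t c - g}))"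
      using J by (auto simp: A_def)
    moreover have "closed ((\<Inter>V\<in>J. {x. t c + g \<le> q V x}) \<inter> (\<Inter>V\<in>\<W> - J. {x. q V x \<le> t c - g}))"
      by (intro closed_Int closed_INT ballI closed_Collect_le continuous_intros contq)
    ultimately show "compact S" using K compact_Int_closed by metis
    obtain V where V: "V \<in> J" using J(2) by blast
    fix x y assume xy: "x \<in> S" "y \<in> S"
    have "z \<in> V" if "z \<in> S" for z
    proof -
      have "q V z \<ge> t c + g" "z \<in> K" using that V J(3) by (auto simp: A_def)
      then have "q V z > 0" using t1[of c] g(1) by linarith
      then show ?thesis using qpos V J(1) \<open>z \<in> K\<close> by blast
    qed
    then show "dist x y < \<epsilon>" using \<W>(4)[of V x y] xy V J(1) by blast
  next
    fix x assume x: "x \<in> K"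
    let ?B = "{c. c < R \<and> x \<notin> \<Union> (\<A> c)}"
    have near: "\<exists>V. V \<in> \<W> \<and> \<bar>q V x - t c\<bar> < g" if c: "c \<in> ?B" for c
    proof (rule ccontr)
      assume no: "\<not> ?thesis"
      define J where "J = {V \<in> \<W>. q V x \<ge> t c + g}"
      obtain V where V: "V \<in> \<W>" "q V x \<ge> l" using l(2)[OF x] by blast
      have "V \<in> J" using V t2[of c] c by (auto simp: J_def)
      then have J: "J \<subseteq> \<W>" "J \<noteq> {}" by (auto simp: J_def)
      have "x \<in> A c J" using x no by (fastforce simp: A_def J_def)
      then have "x \<in> \<Union> (\<A> c)" using J by (auto simp: \<A>_def)
      then show False using c by blast
    qed
    have "\<forall>c\<in>?B. \<exists>V. V \<in> \<W> \<and> \<bar>q V x - t c\<bar> < g" by (intro ballI near)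
    from bchoice[OF this] obtain v where v: "\<forall>c\<in>?B. v c \<in> \<W> \<and> \<bar>q (v c) x - t c\<bar> < g" ..
    have "card ?B \<le> card {V \<in> \<W>. x \<in> V}"
    proof (rule card_inj_on_le[of v])
      show "inj_on v ?B"
      proof (rule inj_onI)
        fix c c' assume c: "c \<in> ?B" "c' \<in> ?B" "v c = v c'"
        have "\<bar>q (v c) x - t c\<bar> < g" "\<bar>q (v c) x - t c'\<bar> < g"
          using bspec[OF v c(1)] bspec[OF v c(2)] c(3) by simp_all
        then show "c = c'" by (rule t3)
      qed
      show "v ` ?B \<subseteq> {V \<in> \<W>. x \<in> V}"
      proof
        fix V assume "V \<in> v ` ?B"
        then obtain c where "c \<in> ?B" "V = v c" by (elim imageE)
        then have c: "V \<in> \<W>" "\<bar>q V x - t c\<bar> < g" using bspec[OF v] by simp_all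
        then have "q V x > 0" using t1[of c] by linarith
        then show "V \<in> {V \<in> \<W>. x \<in> V}" using qpos[OF c(1) x] c(1) by blast
      qed
    qed (use \<W>(1) in simp)
    also have "\<dots> \<le> n + 2" using \<W>(5)[OF x] .
    finally show "card ?B \<le> n + 2" .
  qed
  then show "\<exists>\<A>. colored_families K (n + 2) R \<epsilon> \<A>" by (intro exI[of _ \<A>])
qed

subsection \<open>Embedding into the space of real sequences\<close>

text \<open>The criterion behind two embeddings: by distances to a dense sequence, and by the
  members of a basic family. The set \<open>W\<close> cuts out of the image a neighborhood of
  \<open>f x\<close> that consists of images of points of \<open>U\<close>.\<close>

lemma homeomorphic_space_image_of_separating:
  fixes f :: "'a \<Rightarrow> 'b::topological_space"
  assumes cont: "continuous_map X euclidean f" and inj: "inj_on f (topspace X)"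
    and sep: "\<And>U x. openin X U \<Longrightarrow> x \<in> U \<Longrightarrow> \<exists>W. open W \<and> f x \<in> W \<and> (\<forall>z\<in>topspace X. f z \<in> W \<longrightarrow> z \<in> U)"
  shows "X homeomorphic_space top_of_set (f ` topspace X)"
proof -
  have "homeomorphic_map X (top_of_set (f ` topspace X)) f"
  proof (rule bijective_open_imp_homeomorphic_map)
    show "continuous_map X (top_of_set (f ` topspace X)) f"
      using cont by (simp add: continuous_map_in_subtopology)
    show "open_map X (top_of_set (f ` topspace X)) f"
      unfolding open_map_def
    proof (intro allI impI)
      fix U assume U: "openin X U"
      show "openin (top_of_set (f ` topspace X)) (f ` U)"
        unfolding openin_subopen[of _ "f ` U"]
      proof
        fix y assume "y \<in> f ` U"
        then obtain x where x: "x \<in> U" "y = f x" by blast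
        obtain W where W: "open W" "f x \<in> W" "\<forall>z\<in>topspace X. f z \<in> W \<longrightarrow> z \<in> U" using sep[OF U x(1)] by blast
        have "x \<in> topspace X" using U x(1) openin_subset by blast
        then have "openin (top_of_set (f ` topspace X)) (f ` topspace X \<inter> W) \<and> y \<in> f ` topspace X \<inter> W \<and> f ` topspace X \<inter> W \<subseteq> f ` U"
          using W x(2) by (auto intro: openin_open_Int)
        then show "\<exists>T. openin (top_of_set (f ` topspace X)) T \<and> y \<in> T \<and> T \<subseteq> f ` U" by blast
      qed
    qed
  qed (use inj in auto)
  then show ?thesis by (rule homeomorphic_map_imp_homeomorphic_space)
qed

lemma continuous_map_into_fun:
  fixes f :: "'a \<Rightarrow> 'i \<Rightarrow> 'b::topological_space"
  assumes "\<And>i. continuous_map X euclidean (\<lambda>x. f x i)"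
  shows "continuous_map X euclidean f"
  using assms by (simp add: euclidean_product_topology[symmetric] continuous_map_componentwise_UNIV)

lemma embedding_in_real_sequences:
  assumes "separable_space X" "metrizable_space X"
  obtains Y :: "(nat \<Rightarrow> real) set" where "X homeomorphic_space top_of_set Y" "Y \<subseteq> UNIV \<rightarrow>\<^sub>E {0..1}"
proof (cases "topspace X = {}")
  case True
  show ?thesis
  proof (rule that[of "{}"])
    show "X homeomorphic_space top_of_set ({} :: (nat \<Rightarrow> real) set)"
      using True by (simp add: homeomorphic_empty_space_eq)
  qed simp
next
  case False
  obtain M d where M: "Metric_space M d" "X = Metric_space.mtopology M d"
    using assms(2) unfolding metrizable_space_def by blast
  interpret Metric_space M d by fact
  have top: "topspace X = M" using M(2) by simp
  obtain C where C: "countable C" "C \<subseteq> M" "mtopology closure_of C = M"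
    using assms(1) unfolding separable_space_def top M(2) by auto
  have "C \<noteq> {}" using C(3) False top by auto
  define c where "c = from_nat_into C"
  have cC: "c n \<in> M" for n using from_nat_into[OF \<open>C \<noteq> {}\<close>] C(2) by (auto simp: c_def)
  have dense: "\<exists>n. d x (c n) < r" if x: "x \<in> M" and r: "r > 0" for x r
  proof -
    have "x \<in> mtopology closure_of C" using x C(3) by simp
    then obtain y where y: "y \<in> C" "y \<in> mball x r" using r unfolding metric_closure_of by blast
    obtain n where "c n = y" using from_nat_into_surj[OF C(1) y(1)] unfolding c_def by blast
    then show ?thesis using y(2) by (intro exI[of _ n]) simp
  qed
  define e where "e x n = min 1 (d x (c n))" for x n
  have "continuous_map X euclideanreal (\<lambda>x. e x n)" for n
  proof -
    have "continuous_map mtopology Met_TC.mtopology (\<lambda>x. d x (c n))"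
      unfolding metric_continuous_map[OF Met_TC.Metric_space_axioms]
    proof (intro conjI ballI allI impI)
      fix a and \<epsilon> :: real assume a: "a \<in> M" "\<epsilon> > 0"
      have "dist (d a (c n)) (d x (c n)) \<le> d a x" if "x \<in> M" for x
        using triangle[OF a(1) that cC[of n]] triangle[OF that a(1) cC[of n]] commute[of a x]
        by (simp add: dist_real_def abs_le_iff)
      then show "\<exists>\<delta>>0. \<forall>x. x \<in> M \<and> d a x < \<delta> \<longrightarrow> dist (d a (c n)) (d x (c n)) < \<epsilon>"
        using a(2) by (intro exI[of _ \<epsilon>]) force
    qed simp
    then have "continuous_map X euclideanreal (\<lambda>x. d x (c n))" by (simp add: M(2))
    then show ?thesis unfolding e_def by (intro continuous_map_real_min continuous_map_const[THEN iffD2]) auto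
  qed
  then have ce: "continuous_map X euclidean e" by (rule continuous_map_into_fun)
  \<comment> \<open>One coordinate decides: if \<open>c n\<close> is within \<open>r / 3\<close> of
    \<open>x\<close> and \<open>z\<close> has a similar \<open>n\<close>-th coordinate, then
    \<open>z\<close> is within \<open>2 * r / 3\<close> of \<open>c n\<close>. Because of
    \<open>r \<le> 1\<close> the truncation at 1 has no effect on these values.\<close>
  have small: "d x z < r" if "x \<in> M" "z \<in> M" "d x (c n) < r / 3" "\<bar>e z n - e x n\<bar> < r / 3" "r \<le> 1" for x z n r
  proof -
    have "e x n = d x (c n)" using that(3,5) by (simp add: e_def)
    then have "e z n < 2 * r / 3" using that(3,4) by linarith
    then have "min 1 (d z (c n)) < 2 * r / 3" by (simp add: e_def)
    then have "d z (c n) < 2 * r / 3" using that(5) by (auto simp: min_def split: if_splits)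
    then show ?thesis using triangle[OF that(1) cC[of n] that(2)] that(3) commute[of z "c n"] by simp
  qed
  have "X homeomorphic_space top_of_set (e ` topspace X)"
  proof (rule homeomorphic_space_image_of_separating[OF ce])
    show "inj_on e (topspace X)"
    proof (rule inj_onI, rule ccontr)
      fix x z assume xz: "x \<in> topspace X" "z \<in> topspace X" "e x = e z" "x \<noteq> z"
      define r where "r = min 1 (d x z)"
      have r: "r > 0" "r \<le> 1" "r \<le> d x z" using xz top by (auto simp: r_def)
      then obtain n where n: "d x (c n) < r / 3" using dense[of x "r/3"] xz top by auto
      then have "d x z < r" using small[of x z n r] xz r top by simp
      then show False using r by simp
    qed
    fix U x assume U: "openin X U" "x \<in> U"
    then have "U \<subseteq> M" "\<exists>r>0. mball x r \<subseteq> U" unfolding M(2) openin_mtopology by blast+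
    then obtain r0 where r0: "r0 > 0" "mball x r0 \<subseteq> U" "x \<in> M" using U(2) by blast
    define r where "r = min 1 r0"
    have r: "r > 0" "r \<le> 1" "r \<le> r0" using r0 by (auto simp: r_def)
    obtain n where n: "d x (c n) < r / 3" using dense[of x "r/3"] r0 r by auto
    show "\<exists>W. open W \<and> e x \<in> W \<and> (\<forall>z\<in>topspace X. e z \<in> W \<longrightarrow> z \<in> U)"
    proof (intro exI[of _ "{y. \<bar>y n - e x n\<bar> < r / 3}"] conjI ballI impI)
      show "open {y::nat \<Rightarrow> real. \<bar>y n - e x n\<bar> < r / 3}"
        by (intro open_Collect_less continuous_intros continuous_on_product_coordinates)
      show "e x \<in> {y. \<bar>y n - e x n\<bar> < r / 3}" using r by simp
      fix z assume z: "z \<in> topspace X" "e z \<in> {y. \<bar>y n - e x n\<bar> < r / 3}"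
      then have "d x z < r" using small[OF r0(3) _ n _ r(2)] top by simp
      then have "z \<in> mball x r0" using r(3) r0(3) z(1) top by simp
      then show "z \<in> U" using r0(2) by blast
    qed
  qed
  moreover have "e ` topspace X \<subseteq> UNIV \<rightarrow>\<^sub>E {0..1}"
    using cC top by (auto simp: e_def)
  ultimately show ?thesis by (rule that)
qed

text \<open>Local compactness makes the embedded space open in its compact closure, so the remainder
  is closed and can be shrunk to a point by means of the distance to it. If \<open>X\<close> is
  compact, the remainder is empty and \<open>\<omega>\<close> lies outside \<open>K\<close>, so both
  cases are covered.\<close>

proposition one_point_compactification_in_real_sequences:
  assumes "locally_compact_space X" "separable_space X" "metrizable_space X"
  obtains K :: "(nat \<Rightarrow> real) set" and \<omega> where "compact K" "X homeomorphic_space top_of_set (K - {\<omega>})"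
proof -
  obtain Y :: "(nat \<Rightarrow> real) set" where Y: "X homeomorphic_space top_of_set Y" "Y \<subseteq> UNIV \<rightarrow>\<^sub>E {0..1}"
    using embedding_in_real_sequences[OF assms(2,3)] .
  have "locally_compact_space (top_of_set Y)"
    using homeomorphic_locally_compact_space[OF Y(1)] assms(1) by simp
  then have "openin (top_of_set (closure Y)) Y"
    using locally_compact_subspace_openin_closure_of[of euclidean Y] by (simp add: euclidean_closure_of)
  then have "closedin (top_of_set (closure Y)) (closure Y - Y)" by (simp add: closedin_diff)
  then have clL: "closed (closure Y - Y)" by (meson closedin_closed_trans closed_closure)
  have compC: "compact (UNIV \<rightarrow>\<^sub>E {0..1::real} :: (nat \<Rightarrow> real) set)" by (rule compact_PiE_fun) simp
  then have "closure Y \<subseteq> UNIV \<rightarrow>\<^sub>E {0..1}" using Y(2) by (intro closure_minimal compact_imp_closed)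
  then have compY: "compact (closure Y)"
    using compact_Int_closed[OF compC closed_closure[of Y]] by (simp add: Int_absorb1)
  \<comment> \<open>\<open>infdist\<close> to the empty set is 0; the value 1 keeps
    \<open>\<delta>\<close> nonzero on \<open>Y\<close> when there is no remainder.\<close>
  define \<delta> where "\<delta> y = (if closure Y - Y = {} then 1 else infdist y (closure Y - Y))" for y
  have cont\<delta>: "continuous_on UNIV \<delta>"
    unfolding \<delta>_def[abs_def] by (cases "closure Y - Y = {}") (auto intro!: continuous_intros)
  have \<delta>0: "\<delta> y = 0" if "y \<in> closure Y - Y" for y using that by (auto simp: \<delta>_def)
  have \<delta>pos: "\<delta> y \<noteq> 0" if "y \<in> Y" for y
  proof (cases "closure Y - Y = {}")
    case False
    then show ?thesis using in_closed_iff_infdist_zero[OF clL False, of y] that by (simp add: \<delta>_def)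
  qed (simp add: \<delta>_def)
  \<comment> \<open>\<open>h\<close> collapses the remainder \<open>closure Y - Y\<close> to the point 0 and is injective on \<open>Y\<close>.\<close>
  define h where "h y n = (case n of 0 \<Rightarrow> \<delta> y | Suc n \<Rightarrow> \<delta> y * y n)" for y :: "nat \<Rightarrow> real" and n
  have conth: "continuous_on UNIV h"
  proof (rule continuous_on_coordinatewise_then_product)
    fix n show "continuous_on UNIV (\<lambda>y. h y n)"
      unfolding h_def by (cases n) (auto intro!: continuous_intros cont\<delta> continuous_on_product_coordinates)
  qed
  \<comment> \<open>The coordinate 0 of \<open>h y\<close> records the factor
    \<open>\<delta> y\<close>, so division by it recovers \<open>y\<close>.\<close>
  define g where "g z n = z (Suc n) / z 0" for z :: "nat \<Rightarrow> real" and n :: nat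
  have gh: "g (h y) = y" if "y \<in> Y" for y using \<delta>pos[OF that] by (auto simp: g_def h_def)
  have contg: "continuous_on (h ` Y) g"
  proof (rule continuous_on_coordinatewise_then_product)
    fix n
    have "\<forall>z\<in>h ` Y. z 0 \<noteq> 0" using \<delta>pos by (auto simp: h_def)
    then show "continuous_on (h ` Y) (\<lambda>z. g z n)" unfolding g_def
      by (intro continuous_on_divide continuous_on_subset[OF continuous_on_product_coordinates]) auto
  qed
  have homeo: "top_of_set Y homeomorphic_space top_of_set (h ` Y)"
    unfolding homeomorphic_space_def homeomorphic_maps_def
  proof (rule exI[of _ h], rule exI[of _ g], intro conjI ballI)
    show "continuous_map (top_of_set Y) (top_of_set (h ` Y)) h"
      using continuous_on_subset[OF conth] by (auto simp: continuous_map_in_subtopology)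
    show "continuous_map (top_of_set (h ` Y)) (top_of_set Y) g"
      using contg gh by (auto simp: continuous_map_in_subtopology)
  qed (use gh in auto)
  show ?thesis
  proof (rule that[of "h ` closure Y" "\<lambda>_. 0"])
    show "compact (h ` closure Y)"
      using continuous_on_subset[OF conth] compY by (intro compact_continuous_image) auto
    have h0: "h y = (\<lambda>_. 0)" if "y \<in> closure Y - Y" for y
      using \<delta>0[OF that] by (auto simp: h_def fun_eq_iff split: nat.split)
    have hY: "h y \<noteq> (\<lambda>_. 0)" if "y \<in> Y" for y
    proof
      assume "h y = (\<lambda>_. 0)"
      then have "h y 0 = 0" by simp
      then show False using \<delta>pos[OF that] by (simp add: h_def)
    qed
    have "h ` closure Y - {\<lambda>_. 0} = h ` Y"
    proof (intro equalityI subsetI)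
      fix z assume "z \<in> h ` closure Y - {\<lambda>_. 0}"
      then obtain y where y: "y \<in> closure Y" "z = h y" "z \<noteq> (\<lambda>_. 0)" by (elim DiffE imageE) simp
      then show "z \<in> h ` Y" using h0[of y] by (cases "y \<in> Y") simp_all
    next
      fix z assume "z \<in> h ` Y"
      then obtain y where y: "y \<in> Y" "z = h y" by (elim imageE)
      have "y \<in> closure Y" using y(1) closure_subset by (rule rev_subsetD)
      then show "z \<in> h ` closure Y - {\<lambda>_. 0}" using hY[OF y(1)] y(2) by simp
    qed
    then show "X homeomorphic_space top_of_set (h ` closure Y - {\<lambda>_. 0})"
      using homeomorphic_space_trans[OF Y(1) homeo] by simp
  qed
qed

subsection \<open>Finite basic families\<close>

text \<open>A function on \<open>X\<close> is pulled back to \<open>Y\<close> along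
  \<open>r\<close>, and its representation returns along \<open>s\<close>. Used for the diagonal of
  a power and for identifying \<open>X\<close> with its power over a single index.\<close>

lemma has_finite_basic_family_retract:
  assumes "continuous_map X Y s" "continuous_map Y X r" "\<And>x. x \<in> topspace X \<Longrightarrow> r (s x) = x"
    and "has_finite_basic_family Y"
  shows "has_finite_basic_family X"
proof -
  obtain \<Phi> where \<Phi>: "finite \<Phi>" "basic_family Y \<Phi>" using assms(4) unfolding has_finite_basic_family_def by blast
  have sY: "s x \<in> topspace Y" if "x \<in> topspace X" for x
    using assms(1) that by (meson continuous_map_image_subset_topspace image_subset_iff)
  have "basic_family X ((\<lambda>\<phi>. \<phi> \<circ> s) ` \<Phi>)" unfolding basic_family_def
  proof (intro conjI ballI allI impI)
    fix \<phi> assume "\<phi> \<in> (\<lambda>\<phi>. \<phi> \<circ> s) ` \<Phi>"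
    then obtain \<phi>' where \<phi>': "\<phi>' \<in> \<Phi>" "\<phi> = \<phi>' \<circ> s" by (elim imageE)
    then have "continuous_map Y euclideanreal \<phi>'" using \<Phi>(2) unfolding basic_family_def by blast
    then show "continuous_map X euclideanreal \<phi>" unfolding \<phi>'(2) using assms(1) by (rule continuous_map_compose[rotated])
  next
    fix f assume f: "continuous_map X euclideanreal f"
    have "continuous_map Y euclideanreal (f \<circ> r)" using assms(2) f by (rule continuous_map_compose)
    then have "\<exists>(n::nat) \<phi> g. (\<forall>q\<in>{1..n}. \<phi> q \<in> \<Phi> \<and> continuous_map euclideanreal euclideanreal (g q)) \<and>
           (\<forall>y\<in>topspace Y. (f \<circ> r) y = (\<Sum>q=1..n. g q (\<phi> q y)))"
      using \<Phi>(2) unfolding basic_family_def by blast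
    then obtain n :: nat and \<phi> g where g: "\<forall>q\<in>{1..n}. \<phi> q \<in> \<Phi> \<and> continuous_map euclideanreal euclideanreal (g q)"
      "\<forall>y\<in>topspace Y. (f \<circ> r) y = (\<Sum>q=1..n. g q (\<phi> q y))" by (elim exE conjE)
    show "\<exists>(n::nat) \<phi> g. (\<forall>q\<in>{1..n}. \<phi> q \<in> (\<lambda>\<phi>. \<phi> \<circ> s) ` \<Phi> \<and> continuous_map euclideanreal euclideanreal (g q)) \<and>
           (\<forall>x\<in>topspace X. f x = (\<Sum>q=1..n. g q (\<phi> q x)))"
    proof (rule exI[of _ n], rule exI[of _ "\<lambda>q. \<phi> q \<circ> s"], rule exI[of _ g], intro conjI ballI)
      fix x assume x: "x \<in> topspace X"
      then show "f x = (\<Sum>q=1..n. g q ((\<phi> q \<circ> s) x))" using bspec[OF g(2) sY[OF x]] assms(3) by simp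
    qed (use g(1) in auto)
  qed
  then show ?thesis using \<Phi>(1) unfolding has_finite_basic_family_def by blast
qed

lemma has_finite_basic_family_of_power:
  assumes "I \<noteq> {}" "has_finite_basic_family (product_topology (\<lambda>_. X) I)"
  shows "has_finite_basic_family X"
proof -
  obtain i where i: "i \<in> I" using assms(1) by blast
  show ?thesis
  proof (rule has_finite_basic_family_retract[OF _ _ _ assms(2)])
    show "continuous_map X (product_topology (\<lambda>_. X) I) (\<lambda>x. restrict (\<lambda>_. x) I)"
      by (rule continuous_map_coordinatewise_then_product) auto
    show "continuous_map (product_topology (\<lambda>_. X) I) X (\<lambda>y. y i)"
      using i by (rule continuous_map_product_coordinates)
  qed (use i in simp)
qed

lemma has_finite_basic_family_singleton_power:
  assumes "has_finite_basic_family X"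
  shows "has_finite_basic_family (product_topology (\<lambda>_. X) {i})"
proof (rule has_finite_basic_family_retract[OF _ _ _ assms])
  show "continuous_map (product_topology (\<lambda>_. X) {i}) X (\<lambda>y. y i)"
    by (rule continuous_map_product_coordinates) simp
  show "continuous_map X (product_topology (\<lambda>_. X) {i}) (\<lambda>x. restrict (\<lambda>_. x) {i})"
    by (rule continuous_map_coordinatewise_then_product) auto
  fix y assume "y \<in> topspace (product_topology (\<lambda>_. X) {i})"
  then show "restrict (\<lambda>_. y i) {i} = y" by (auto simp: PiE_iff extensional_def fun_eq_iff)
qed

lemma superposition_property_imp_finite_basic_family:
  assumes "superposition_property X"
  shows "has_finite_basic_family X"
proof -
  let ?P = "product_topology (\<lambda>_. X) {1..1::nat}"
  have "\<exists>r\<ge>1. \<exists>\<psi> :: nat \<Rightarrow> nat \<Rightarrow> 'a \<Rightarrow> nat \<Rightarrow> real.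
        (\<forall>p\<in>{1..1}. \<forall>q\<in>{1..r}. continuous_map X (Euclidean_space 1) (\<psi> p q)) \<and>
        (\<forall>f. continuous_map ?P (Euclidean_space 1) f \<longrightarrow>
           (\<exists>g. (\<forall>q\<in>{1..r}. continuous_map (Euclidean_space 1) (Euclidean_space 1) (g q)) \<and>
                (\<forall>x\<in>topspace ?P. f x = (\<lambda>j. \<Sum>q=1..r. g q (\<lambda>i. \<Sum>p=1..1. \<psi> p q (x p) i) j))))"
    using assms[unfolded superposition_property_def, THEN spec, of 1] by simp
  then obtain r and \<psi> :: "nat \<Rightarrow> nat \<Rightarrow> 'a \<Rightarrow> nat \<Rightarrow> real" where r: "1 \<le> r"
    and \<psi>: "\<forall>p\<in>{1..1}. \<forall>q\<in>{1..r}. continuous_map X (Euclidean_space 1) (\<psi> p q)"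
    and rep: "\<forall>f. continuous_map ?P (Euclidean_space 1) f \<longrightarrow>
           (\<exists>g. (\<forall>q\<in>{1..r}. continuous_map (Euclidean_space 1) (Euclidean_space 1) (g q)) \<and>
                (\<forall>x\<in>topspace ?P. f x = (\<lambda>j. \<Sum>q=1..r. g q (\<lambda>i. \<Sum>p=1..1. \<psi> p q (x p) i) j)))"
    by (elim exE conjE)
  have coord: "continuous_map Z euclideanreal (\<lambda>z. h z 0)" if "continuous_map Z (Euclidean_space 1) h" for Z :: "'z topology" and h
    using that unfolding Euclidean_space_def continuous_map_in_subtopology continuous_map_componentwise_UNIV by blast
  \<comment> \<open>The identification of the real line with \<open>Euclidean_space 1\<close>, whose
    members vanish from index 1 on.\<close>
  define \<iota> where "\<iota> t i = (if i < 1 then t else 0)" for t :: real and i :: nat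
  have \<iota>: "continuous_map Z (Euclidean_space 1) (\<lambda>z. \<iota> (h z))" if "continuous_map Z euclideanreal h" for Z :: "'z topology" and h
    unfolding \<iota>_def[abs_def] continuous_map_componentwise_Euclidean_space using that by simp
  have \<psi>\<iota>: "\<psi> 1 q x = \<iota> (\<psi> 1 q x 0)" if "q \<in> {1..r}" "x \<in> topspace X" for q x
  proof -
    have "continuous_map X (Euclidean_space 1) (\<psi> 1 q)" using \<psi> that(1) by simp
    then have "\<psi> 1 q x \<in> topspace (Euclidean_space 1)"
      using that(2) by (meson continuous_map_image_subset_topspace image_subset_iff)
    then show ?thesis by (auto simp: topspace_Euclidean_space \<iota>_def fun_eq_iff)
  qed
  have "basic_family X ((\<lambda>q x. \<psi> 1 q x 0) ` {1..r})" unfolding basic_family_def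
  proof (intro conjI ballI allI impI)
    fix \<phi> assume "\<phi> \<in> (\<lambda>q x. \<psi> 1 q x 0) ` {1..r}"
    then obtain q where q: "q \<in> {1..r}" "\<phi> = (\<lambda>x. \<psi> 1 q x 0)" by (elim imageE)
    then have "continuous_map X (Euclidean_space 1) (\<psi> 1 q)" using \<psi> by simp
    then show "continuous_map X euclideanreal \<phi>" unfolding q(2) by (rule coord)
  next
    fix f assume f: "continuous_map X euclideanreal f"
    have "continuous_map ?P euclideanreal (f \<circ> (\<lambda>x. x 1))"
      by (rule continuous_map_compose[OF _ f]) (rule continuous_map_product_coordinates, simp)
    then have "continuous_map ?P (Euclidean_space 1) (\<lambda>x. \<iota> (f (x 1)))" using \<iota> by (simp add: o_def)
    from rep[THEN spec, THEN mp, OF this] obtain g where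
      g: "\<forall>q\<in>{1..r}. continuous_map (Euclidean_space 1) (Euclidean_space 1) (g q)"
      "\<forall>x\<in>topspace ?P. \<iota> (f (x 1)) = (\<lambda>j. \<Sum>q=1..r. g q (\<lambda>i. \<Sum>p=1..1. \<psi> p q (x p) i) j)" by (elim exE conjE)
    show "\<exists>(n::nat) \<phi> g. (\<forall>q\<in>{1..n}. \<phi> q \<in> (\<lambda>q x. \<psi> 1 q x 0) ` {1..r} \<and> continuous_map euclideanreal euclideanreal (g q)) \<and>
           (\<forall>x\<in>topspace X. f x = (\<Sum>q=1..n. g q (\<phi> q x)))"
    proof (rule exI[of _ r], rule exI[of _ "\<lambda>q x. \<psi> 1 q x 0"], rule exI[of _ "\<lambda>q t. g q (\<iota> t) 0"], intro conjI ballI)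
      fix q assume q: "q \<in> {1..r}"
      show "(\<lambda>x. \<psi> 1 q x 0) \<in> (\<lambda>q x. \<psi> 1 q x 0) ` {1..r}" using q by (rule imageI)
      have "continuous_map euclideanreal (Euclidean_space 1) (\<lambda>t. \<iota> t)" by (rule \<iota>) simp
      then have "continuous_map euclideanreal (Euclidean_space 1) (g q \<circ> \<iota>)"
        using bspec[OF g(1) q] by (rule continuous_map_compose)
      from coord[OF this] show "continuous_map euclideanreal euclideanreal (\<lambda>t. g q (\<iota> t) 0)" by (simp only: o_def)
    next
      fix x assume x: "x \<in> topspace X"
      have "(restrict (\<lambda>_. x) {1..1}) \<in> topspace ?P" using x by auto
      from fun_cong[OF bspec[OF g(2) this], of 0]
      have "f x = (\<Sum>q=1..r. g q (\<psi> 1 q x) 0)" by (simp add: \<iota>_def)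
      also have "\<dots> = (\<Sum>q=1..r. g q (\<iota> (\<psi> 1 q x 0)) 0)" using \<psi>\<iota>[OF _ x] by (intro sum.cong) simp_all
      finally show "f x = (\<Sum>q=1..r. g q (\<iota> (\<psi> 1 q x 0)) 0)" .
    qed
  qed
  then show ?thesis unfolding has_finite_basic_family_def by blast
qed

section \<open>From a finite basic family to a closed embedding\<close>

lemma Euclidean_space_eq_top_of_set: "Euclidean_space n = top_of_set {x. \<forall>i\<ge>n. x i = 0}"
  by (simp add: Euclidean_space_def euclidean_product_topology)

proposition finite_basic_family_imp_closed_embedding:
  assumes X: "tychonoff_space X" and "has_finite_basic_family X"
  shows "\<exists>l S. closedin (Euclidean_space l) S \<and> X homeomorphic_space subtopology (Euclidean_space l) S"
proof -
  obtain \<Phi> where \<Phi>: "finite \<Phi>" "basic_family X \<Phi>" using assms(2) unfolding has_finite_basic_family_def by blast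
  obtain \<phi> where \<phi>: "bij_betw \<phi> {0..<card \<Phi>} \<Phi>" using ex_bij_betw_nat_finite[OF \<Phi>(1)] by blast
  define l where "l = card \<Phi>"
  define h where "h x i = (if i < l then \<phi> i x else 0)" for x i
  have \<phi>c: "continuous_map X euclideanreal (\<phi> i)" if "i < l" for i
  proof -
    have "\<phi> i \<in> \<Phi>" using bij_betwE[OF \<phi>] that by (simp add: l_def)
    then show ?thesis using \<Phi>(2) unfolding basic_family_def by blast
  qed
  have hc: "continuous_map X euclidean h"
  proof (rule continuous_map_into_fun)
    fix i show "continuous_map X euclideanreal (\<lambda>x. h x i)"
      using \<phi>c[of i] by (cases "i < l") (simp_all add: h_def)
  qed
  have factor: "\<exists>G. continuous_on UNIV G \<and> (\<forall>x\<in>topspace X. f x = G (h x))" if f: "continuous_map X euclideanreal f" for f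
  proof -
    have "\<exists>(n::nat) \<theta> g. (\<forall>q\<in>{1..n}. \<theta> q \<in> \<Phi> \<and> continuous_map euclideanreal euclideanreal (g q)) \<and>
           (\<forall>x\<in>topspace X. f x = (\<Sum>q=1..n. g q (\<theta> q x)))"
      using \<Phi>(2) f unfolding basic_family_def by blast
    then obtain n :: nat and \<theta> g where g: "\<forall>q\<in>{1..n}. \<theta> q \<in> \<Phi> \<and> continuous_map euclideanreal euclideanreal (g q)"
      "\<forall>x\<in>topspace X. f x = (\<Sum>q=1..n. g q (\<theta> q x))" by (elim exE conjE)
    have "\<forall>q\<in>{1..n}. \<exists>i. i < l \<and> \<phi> i = \<theta> q"
    proof
      fix q assume "q \<in> {1..n}"
      then have "\<theta> q \<in> \<phi> ` {0..<card \<Phi>}" using g(1) bij_betw_imp_surj_on[OF \<phi>] by simp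
      then show "\<exists>i. i < l \<and> \<phi> i = \<theta> q" by (auto simp: l_def)
    qed
    from bchoice[OF this] obtain j where j: "\<forall>q\<in>{1..n}. j q < l \<and> \<phi> (j q) = \<theta> q" ..
    show ?thesis
    proof (intro exI[of _ "\<lambda>y. \<Sum>q=1..n. g q (y (j q))"] conjI ballI)
      show "continuous_on UNIV (\<lambda>y. \<Sum>q=1..n. g q (y (j q)))"
      proof (rule continuous_on_sum)
        fix q assume "q \<in> {1..n}"
        then have "continuous_on UNIV (g q)" using g(1) by simp
        then show "continuous_on UNIV (\<lambda>y. g q (y (j q)))" by (rule continuous_on_coordinate) simp
      qed
      fix x assume "x \<in> topspace X"
      then have "f x = (\<Sum>q=1..n. g q (\<theta> q x))" using g(2) by blast
      also have "\<dots> = (\<Sum>q=1..n. g q (h x (j q)))" using j by (intro sum.cong) (auto simp: h_def)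
      finally show "f x = (\<Sum>q=1..n. g q (h x (j q)))" .
    qed
  qed
  have sep: "\<exists>W. open W \<and> h x \<in> W \<and> (\<forall>z\<in>topspace X. h z \<in> W \<longrightarrow> z \<in> U)" if U: "openin X U" "x \<in> U" for U x
  proof -
    have xX: "x \<in> topspace X" using U openin_subset by blast
    have "closedin X (topspace X - U)" using U(1) by blast
    moreover have "x \<in> topspace X - (topspace X - U)" using xX U(2) by blast
    ultimately obtain f where f: "continuous_map X (top_of_set {0..1::real}) f" "f x = 0" "f ` (topspace X - U) \<subseteq> {1}"
      using X unfolding tychonoff_space_def completely_regular_space_def by meson
    have "continuous_map X euclideanreal f" using f(1) by (rule continuous_map_into_fulltopology)
    from factor[OF this] obtain G where G: "continuous_on UNIV G" "\<forall>x\<in>topspace X. f x = G (h x)" by blast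
    show ?thesis
    proof (intro exI[of _ "{y. G y < 1}"] conjI ballI impI)
      show "open {y. G y < 1}" using G(1) by (intro open_Collect_less continuous_on_const)
      show "h x \<in> {y. G y < 1}" using G(2) xX f(2) by simp
      fix z assume z: "z \<in> topspace X" "h z \<in> {y. G y < 1}"
      then have "f z \<noteq> 1" using G(2) by simp
      then show "z \<in> U" using f(3) z(1) by blast
    qed
  qed
  have inj: "inj_on h (topspace X)"
  proof (rule inj_onI, rule ccontr)
    fix x z assume xz: "x \<in> topspace X" "z \<in> topspace X" "h x = h z" "x \<noteq> z"
    obtain U V where "openin X U" "x \<in> U" "openin X V" "z \<in> V" "disjnt U V"
      using X xz unfolding tychonoff_space_def Hausdorff_space_def by meson
    then obtain W where "h x \<in> W" "\<forall>z\<in>topspace X. h z \<in> W \<longrightarrow> z \<in> U" using sep by blast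
    then have "z \<in> U" using xz by simp
    then show False using \<open>z \<in> V\<close> \<open>disjnt U V\<close> by (meson disjnt_iff)
  qed
  have homeo: "X homeomorphic_space top_of_set (h ` topspace X)"
    using hc inj sep by (rule homeomorphic_space_image_of_separating)
  have "closed (h ` topspace X)"
  proof (rule ccontr)
    assume "\<not> closed (h ` topspace X)"
    then obtain p where p: "p \<in> closure (h ` topspace X)" "p \<notin> h ` topspace X"
      unfolding closure_subset_eq[symmetric] by blast
    have "continuous_map X euclideanreal (\<lambda>x. 1 / dist (h x) p)"
    proof -
      have "continuous_on (- {p}) (\<lambda>y. 1 / dist y p)" by (intro continuous_intros) auto
      then have c: "continuous_map (top_of_set (- {p})) euclideanreal (\<lambda>y. 1 / dist y p)" by simp
      have "continuous_map X (top_of_set (- {p})) h"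
        using hc p(2) by (auto simp: continuous_map_in_subtopology)
      from continuous_map_compose[OF this c] show ?thesis by (simp only: o_def)
    qed
    from factor[OF this] obtain G where G: "continuous_on UNIV G" "\<forall>x\<in>topspace X. 1 / dist (h x) p = G (h x)" by blast
    have "continuous (at p) G" using G(1) by (simp add: continuous_on_eq_continuous_at)
    then obtain r where r: "r > 0" "\<forall>y. dist y p < r \<longrightarrow> dist (G y) (G p) < 1"
      unfolding continuous_at_eps_delta by (meson zero_less_one)
    \<comment> \<open>By continuity \<open>G\<close> stays below \<open>B\<close> near
      \<open>p\<close>, whereas the reciprocal distance exceeds \<open>B\<close> at image points
      closer than \<open>1 / B\<close>.\<close>
    define B where "B = \<bar>G p\<bar> + 1"
    have B: "B > 0" by (simp add: B_def)
    have "min r (1 / B) > 0" using r(1) B by simp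
    then obtain y where y: "y \<in> h ` topspace X" "dist y p < min r (1 / B)"
      using p(1) unfolding closure_approachable by blast
    then have pos: "dist y p > 0" using p(2) by auto
    have "1 / dist y p = G y" using G(2) y(1) by auto
    moreover have "dist (G y) (G p) < 1" using r(2) y(2) by simp
    then have "G y < B" unfolding B_def dist_real_def by linarith
    moreover have "B < 1 / dist y p" using y(2) pos B by (simp add: field_simps)
    ultimately show False by simp
  qed
  moreover have sub: "h ` topspace X \<subseteq> {x. \<forall>i\<ge>l. x i = 0}" by (auto simp: h_def)
  ultimately have "closedin (Euclidean_space l) (h ` topspace X)"
    by (simp add: closedin_Euclidean_space_iff topspace_Euclidean_space)
  moreover have "subtopology (Euclidean_space l) (h ` topspace X) = top_of_set (h ` topspace X)"
    using sub by (simp add: Euclidean_space_eq_top_of_set subtopology_subtopology Int_absorb1)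
  ultimately show ?thesis using homeo by (intro exI[of _ l] exI[of _ "h ` topspace X"]) simp
qed

subsection \<open>Closed subsets of Euclidean spaces\<close>

text \<open>A point lies in at most one set of each color. The colored families may be infinite
  while a finite refinement is required, so the sets of one color assigned to the same
  \<open>U\<close> are merged; a point still meets at most one merged set per color.\<close>

lemma covering_dimension_le_of_colored_covers:
  assumes \<Gamma>: "finite \<Gamma>"
    and cov: "\<And>\<U>. finite \<U> \<Longrightarrow> \<forall>U\<in>\<U>. openin X U \<Longrightarrow> \<Union>\<U> = topspace X \<Longrightarrow>
      \<exists>\<C>. (\<forall>\<gamma>\<in>\<Gamma>. disjoint (\<C> \<gamma>) \<and> (\<forall>C\<in>\<C> \<gamma>. openin X C \<and> (\<exists>U\<in>\<U>. C \<subseteq> U))) \<and> topspace X \<subseteq> (\<Union>\<gamma>\<in>\<Gamma>. \<Union>(\<C> \<gamma>))"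
  shows "covering_dimension_le X (card \<Gamma>)"
  unfolding covering_dimension_le_def
proof (intro allI impI, elim conjE)
  fix \<U> assume \<U>: "finite \<U>" "\<forall>U\<in>\<U>. openin X U" "\<Union>\<U> = topspace X"
  obtain \<C> where \<C>: "\<forall>\<gamma>\<in>\<Gamma>. disjoint (\<C> \<gamma>) \<and> (\<forall>C\<in>\<C> \<gamma>. openin X C \<and> (\<exists>U\<in>\<U>. C \<subseteq> U))"
    "topspace X \<subseteq> (\<Union>\<gamma>\<in>\<Gamma>. \<Union>(\<C> \<gamma>))"
    using cov[OF \<U>] by (elim exE conjE)
  define u where "u C = (SOME U. U \<in> \<U> \<and> C \<subseteq> U)" for C
  have u: "u C \<in> \<U> \<and> C \<subseteq> u C" if "\<gamma> \<in> \<Gamma>" "C \<in> \<C> \<gamma>" for \<gamma> C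
  proof -
    have "\<exists>U. U \<in> \<U> \<and> C \<subseteq> U" using \<C>(1) that by blast
    then show ?thesis unfolding u_def by (rule someI_ex)
  qed
  define V where "V \<gamma> U = \<Union>{C \<in> \<C> \<gamma>. u C = U}" for \<gamma> U
  show "\<exists>\<V>. finite \<V> \<and> (\<forall>V\<in>\<V>. openin X V) \<and> \<Union>\<V> = topspace X \<and> (\<forall>V\<in>\<V>. \<exists>U\<in>\<U>. V \<subseteq> U) \<and>
     (\<forall>x\<in>topspace X. card {V \<in> \<V>. x \<in> V} \<le> card \<Gamma> + 1)"
  proof (intro exI[of _ "(\<lambda>(\<gamma>, U). V \<gamma> U) ` (\<Gamma> \<times> \<U>)"] conjI ballI)
    show "finite ((\<lambda>(\<gamma>, U). V \<gamma> U) ` (\<Gamma> \<times> \<U>))" using \<Gamma> \<U>(1) by simp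
    have op: "openin X (V \<gamma> U)" if "\<gamma> \<in> \<Gamma>" for \<gamma> U
      unfolding V_def using \<C>(1) that by (intro openin_Union) blast
    show "openin X W" if "W \<in> (\<lambda>(\<gamma>, U). V \<gamma> U) ` (\<Gamma> \<times> \<U>)" for W
      using that op by auto
    show "\<exists>U\<in>\<U>. W \<subseteq> U" if W: "W \<in> (\<lambda>(\<gamma>, U). V \<gamma> U) ` (\<Gamma> \<times> \<U>)" for W
    proof -
      obtain \<gamma> U where g: "\<gamma> \<in> \<Gamma>" "U \<in> \<U>" "W = V \<gamma> U" using W by auto
      have "W \<subseteq> U" unfolding g(3) V_def using u[OF g(1)] by blast
      then show ?thesis using g(2) by blast
    qed
    show "\<Union> ((\<lambda>(\<gamma>, U). V \<gamma> U) ` (\<Gamma> \<times> \<U>)) = topspace X"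
    proof (intro equalityI subsetI)
      fix x assume "x \<in> \<Union> ((\<lambda>(\<gamma>, U). V \<gamma> U) ` (\<Gamma> \<times> \<U>))"
      then obtain \<gamma> U where "\<gamma> \<in> \<Gamma>" "x \<in> V \<gamma> U" by auto
      then show "x \<in> topspace X" using openin_subset[OF op] by blast
    next
      fix x assume "x \<in> topspace X"
      then obtain \<gamma> C where c: "\<gamma> \<in> \<Gamma>" "C \<in> \<C> \<gamma>" "x \<in> C" using \<C>(2) by blast
      then have "x \<in> V \<gamma> (u C)" by (auto simp: V_def)
      moreover have "(\<gamma>, u C) \<in> \<Gamma> \<times> \<U>" using c u by simp
      ultimately show "x \<in> \<Union> ((\<lambda>(\<gamma>, U). V \<gamma> U) ` (\<Gamma> \<times> \<U>))" by (intro UN_I[of "(\<gamma>, u C)"]) simp_all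
    qed
    fix x
    define w where "w \<gamma> = V \<gamma> (u (THE C. C \<in> \<C> \<gamma> \<and> x \<in> C))" for \<gamma>
    have "{W \<in> (\<lambda>(\<gamma>, U). V \<gamma> U) ` (\<Gamma> \<times> \<U>). x \<in> W} \<subseteq> w ` \<Gamma>"
    proof
      fix W assume "W \<in> {W \<in> (\<lambda>(\<gamma>, U). V \<gamma> U) ` (\<Gamma> \<times> \<U>). x \<in> W}"
      then obtain \<gamma> U where g: "\<gamma> \<in> \<Gamma>" "U \<in> \<U>" "W = V \<gamma> U" "x \<in> W" by auto
      then obtain C where C: "C \<in> \<C> \<gamma>" "u C = U" "x \<in> C" by (auto simp: V_def)
      have "disjoint (\<C> \<gamma>)" using \<C>(1) g(1) by blast
      then have "(THE C. C \<in> \<C> \<gamma> \<and> x \<in> C) = C"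
        using C by (intro the_equality) (auto simp: disjoint_def)
      then have "w \<gamma> = W" using g(3) C(2) by (simp add: w_def)
      then show "W \<in> w ` \<Gamma>" using g(1) by blast
    qed
    then have "card {W \<in> (\<lambda>(\<gamma>, U). V \<gamma> U) ` (\<Gamma> \<times> \<U>). x \<in> W} \<le> card (w ` \<Gamma>)"
      using \<Gamma> by (intro card_mono) auto
    also have "\<dots> \<le> card \<Gamma>" using \<Gamma> by (rule card_image_le)
    finally show "card {W \<in> (\<lambda>(\<gamma>, U). V \<gamma> U) ` (\<Gamma> \<times> \<U>). x \<in> W} \<le> card \<Gamma> + 1" by simp
  qed
qed

text \<open>A Lebesgue number exists only on bounded parts, so the mesh of the grid must vary from
  shell to shell, while the number of colors may not. Two shifts of the shells and one optional
  shift per coordinate make \<open>2 * 2 ^ l\<close> colors, independently of the cover.\<close>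

proposition finite_dimensional_closed_subset:
  fixes S :: "(nat \<Rightarrow> real) set"
  assumes S: "closed S" "S \<subseteq> {x. \<forall>i\<ge>l. x i = 0}"
  shows "finite_dimensional_space (top_of_set S)"
proof -
  define nm where "nm x = (\<Sum>i<l. \<bar>x i\<bar>)" for x :: "nat \<Rightarrow> real"
  have contnm: "continuous_on A nm" for A
    unfolding nm_def[abs_def] by (intro continuous_intros continuous_on_subset[OF continuous_on_product_coordinates]) auto
  have compQ: "compact {x \<in> S. nm x \<le> r}" for r
  proof -
    have "compact (PiE UNIV (\<lambda>i::nat. if i < l then {-r..r} else {0::real}))" by (rule compact_PiE_fun) simp
    moreover have "closed (S \<inter> {x. nm x \<le> r})" using S(1) by (intro closed_Int closed_Collect_le contnm continuous_on_const)
    moreover have "{x \<in> S. nm x \<le> r} = PiE UNIV (\<lambda>i::nat. if i < l then {-r..r} else {0::real}) \<inter> (S \<inter> {x. nm x \<le> r})"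
    proof (intro equalityI subsetI)
      fix x assume x: "x \<in> {x \<in> S. nm x \<le> r}"
      have "- r \<le> x i \<and> x i \<le> r" if "i < l" for i
      proof -
        have "\<bar>x i\<bar> \<le> nm x" unfolding nm_def using that by (intro member_le_sum) auto
        moreover have "nm x \<le> r" using x by simp
        ultimately show ?thesis by linarith
      qed
      then have "x i \<in> (if i < l then {-r..r} else {0})" for i
        using x S(2) by auto
      then show "x \<in> PiE UNIV (\<lambda>i::nat. if i < l then {-r..r} else {0::real}) \<inter> (S \<inter> {x. nm x \<le> r})" using x by auto
    qed auto
    ultimately show ?thesis by (simp only: compact_Int_closed)
  qed
  define \<Gamma> where "\<Gamma> = {0, 1::nat} \<times> Pow {..<l}"
  have "covering_dimension_le (top_of_set S) (card \<Gamma>)"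
  proof (rule covering_dimension_le_of_colored_covers)
    show "finite \<Gamma>" by (simp add: \<Gamma>_def)
    fix \<U> assume \<U>: "finite \<U>" "\<forall>U\<in>\<U>. openin (top_of_set S) U" "\<Union>\<U> = topspace (top_of_set S)"
    have "\<exists>e>0. \<forall>x\<in>{x \<in> S. nm x \<le> r}. \<exists>U\<in>\<U>. \<forall>y\<in>S. (\<forall>i<l. \<bar>x i - y i\<bar> < e) \<longrightarrow> y \<in> U" for r
    proof -
      define \<G> where "\<G> = {G. open G \<and> S \<inter> G \<in> \<U>}"
      have "{x \<in> S. nm x \<le> r} \<subseteq> \<Union>\<G>"
      proof
        fix x assume x: "x \<in> {x \<in> S. nm x \<le> r}"
        then obtain U where U: "U \<in> \<U>" "x \<in> U" using \<U>(3) by auto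
        then obtain G where "open G" "U = S \<inter> G" using \<U>(2) by (meson openin_open)
        then show "x \<in> \<Union>\<G>" using U by (auto simp: \<G>_def)
      qed
      then obtain \<delta> where \<delta>: "\<delta> > 0" "\<And>x. x \<in> {x \<in> S. nm x \<le> r} \<Longrightarrow> \<exists>G\<in>\<G>. ball x \<delta> \<subseteq> G"
        by (rule Heine_Borel_lemma[OF compQ]) (auto simp: \<G>_def)
      obtain e where e: "e > 0" "\<And>x y :: nat \<Rightarrow> real. (\<And>i. dist (x i) (y i) < e) \<Longrightarrow> dist x y < \<delta>"
        using dist_fun_less[OF \<delta>(1)] by blast
      show ?thesis
      proof (intro exI[of _ e] conjI ballI e(1))
        fix x assume x: "x \<in> {x \<in> S. nm x \<le> r}"
        obtain G where G: "G \<in> \<G>" "ball x \<delta> \<subseteq> G" using \<delta>(2)[OF x] by blast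
        show "\<exists>U\<in>\<U>. \<forall>y\<in>S. (\<forall>i<l. \<bar>x i - y i\<bar> < e) \<longrightarrow> y \<in> U"
        proof (intro bexI[of _ "S \<inter> G"] ballI impI)
          show "S \<inter> G \<in> \<U>" using G(1) by (simp add: \<G>_def)
          fix y assume y: "y \<in> S" "\<forall>i<l. \<bar>x i - y i\<bar> < e"
          have "dist (x i) (y i) < e" for i
          proof (cases "i < l")
            case False
            then have "x i = 0" "y i = 0" using x y(1) S(2) by auto
            then show ?thesis using e(1) by simp
          qed (use y(2) in \<open>simp add: dist_real_def\<close>)
          then have "y \<in> ball x \<delta>" using e(2)[of x y] by simp
          then show "y \<in> S \<inter> G" using G(2) y(1) by blast
        qed
      qed
    qed
    then have "\<forall>r. \<exists>e. e > 0 \<and> (\<forall>x\<in>{x \<in> S. nm x \<le> r}. \<exists>U\<in>\<U>. \<forall>y\<in>S. (\<forall>i<l. \<bar>x i - y i\<bar> < e) \<longrightarrow> y \<in> U)" by simp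
    from choice[OF this] obtain e where
      e: "\<forall>r. e r > 0 \<and> (\<forall>x\<in>{x \<in> S. nm x \<le> r}. \<exists>U\<in>\<U>. \<forall>y\<in>S. (\<forall>i<l. \<bar>x i - y i\<bar> < e r) \<longrightarrow> y \<in> U)" ..
    \<comment> \<open>A mesh that suits the bounded part containing shell number \<open>j\<close>,
      for both shifts.\<close>
    define \<eta> where "\<eta> j = e (2 * real j + 2)" for j :: nat
    have \<eta>pos: "\<eta> j > 0" for j using e by (simp add: \<eta>_def)
    define s where "s c i j x = x i / \<eta> j + (if i \<in> c then 1/2 else 0)" for c :: "nat set" and i j and x :: "nat \<Rightarrow> real"
    define cell where "cell \<gamma> j k = {x \<in> S. (2 * real j < nm x + real (fst \<gamma>) \<and> nm x + real (fst \<gamma>) < 2 * real j + 2) \<and>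
       (\<forall>i\<in>{..<l}. of_int (k i) < s (snd \<gamma>) i j x \<and> s (snd \<gamma>) i j x < of_int (k i) + 1)}"
      for \<gamma> :: "nat \<times> nat set" and j and k :: "nat \<Rightarrow> int"
    \<comment> \<open>Grid boxes inside the shells \<open>2 * j < nm x + \<sigma> < 2 * j + 2\<close>, with a mesh that depends on the shell;
     \<open>\<sigma>\<close> and \<open>c\<close> shift the shells and the grid by half a period.\<close>
  define \<C> where "\<C> \<gamma> = {cell \<gamma> j k |j k. cell \<gamma> j k \<noteq> {}}" for \<gamma>
    have op: "openin (top_of_set S) (cell \<gamma> j k)" for \<gamma> j k
    proof -
      have cs: "continuous_on UNIV (\<lambda>x. s c i j x)" for c i
        unfolding s_def using \<eta>pos[of j] by (intro continuous_intros continuous_on_product_coordinates) simp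
      have "open ({x. 2 * real j < nm x + real (fst \<gamma>)} \<inter> {x. nm x + real (fst \<gamma>) < 2 * real j + 2} \<inter>
        (\<Inter>i\<in>{..<l}. {x. of_int (k i) < s (snd \<gamma>) i j x} \<inter> {x. s (snd \<gamma>) i j x < of_int (k i) + 1}))"
        by (intro open_Int open_INT ballI finite_lessThan open_Collect_less continuous_intros contnm cs)
      moreover have "cell \<gamma> j k = S \<inter> ({x. 2 * real j < nm x + real (fst \<gamma>)} \<inter> {x. nm x + real (fst \<gamma>) < 2 * real j + 2} \<inter>
        (\<Inter>i\<in>{..<l}. {x. of_int (k i) < s (snd \<gamma>) i j x} \<inter> {x. s (snd \<gamma>) i j x < of_int (k i) + 1}))"
        by (auto simp: cell_def)
      ultimately show ?thesis by (simp only: openin_open_Int)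
    qed
    have disj: "cell \<gamma> j k = cell \<gamma> j' k'" if "x \<in> cell \<gamma> j k" "x \<in> cell \<gamma> j' k'" for x \<gamma> j j' k k'
    proof -
      have "2 * real j < 2 * real j' + 2" "2 * real j' < 2 * real j + 2" using that by (auto simp: cell_def)
      then have j: "j = j'" by linarith
      have kk: "k i = k' i" if i: "i \<in> {..<l}" for i
      proof -
        have "of_int (k i) < s (snd \<gamma>) i j x" "s (snd \<gamma>) i j x < of_int (k i) + 1"
          "of_int (k' i) < s (snd \<gamma>) i j x" "s (snd \<gamma>) i j x < of_int (k' i) + 1"
          using \<open>x \<in> cell \<gamma> j k\<close> \<open>x \<in> cell \<gamma> j' k'\<close> i unfolding j cell_def by blast+
        then have "real_of_int (k i) < real_of_int (k' i) + 1" "real_of_int (k' i) < real_of_int (k i) + 1" by linarith+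
        then show ?thesis by linarith
      qed
      show ?thesis unfolding cell_def j
        by (intro Collect_cong arg_cong2[of _ _ _ _ "(\<and>)"] ball_cong refl) (simp_all only: kk)
    qed
    have sub: "\<exists>U\<in>\<U>. C \<subseteq> U" if C: "C \<in> \<C> \<gamma>" for C \<gamma>
    proof -
      obtain j k x where x: "C = cell \<gamma> j k" "x \<in> C" using C by (auto simp: \<C>_def)
      then have "x \<in> {x \<in> S. nm x \<le> 2 * real j + 2}" by (auto simp: cell_def)
      then obtain U where U: "U \<in> \<U>" "\<forall>y\<in>S. (\<forall>i<l. \<bar>x i - y i\<bar> < \<eta> j) \<longrightarrow> y \<in> U"
        using e unfolding \<eta>_def by blast
      have "y \<in> U" if y: "y \<in> C" for y
      proof -
        have "\<bar>x i - y i\<bar> < \<eta> j" if i: "i < l" for i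
        proof -
          have "of_int (k i) < s (snd \<gamma>) i j x" "s (snd \<gamma>) i j x < of_int (k i) + 1"
            "of_int (k i) < s (snd \<gamma>) i j y" "s (snd \<gamma>) i j y < of_int (k i) + 1"
            using x y i unfolding cell_def by blast+
          then have "\<bar>s (snd \<gamma>) i j x - s (snd \<gamma>) i j y\<bar> < 1" by linarith
          then have "\<bar>(x i - y i) / \<eta> j\<bar> < 1" by (simp add: s_def diff_divide_distrib)
          then show ?thesis using \<eta>pos[of j] by (simp add: abs_divide)
        qed
        moreover have "y \<in> S" using y x(1) by (simp add: cell_def)
        ultimately show ?thesis using U(2) by blast
      qed
      then show ?thesis using U(1) by blast
    qed
    have cover: "\<exists>\<gamma>\<in>\<Gamma>. x \<in> \<Union>(\<C> \<gamma>)" if x: "x \<in> S" for x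
    proof -
      have nm0: "nm x \<ge> 0" unfolding nm_def by (intro sum_nonneg) simp
      have "\<exists>\<sigma>\<in>{0,1::nat}. \<exists>j::nat. 2 * real j < nm x + real \<sigma> \<and> nm x + real \<sigma> < 2 * real j + 2"
      proof (cases "nm x / 2 = of_int \<lfloor>nm x / 2\<rfloor>")
        case True
        define j where "j = nat \<lfloor>nm x / 2\<rfloor>"
        have "real j = nm x / 2" using True nm0 unfolding j_def by simp
        then show ?thesis by (intro bexI[of _ 1] exI[of _ j]) auto
      next
        case False
        define j where "j = nat \<lfloor>nm x / 2\<rfloor>"
        have "real j = of_int \<lfloor>nm x / 2\<rfloor>" using nm0 unfolding j_def by simp
        then have "real j < nm x / 2" "nm x / 2 < real j + 1" using False by linarith+
        then show ?thesis by (intro bexI[of _ 0] exI[of _ j]) auto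
      qed
      then obtain \<sigma> j where j: "\<sigma> \<in> {0,1::nat}" "2 * real j < nm x + real \<sigma>" "nm x + real \<sigma> < 2 * real j + 2" by blast
      \<comment> \<open>The grid is shifted in exactly those coordinates in which \<open>x\<close>
        lies on a wall; half a mesh away it no longer does.\<close>
      define c where "c = {i. i < l \<and> x i / \<eta> j \<in> \<int>}"
      define k where "k i = \<lfloor>s c i j x\<rfloor>" for i
      have "of_int (k i) < s c i j x \<and> s c i j x < of_int (k i) + 1" if i: "i \<in> {..<l}" for i
      proof -
        have "s c i j x \<notin> \<int>"
        proof (cases "i \<in> c")
          case True
          then obtain n where "x i / \<eta> j = of_int n" unfolding c_def by (auto elim: Ints_cases)
          then have sn: "s c i j x = of_int n + 1/2" using True by (simp add: s_def)
          show ?thesis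
          proof
            assume "s c i j x \<in> \<int>"
            then obtain n' where "s c i j x = of_int n'" by (elim Ints_cases)
            then have "real_of_int (2 * n') = real_of_int (2 * n + 1)" using sn by simp
            then have "2 * n' = 2 * n + 1" by (simp only: of_int_eq_iff)
            then show False by presburger
          qed
        next
          case False
          then show ?thesis using i by (simp add: s_def c_def)
        qed
        then have "s c i j x \<noteq> of_int (k i)" by (metis Ints_of_int)
        then show ?thesis unfolding k_def by linarith
      qed
      then have "x \<in> cell (\<sigma>, c) j k" using j(2,3) x unfolding cell_def by simp
      then have "x \<in> \<Union>(\<C> (\<sigma>, c))" unfolding \<C>_def by blast
      moreover have "(\<sigma>, c) \<in> \<Gamma>" using j(1) by (auto simp: \<Gamma>_def c_def)
      ultimately show ?thesis by blast
    qed
    have dj: "disjoint (\<C> \<gamma>)" for \<gamma>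
    proof (rule disjointI)
      fix C C' assume C: "C \<in> \<C> \<gamma>" "C' \<in> \<C> \<gamma>" "C \<noteq> C'"
      then obtain j k j' k' where "C = cell \<gamma> j k" "C' = cell \<gamma> j' k'" unfolding \<C>_def by blast
      then show "C \<inter> C' = {}" using disj[of _ \<gamma> j k j' k'] C(3) by auto
    qed
    show "\<exists>\<C>. (\<forall>\<gamma>\<in>\<Gamma>. disjoint (\<C> \<gamma>) \<and> (\<forall>C\<in>\<C> \<gamma>. openin (top_of_set S) C \<and> (\<exists>U\<in>\<U>. C \<subseteq> U))) \<and>
      topspace (top_of_set S) \<subseteq> (\<Union>\<gamma>\<in>\<Gamma>. \<Union>(\<C> \<gamma>))"
    proof (intro exI[of _ \<C>] conjI ballI dj sub)
      show "openin (top_of_set S) C" if C: "C \<in> \<C> \<gamma>" for C \<gamma>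
      proof -
        obtain j k where "C = cell \<gamma> j k" using C unfolding \<C>_def by blast
        then show ?thesis by (simp only: op)
      qed
      show "topspace (top_of_set S) \<subseteq> (\<Union>\<gamma>\<in>\<Gamma>. \<Union>(\<C> \<gamma>))"
      proof
        fix x assume "x \<in> topspace (top_of_set S)"
        then have "x \<in> S" by simp
        from cover[OF this] show "x \<in> (\<Union>\<gamma>\<in>\<Gamma>. \<Union>(\<C> \<gamma>))" by (simp only: UN_iff)
      qed
    qed
  qed
  then show ?thesis unfolding finite_dimensional_space_def by (rule exI)
qed

subsection \<open>The equivalence\<close>

text \<open>Scalar superposition yields the one for vectors of any length. The inner functions
  depend on the space alone, so they serve all coordinates of \<open>f\<close>: they are placed in
  coordinate 0, the outer functions read only that coordinate, and each coordinate of
  \<open>f\<close> has its own scalar outer functions.\<close>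

lemma superposition_property_of_homeomorphic:
  fixes X :: "'a topology" and Z :: "'b::topological_space set"
  assumes homeo: "X homeomorphic_space top_of_set Z"
    and Z: "\<And>m. m \<ge> 1 \<Longrightarrow> \<exists>r\<ge>1. \<exists>\<psi> :: nat \<Rightarrow> nat \<Rightarrow> 'b \<Rightarrow> real. (\<forall>p\<in>{1..m}. \<forall>q\<in>{1..r}. continuous_on Z (\<psi> p q)) \<and>
      (\<forall>f :: (nat \<Rightarrow> 'b) \<Rightarrow> real. continuous_on (PiE {1..m} (\<lambda>_. Z)) f \<longrightarrow>
        (\<exists>g. (\<forall>q\<in>{1..r}. continuous_on UNIV (g q)) \<and>
          (\<forall>x\<in>PiE {1..m} (\<lambda>_. Z). f x = (\<Sum>q=1..r. g q (\<Sum>p=1..m. \<psi> p q (x p))))))"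
  shows "superposition_property X"
  unfolding superposition_property_def
proof (intro allI impI)
  fix m n :: nat assume m: "m \<ge> 1" and n: "n \<ge> 1"
  let ?P = "product_topology (\<lambda>_. X) {1..m}"
  obtain e e' where e: "continuous_map X (top_of_set Z) e" "continuous_map (top_of_set Z) X e'"
    "\<And>x. x \<in> topspace X \<Longrightarrow> e' (e x) = x"
    using homeo unfolding homeomorphic_space_def homeomorphic_maps_def by auto
  have eZ: "e x \<in> Z" if "x \<in> topspace X" for x
    using continuous_map_image_subset_topspace[OF e(1)] that by auto
  obtain r and \<psi> :: "nat \<Rightarrow> nat \<Rightarrow> 'b \<Rightarrow> real" where r: "r \<ge> 1"
    and \<psi>: "\<forall>p\<in>{1..m}. \<forall>q\<in>{1..r}. continuous_on Z (\<psi> p q)"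
    and rep: "\<forall>f :: (nat \<Rightarrow> 'b) \<Rightarrow> real. continuous_on (PiE {1..m} (\<lambda>_. Z)) f \<longrightarrow>
        (\<exists>g. (\<forall>q\<in>{1..r}. continuous_on UNIV (g q)) \<and>
          (\<forall>x\<in>PiE {1..m} (\<lambda>_. Z). f x = (\<Sum>q=1..r. g q (\<Sum>p=1..m. \<psi> p q (x p)))))"
    using Z[OF m] by (elim exE conjE)
  define \<Psi> where "\<Psi> p q x i = (if i < n then (if i = 0 then \<psi> p q (e x) else 0) else 0)" for p q x and i :: nat
  have coord: "continuous_map Y euclideanreal (\<lambda>y. h y j)" if "continuous_map Y (Euclidean_space n) h" for Y :: "'y topology" and h j
    using that unfolding Euclidean_space_def continuous_map_in_subtopology continuous_map_componentwise_UNIV by blast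
  show "\<exists>r\<ge>1. \<exists>\<psi> :: nat \<Rightarrow> nat \<Rightarrow> 'a \<Rightarrow> nat \<Rightarrow> real.
        (\<forall>p\<in>{1..m}. \<forall>q\<in>{1..r}. continuous_map X (Euclidean_space n) (\<psi> p q)) \<and>
        (\<forall>f. continuous_map ?P (Euclidean_space n) f \<longrightarrow>
           (\<exists>g. (\<forall>q\<in>{1..r}. continuous_map (Euclidean_space n) (Euclidean_space n) (g q)) \<and>
                (\<forall>x\<in>topspace ?P. f x = (\<lambda>j. \<Sum>q=1..r. g q (\<lambda>i. \<Sum>p=1..m. \<psi> p q (x p) i) j))))"
  proof (rule exI[of _ r], intro conjI r, rule exI[of _ \<Psi>], intro conjI ballI allI impI)
    fix p q assume pq: "p \<in> {1..m}" "q \<in> {1..r}"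
    then have "continuous_map (top_of_set Z) euclideanreal (\<psi> p q)" using \<psi> by simp
    from continuous_map_compose[OF e(1) this] have "continuous_map X euclideanreal (\<lambda>x. \<psi> p q (e x))" by (simp only: o_def)
    then show "continuous_map X (Euclidean_space n) (\<Psi> p q)"
      unfolding \<Psi>_def[abs_def] continuous_map_componentwise_Euclidean_space by simp
  next
    fix f assume f: "continuous_map ?P (Euclidean_space n) f"
    define F where "F j y = f (\<lambda>p\<in>{1..m}. e' (y p)) j" for j and y :: "nat \<Rightarrow> 'b"
    have "continuous_map (top_of_set (PiE {1..m} (\<lambda>_. Z))) ?P (\<lambda>y. \<lambda>p\<in>{1..m}. e' (y p))"
    proof (rule continuous_map_coordinatewise_then_product)
      fix p assume p: "p \<in> {1..m}"
      have "continuous_map (top_of_set (PiE {1..m} (\<lambda>_. Z))) (top_of_set Z) (\<lambda>y. y p)"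
        using p by (auto simp: continuous_map_in_subtopology intro: continuous_on_subset[OF continuous_on_product_coordinates])
      from continuous_map_compose[OF this e(2)] show "continuous_map (top_of_set (PiE {1..m} (\<lambda>_. Z))) X (\<lambda>y. (\<lambda>p\<in>{1..m}. e' (y p)) p)"
        using p by (simp add: o_def)
    qed auto
    from continuous_map_compose[OF this f]
    have "continuous_map (top_of_set (PiE {1..m} (\<lambda>_. Z))) (Euclidean_space n) (\<lambda>y. f (\<lambda>p\<in>{1..m}. e' (y p)))" by (simp only: o_def)
    from coord[OF this] have Fc: "continuous_on (PiE {1..m} (\<lambda>_. Z)) (F j)" for j
      unfolding F_def[abs_def] by simp
    have "\<forall>j. \<exists>g. (\<forall>q\<in>{1..r}. continuous_on UNIV (g q)) \<and>
          (\<forall>x\<in>PiE {1..m} (\<lambda>_. Z). F j x = (\<Sum>q=1..r. g q (\<Sum>p=1..m. \<psi> p q (x p))))"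
      using rep Fc by blast
    from choice[OF this] obtain g where g: "\<forall>j. (\<forall>q\<in>{1..r}. continuous_on UNIV (g j q)) \<and>
          (\<forall>x\<in>PiE {1..m} (\<lambda>_. Z). F j x = (\<Sum>q=1..r. g j q (\<Sum>p=1..m. \<psi> p q (x p))))" ..
    define G where "G q v j = (if j < n then g j q (v 0) else 0)" for q and v :: "nat \<Rightarrow> real" and j
    show "\<exists>g. (\<forall>q\<in>{1..r}. continuous_map (Euclidean_space n) (Euclidean_space n) (g q)) \<and>
                (\<forall>x\<in>topspace ?P. f x = (\<lambda>j. \<Sum>q=1..r. g q (\<lambda>i. \<Sum>p=1..m. \<Psi> p q (x p) i) j))"
    proof (intro exI[of _ G] conjI ballI)
      fix q assume q: "q \<in> {1..r}"
      have "continuous_map (Euclidean_space n) euclideanreal (\<lambda>v. g j q (v 0))" for j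
      proof -
        have "continuous_map (Euclidean_space n) (Euclidean_space n) (\<lambda>v. v)" by simp
        from coord[OF this] have "continuous_map (Euclidean_space n) euclideanreal (\<lambda>v. v 0)" .
        moreover have "continuous_map euclideanreal euclideanreal (g j q)" using g q by simp
        ultimately have "continuous_map (Euclidean_space n) euclideanreal (g j q \<circ> (\<lambda>v. v 0))" by (rule continuous_map_compose)
        then show ?thesis by (simp only: o_def)
      qed
      then show "continuous_map (Euclidean_space n) (Euclidean_space n) (G q)"
        unfolding G_def[abs_def] continuous_map_componentwise_Euclidean_space by simp
    next
      fix x assume x: "x \<in> topspace ?P"
      then have xX: "x p \<in> topspace X" if "p \<in> {1..m}" for p using that by (auto simp: PiE_iff)
      define y where "y = (\<lambda>p\<in>{1..m}. e (x p))"
      have y: "y \<in> PiE {1..m} (\<lambda>_. Z)" unfolding y_def using eZ[OF xX] by simp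
      have "(\<lambda>p\<in>{1..m}. e' (y p)) = x"
      proof
        fix p show "(\<lambda>p\<in>{1..m}. e' (y p)) p = x p"
          using x e(3)[OF xX] by (cases "p \<in> {1..m}") (auto simp: y_def PiE_iff extensional_def)
      qed
      then have Fy: "F j y = f x j" for j by (simp add: F_def)
      show "f x = (\<lambda>j. \<Sum>q=1..r. G q (\<lambda>i. \<Sum>p=1..m. \<Psi> p q (x p) i) j)"
      proof
        fix j
        show "f x j = (\<Sum>q=1..r. G q (\<lambda>i. \<Sum>p=1..m. \<Psi> p q (x p) i) j)"
        proof (cases "j < n")
          case True
          have "f x j = (\<Sum>q=1..r. g j q (\<Sum>p=1..m. \<psi> p q (y p)))" using g y Fy[of j] by simp
          also have "\<dots> = (\<Sum>q=1..r. G q (\<lambda>i. \<Sum>p=1..m. \<Psi> p q (x p) i) j)"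
          proof (rule sum.cong[OF refl])
            fix q
            have "(\<Sum>p=1..m. \<psi> p q (y p)) = (\<Sum>p=1..m. \<Psi> p q (x p) 0)"
              using n by (intro sum.cong) (auto simp: y_def \<Psi>_def)
            then show "g j q (\<Sum>p=1..m. \<psi> p q (y p)) = G q (\<lambda>i. \<Sum>p=1..m. \<Psi> p q (x p) i) j"
              using True by (simp add: G_def)
          qed
          finally show ?thesis .
        next
          case False
          have "f x \<in> topspace (Euclidean_space n)"
            using continuous_map_image_subset_topspace[OF f] x by blast
          then show ?thesis using False by (simp add: G_def topspace_Euclidean_space)
        qed
      qed
    qed
  qed
qed

proposition superposition_property_of_finite_dimensional:
  assumes "locally_compact_space X" "finite_dimensional_space X" "separable_space X" "metrizable_space X"
  shows "superposition_property X"
proof -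
  obtain K :: "(nat \<Rightarrow> real) set" and \<omega> where K: "compact K" "X homeomorphic_space top_of_set (K - {\<omega>})"
    using one_point_compactification_in_real_sequences[OF assms(1,3,4)] .
  obtain d where "covering_dimension_le X d" using assms(2) unfolding finite_dimensional_space_def by blast
  then have "covering_dimension_le (top_of_set (K - {\<omega>})) d" using K(2) by (rule covering_dimension_le_homeomorphic[rotated])
  then have "colorable K (d + 2)" by (rule colorable_of_covering_dimension[OF K(1)])
  then show ?thesis
    by (intro superposition_property_of_homeomorphic[OF K(2)] superposition_power[OF K(1)])
qed

lemma second_countable_euclidean: "second_countable (euclidean :: 'b::second_countable_topology topology)"
proof -
  obtain B :: "'b set set" where B: "countable B" "topological_basis B" using ex_countable_basis by blast
  show ?thesis unfolding second_countable_def
  proof (intro exI[of _ B] conjI ballI allI impI)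
    show "openin euclidean V" if "V \<in> B" for V using topological_basis_open[OF B(2) that] by simp
    show "\<exists>V\<in>B. x \<in> V \<and> V \<subseteq> U" if "openin euclidean U \<and> x \<in> U" for U x
      using topological_basisE[OF B(2), of U x] that by (metis open_openin)
  qed fact
qed

lemma closed_subset_of_Euclidean_space:
  assumes S: "closedin (Euclidean_space l) S" and X: "X homeomorphic_space subtopology (Euclidean_space l) S"
  shows "locally_compact_space X" "finite_dimensional_space X" "separable_space X" "metrizable_space X"
proof -
  have clS: "closed S" "S \<subseteq> {x. \<forall>i\<ge>l. x i = 0}"
    using S by (auto simp: closedin_Euclidean_space_iff topspace_Euclidean_space)
  then have eq: "subtopology (Euclidean_space l) S = top_of_set S"
    by (simp add: Euclidean_space_eq_top_of_set subtopology_subtopology Int_absorb1)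
  have X': "X homeomorphic_space top_of_set S" using X eq by simp
  have "locally_compact_space (subtopology (Euclidean_space l) S)"
    using locally_compact_Euclidean_space S by (rule locally_compact_space_closed_subset)
  then show "locally_compact_space X" using homeomorphic_locally_compact_space[OF X] by simp
  obtain d where "covering_dimension_le (top_of_set S) d"
    using finite_dimensional_closed_subset[OF clS] unfolding finite_dimensional_space_def by blast
  then have "covering_dimension_le X d"
    by (rule covering_dimension_le_homeomorphic[OF X'[unfolded homeomorphic_space_sym[of X]]])
  then show "finite_dimensional_space X" unfolding finite_dimensional_space_def by blast
  have "separable_space (top_of_set S)"
    by (intro second_countable_imp_separable_space second_countable_subtopology second_countable_euclidean)
  then show "separable_space X" using homeomorphic_separable_space[OF X'] by simp
  have "metrizable_space (top_of_set S)" by (intro metrizable_space_subtopology metrizable_space_euclidean)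
  then show "metrizable_space X" using homeomorphic_metrizable_space[OF X'] by simp
qed

(* 'i is an arbitrary type, so the nonempty index sets I range over all cardinals \<ge> 1;
   the other conditions do not mention 'i. *)
theorem theorem4:
  fixes X :: "'a topology"
  assumes "tychonoff_space X"
  shows
    "((\<exists>I :: 'i set. I \<noteq> {} \<and> has_finite_basic_family (product_topology (\<lambda>_. X) I))
        \<longleftrightarrow> superposition_property X) \<and>
     (superposition_property X
        \<longleftrightarrow> locally_compact_space X \<and> finite_dimensional_space X \<and>
            separable_space X \<and> metrizable_space X) \<and>
     (locally_compact_space X \<and> finite_dimensional_space X \<and>
      separable_space X \<and> metrizable_space X
        \<longleftrightarrow> (\<exists>l S. closedin (Euclidean_space l) S \<and>
                   X homeomorphic_space subtopology (Euclidean_space l) S))"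
proof -
  let ?A = "\<exists>I :: 'i set. I \<noteq> {} \<and> has_finite_basic_family (product_topology (\<lambda>_. X) I)"
  let ?B = "superposition_property X"
  let ?C = "locally_compact_space X \<and> finite_dimensional_space X \<and> separable_space X \<and> metrizable_space X"
  let ?D = "\<exists>l S. closedin (Euclidean_space l) S \<and> X homeomorphic_space subtopology (Euclidean_space l) S"
  have CB: "?C \<Longrightarrow> ?B" by (elim conjE) (rule superposition_property_of_finite_dimensional)
  \<comment> \<open>Every type is inhabited, so a one-point index set exists whatever
    \<open>'i\<close> is.\<close>
  have BA: "?B \<Longrightarrow> ?A"
    by (rule exI[of _ "{undefined}"], rule conjI[OF insert_not_empty])
      (rule has_finite_basic_family_singleton_power[OF superposition_property_imp_finite_basic_family])
  have AD: "?A \<Longrightarrow> ?D"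
    by (elim exE conjE) (rule finite_basic_family_imp_closed_embedding[OF assms has_finite_basic_family_of_power])
  have DC: "?D \<Longrightarrow> ?C" by (elim exE conjE) (intro conjI closed_subset_of_Euclidean_space)
  show ?thesis
  proof (intro conjI iffI)
    show ?B if ?A using CB[OF DC[OF AD[OF that]]] .
    show ?A if ?B using BA[OF that] .
    show ?B if ?C using CB[OF that] .
    show ?D if ?C using AD[OF BA[OF CB[OF that]]] .
    assume B: ?B
    from DC[OF AD[OF BA[OF B]]] show "locally_compact_space X" "finite_dimensional_space X"
      "separable_space X" "metrizable_space X" by blast+
  next
    assume D: ?D
    from DC[OF D] show "locally_compact_space X" "finite_dimensional_space X"
      "separable_space X" "metrizable_space X" by blast+
  qed
qed

end
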